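(* There is a fully polynomial-time approximation scheme (FPTAS) for (BMFNI) on two-terminal series-parallel graphs with unit interdiction costs (i.e. $c(a)=1$ for all arcs $a$), constructing an $\varepsilon$-approximation of the set of non-dominated points. That is, there is an algorithm which, given any instance $(G,u,c,B)$ of (BMFNI) with $G$ two-terminal series-parallel and $c(a)=1$ for all arcs $a$, and any rational $\varepsilon>0$, returns an $\varepsilon$-approximation of the set of non-dominated points in time polynomial in the encoding size of the instance and in $\frac1\varepsilon$.
   Context: $\mathbb{N}$ includes $0$. Graphs are directed and parallel arcs are allowed. An instance $(G,u,c,B)$ of the biobjective maximum flow network interdiction problem (BMFNI) consists of a directed graph $G=(V,A)$ with $m=|A|$ arcs, a source $s\in V$ and a sink $t\in V$, $s\neq t$, two arc capacity functions $u=(u^1,u^2)\colon A\to\mathbb{N}^2$, interdiction costs $c(a)\in\mathbb{N}$ for $a\in A$, and an interdiction budget $B\in\mathbb{N}$. Numbers are encoded in binary. The set of feasible interdiction strategies is $\Gamma=\{\gamma=(\gamma_a)_{a\in A}\in\{0,1\}^m \mid \sum_{a\in A}c(a)\gamma_a\leq B\}$. For $\gamma\in\Gamma$, let $A(\gamma)=\{a\in A\mid\gamma_a=1\}$ be the set of interdicted arcs and $G(\gamma)=(V,A\setminus A(\gamma))$ the interdicted graph. For a capacity function $w$, $\mathrm{VAL}(G(\gamma),w)$ is the maximum value of an $s$-$t$-flow in $G(\gamma)$ with respect to the capacities $w$, and $\mathrm{VAL}(G(\gamma),u)=(\mathrm{VAL}(G(\gamma),u^1),\mathrm{VAL}(G(\gamma),u^2))$.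 For $y,z\in\mathbb{R}^2$, $y\leqq z$ means $y_k\leq z_k$ for $k=1,2$. A strategy $\gamma\in\Gamma$ $\varepsilon$-approximates $\gamma'\in\Gamma$ (for $\varepsilon>0$) if $\mathrm{VAL}(G(\gamma),u)\leqq(1+\varepsilon)\,\mathrm{VAL}(G(\gamma'),u)$. A set $\mathcal{A}\subseteq\Gamma$ is an $\varepsilon$-approximation of the set of non-dominated points if for every $\gamma\in\Gamma$ there is an $a\in\mathcal{A}$ that $\varepsilon$-approximates $\gamma$. A directed graph with source $s$ and sink $t$ is two-terminal series-parallel if it can be built by the following operations: (i) the primitive graph with vertices $s,t$ and single arc $(s,t)$; (ii) parallel composition of two such graphs $G_1$ (source $s_1$, sink $t_1$) and $G_2$ (source $s_2$, sink $t_2$), identifying $s=s_1=s_2$ and $t=t_1=t_2$; (iii) series composition, identifying $s=s_1$, $t_1=s_2$, $t=t_2$. *)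

theory Defs
  imports
    Complex_Main
    "HOL-Library.FuncSet"
    "HOL-Library.Log_Nat"
    "HOL-Computational_Algebra.Polynomial"
    "Graph_Theory.Digraph_Component"
begin

definition is_flow ::
  "('a, 'b) pre_digraph \<Rightarrow> 'a \<Rightarrow> 'a \<Rightarrow> ('b \<Rightarrow> real) \<Rightarrow> ('b \<Rightarrow> real) \<Rightarrow> bool" where
  "is_flow G s t w f \<longleftrightarrow>
     (\<forall>a\<in>arcs G. 0 \<le> f a \<and> f a \<le> w a) \<and>
     (\<forall>v\<in>verts G - {s, t}. (\<Sum>a\<in>in_arcs G v. f a) = (\<Sum>a\<in>out_arcs G v. f a))"

definition flow_value :: "('a, 'b) pre_digraph \<Rightarrow> 'a \<Rightarrow> ('b \<Rightarrow> real) \<Rightarrow> real" where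
  "flow_value G s f = (\<Sum>a\<in>out_arcs G s. f a) - (\<Sum>a\<in>in_arcs G s. f a)"

text \<open>For a finite graph with nonnegative capacities the set below is nonempty and compact,
  so its supremum is the maximum flow value.\<close>

definition max_flow :: "('a, 'b) pre_digraph \<Rightarrow> 'a \<Rightarrow> 'a \<Rightarrow> ('b \<Rightarrow> real) \<Rightarrow> real" where
  "max_flow G s t w = Sup {flow_value G s f |f. is_flow G s t w f}"

text \<open>The vertices shared by two components are exactly the terminals that the composition
  identifies. Since vertex and arc names are arbitrary, every abstract composition (disjoint
  copies followed by identification of terminals) arises in this way up to renaming.\<close>

inductive two_terminal_sp :: "('a, 'b) pre_digraph \<Rightarrow> 'a \<Rightarrow> 'a \<Rightarrow> bool" where
  primitive:
    "\<lbrakk>s \<noteq> t; verts G = {s, t}; arcs G = {a}; tail G a = s; head G a = t\<rbrakk>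
      \<Longrightarrow> two_terminal_sp G s t"
| parallel:
    "\<lbrakk>two_terminal_sp G1 s t; two_terminal_sp G2 s t; compatible G1 G2;
      arcs G1 \<inter> arcs G2 = {}; verts G1 \<inter> verts G2 = {s, t}\<rbrakk>
      \<Longrightarrow> two_terminal_sp (union G1 G2) s t"
| series:
    "\<lbrakk>two_terminal_sp G1 s x; two_terminal_sp G2 x t; compatible G1 G2;
      arcs G1 \<inter> arcs G2 = {}; verts G1 \<inter> verts G2 = {x}\<rbrakk>
      \<Longrightarrow> two_terminal_sp (union G1 G2) s t"

record bmfni =
  graph :: "(nat, nat) pre_digraph"
  source :: nat
  sink :: nat
  cap1 :: "nat \<Rightarrow> nat"
  cap2 :: "nat \<Rightarrow> nat"
  icost :: "nat \<Rightarrow> nat"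
  budget :: nat

abbreviation num_verts :: "bmfni \<Rightarrow> nat" where
  "num_verts I \<equiv> card (verts (graph I))"

abbreviation num_arcs :: "bmfni \<Rightarrow> nat" where
  "num_arcs I \<equiv> card (arcs (graph I))"

text \<open>As usual for an explicit encoding, vertices and arcs are numbered consecutively from 0.
  Parallel arcs are permitted.\<close>

definition bmfni_instance :: "bmfni \<Rightarrow> bool" where
  "bmfni_instance I \<longleftrightarrow>
     fin_digraph (graph I) \<and>
     verts (graph I) = {..<num_verts I} \<and> arcs (graph I) = {..<num_arcs I} \<and>
     source I \<in> verts (graph I) \<and> sink I \<in> verts (graph I) \<and> source I \<noteq> sink I"

definition strategies :: "bmfni \<Rightarrow> (nat \<Rightarrow> nat) set" where
  "strategies I =
     {\<gamma> \<in> arcs (graph I) \<rightarrow>\<^sub>E {0, 1}. (\<Sum>a\<in>arcs (graph I). icost I a * \<gamma> a) \<le> budget I}"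

definition interdicted_arcs :: "bmfni \<Rightarrow> (nat \<Rightarrow> nat) \<Rightarrow> nat set" where
  "interdicted_arcs I \<gamma> = {a \<in> arcs (graph I). \<gamma> a = 1}"

definition interdicted_graph :: "bmfni \<Rightarrow> (nat \<Rightarrow> nat) \<Rightarrow> (nat, nat) pre_digraph" where
  "interdicted_graph I \<gamma> = (graph I)\<lparr>arcs := arcs (graph I) - interdicted_arcs I \<gamma>\<rparr>"

definition val :: "bmfni \<Rightarrow> (nat \<Rightarrow> nat) \<Rightarrow> real \<times> real" where
  "val I \<gamma> =
     (max_flow (interdicted_graph I \<gamma>) (source I) (sink I) (\<lambda>a. real (cap1 I a)),
      max_flow (interdicted_graph I \<gamma>) (source I) (sink I) (\<lambda>a. real (cap2 I a)))"

definition eps_approximates :: "bmfni \<Rightarrow> real \<Rightarrow> (nat \<Rightarrow> nat) \<Rightarrow> (nat \<Rightarrow> nat) \<Rightarrow> bool" where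
  "eps_approximates I \<epsilon> \<gamma> \<gamma>' \<longleftrightarrow>
     fst (val I \<gamma>) \<le> (1 + \<epsilon>) * fst (val I \<gamma>') \<and>
     snd (val I \<gamma>) \<le> (1 + \<epsilon>) * snd (val I \<gamma>')"

definition eps_approximation :: "bmfni \<Rightarrow> real \<Rightarrow> (nat \<Rightarrow> nat) set \<Rightarrow> bool" where
  "eps_approximation I \<epsilon> \<A> \<longleftrightarrow>
     \<A> \<subseteq> strategies I \<and> (\<forall>\<gamma>\<in>strategies I. \<exists>\<alpha>\<in>\<A>. eps_approximates I \<epsilon> \<alpha> \<gamma>)"

text \<open>Algorithms are programs of a deterministic first-order call-by-value language whose data
  are binary trees with natural numbers at the leaves. A program is a finite list of function
  bodies; function 0 is the main function, and variables are de Bruijn indices into the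
  current environment. Time is measured by the logarithmic cost criterion: every evaluation
  step costs 1, and arithmetic additionally costs the bit lengths of its operands. Structural
  operations cost 1 because trees are passed as pointers.

  This is polynomial-time equivalent to Turing machines. In a run of cost \<open>t\<close> at most
  \<open>t\<close> new tree nodes are allocated, environments have length bounded by a constant of the
  program, the recursion depth is at most \<open>t\<close>, and every number produced by arithmetic
  is at most as long as the cost charged for producing it (literals being of constant size), so
  that a Turing machine can simulate the run on a pointer representation in time polynomial in
  \<open>t\<close> and the size of the input. Conversely, a Turing machine tape is a pair of lists.\<close>

datatype data = Num nat | Node data data

datatype arith = Add | Sub | Mul | Div | Less

datatype expr =
    Var nat
  | Lit nat
  | Arith arith expr expr
  | MkNode expr expr
  | Left expr
  | Right expr
  | IsNum expr
  | Cond expr expr expr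
  | Bind expr expr
  | Call nat "expr list"

type_synonym program = "expr list"

definition bitlength :: "nat \<Rightarrow> nat" where
  "bitlength n = floorlog 2 n"

fun arith_op :: "arith \<Rightarrow> nat \<Rightarrow> nat \<Rightarrow> nat" where
  "arith_op Add x y = x + y"
| "arith_op Sub x y = x - y"
| "arith_op Mul x y = x * y"
| "arith_op Div x y = x div y"
| "arith_op Less x y = (if x < y then 1 else 0)"

text \<open>\<open>eval P E e v k\<close>: in program \<open>P\<close> and environment \<open>E\<close>,
  the expression \<open>e\<close> terminates with value \<open>v\<close> at cost \<open>k\<close>. Expressions
  that run into a type error or do not terminate have no value.\<close>

inductive
  eval :: "program \<Rightarrow> data list \<Rightarrow> expr \<Rightarrow> data \<Rightarrow> nat \<Rightarrow> bool" and
  evals :: "program \<Rightarrow> data list \<Rightarrow> expr list \<Rightarrow> data list \<Rightarrow> nat \<Rightarrow> bool"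
  for P :: program
where
  eval_Var: "i < length E \<Longrightarrow> eval P E (Var i) (E ! i) 1"
| eval_Lit: "eval P E (Lit n) (Num n) 1"
| eval_Arith:
    "\<lbrakk>eval P E e1 (Num x) k1; eval P E e2 (Num y) k2\<rbrakk>
      \<Longrightarrow> eval P E (Arith b e1 e2) (Num (arith_op b x y))
            (1 + k1 + k2 + bitlength x + bitlength y)"
| eval_MkNode:
    "\<lbrakk>eval P E e1 v1 k1; eval P E e2 v2 k2\<rbrakk>
      \<Longrightarrow> eval P E (MkNode e1 e2) (Node v1 v2) (1 + k1 + k2)"
| eval_Left: "eval P E e (Node v1 v2) k \<Longrightarrow> eval P E (Left e) v1 (1 + k)"
| eval_Right: "eval P E e (Node v1 v2) k \<Longrightarrow> eval P E (Right e) v2 (1 + k)"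
| eval_IsNum_Num: "eval P E e (Num n) k \<Longrightarrow> eval P E (IsNum e) (Num 1) (1 + k)"
| eval_IsNum_Node: "eval P E e (Node v1 v2) k \<Longrightarrow> eval P E (IsNum e) (Num 0) (1 + k)"
| eval_Cond_True:
    "\<lbrakk>eval P E e (Num (Suc n)) k; eval P E e1 v k1\<rbrakk>
      \<Longrightarrow> eval P E (Cond e e1 e2) v (1 + k + k1)"
| eval_Cond_False:
    "\<lbrakk>eval P E e (Num 0) k; eval P E e2 v k2\<rbrakk>
      \<Longrightarrow> eval P E (Cond e e1 e2) v (1 + k + k2)"
| eval_Bind:
    "\<lbrakk>eval P E e1 v1 k1; eval P (v1 # E) e2 v k2\<rbrakk>
      \<Longrightarrow> eval P E (Bind e1 e2) v (1 + k1 + k2)"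
| eval_Call:
    "\<lbrakk>f < length P; evals P E es vs k1; eval P vs (P ! f) v k2\<rbrakk>
      \<Longrightarrow> eval P E (Call f es) v (1 + k1 + k2)"
| evals_Nil: "evals P E [] [] 0"
| evals_Cons:
    "\<lbrakk>eval P E e v k1; evals P E es vs k2\<rbrakk>
      \<Longrightarrow> evals P E (e # es) (v # vs) (k1 + k2)"

inductive_cases eval_elims:
  "eval P E (Var i) v k"
  "eval P E (Lit n) v k"
  "eval P E (Arith b e1 e2) v k"
  "eval P E (MkNode e1 e2) v k"
  "eval P E (Left e) v k"
  "eval P E (Right e) v k"
  "eval P E (IsNum e) v k"
  "eval P E (Cond e e1 e2) v k"
  "eval P E (Bind e1 e2) v k"
  "eval P E (Call f es) v k"
  "evals P E [] vs k"
  "evals P E (e # es) vs k"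

lemma eval_deterministic:
  "eval P E e v k \<Longrightarrow> eval P E e v' k' \<Longrightarrow> v' = v \<and> k' = k"
  "evals P E es vs k \<Longrightarrow> evals P E es vs' k' \<Longrightarrow> vs' = vs \<and> k' = k"
proof (induction arbitrary: v' k' and vs' k' rule: eval_evals.inducts)
  case (eval_Arith E e1 x k1 e2 y k2 b)
  from eval_Arith.prems show ?case
    by (rule eval_elims) (auto dest!: eval_Arith.IH(2,4))
next
  case (eval_MkNode E e1 v1 k1 e2 v2 k2)
  from eval_MkNode.prems show ?case
    by (rule eval_elims) (auto dest!: eval_MkNode.IH(2,4))
next
  case (eval_Left E e v1 v2 k)
  from eval_Left.prems show ?case
    by (rule eval_elims) (auto dest!: eval_Left.IH(2))
next
  case (eval_Right E e v1 v2 k)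
  from eval_Right.prems show ?case
    by (rule eval_elims) (auto dest!: eval_Right.IH(2))
next
  case (eval_IsNum_Num E e n k)
  from eval_IsNum_Num.prems show ?case
    by (rule eval_elims) (auto dest!: eval_IsNum_Num.IH(2))
next
  case (eval_IsNum_Node E e v1 v2 k)
  from eval_IsNum_Node.prems show ?case
    by (rule eval_elims) (auto dest!: eval_IsNum_Node.IH(2))
next
  case (eval_Cond_True E e n k e1 v k1 e2)
  from eval_Cond_True.prems show ?case
    by (rule eval_elims) (auto dest!: eval_Cond_True.IH(2,4))
next
  case (eval_Cond_False E e k e2 v k2 e1)
  from eval_Cond_False.prems show ?case
    by (rule eval_elims) (auto dest!: eval_Cond_False.IH(2,4))
next
  case (eval_Bind E e1 v1 k1 e2 v k2)
  from eval_Bind.prems show ?case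
    by (rule eval_elims) (auto dest!: eval_Bind.IH(2,4))
next
  case (eval_Call f E es vs k1 v k2)
  from eval_Call.prems show ?case
    by (rule eval_elims) (auto dest!: eval_Call.IH(3,5))
next
  case (evals_Cons E e v k1 es vs k2)
  from evals_Cons.prems show ?case
    by (rule eval_elims) (auto dest!: evals_Cons.IH(2,4))
qed (auto elim: eval_elims)

definition runs :: "program \<Rightarrow> data \<Rightarrow> data \<Rightarrow> nat \<Rightarrow> bool" where
  "runs P x y k \<longleftrightarrow> P \<noteq> [] \<and> eval P [x] (P ! 0) y k"

fun data_size :: "data \<Rightarrow> nat" where
  "data_size (Num n) = 1 + bitlength n"
| "data_size (Node x y) = 1 + data_size x + data_size y"

fun enc_list :: "data list \<Rightarrow> data" where
  "enc_list [] = Num 0"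
| "enc_list (x # xs) = Node x (enc_list xs)"

definition enc_arc :: "bmfni \<Rightarrow> nat \<Rightarrow> data" where
  "enc_arc I a = enc_list
     [Num (tail (graph I) a), Num (head (graph I) a),
      Num (cap1 I a), Num (cap2 I a), Num (icost I a)]"

definition enc_instance :: "bmfni \<Rightarrow> data" where
  "enc_instance I = enc_list
     [Num (num_verts I), Num (source I), Num (sink I),
      enc_list (map (enc_arc I) [0..<num_arcs I]), Num (budget I)]"

definition enc_pos_rat :: "rat \<Rightarrow> data" where
  "enc_pos_rat q = Node (Num (nat (fst (quotient_of q)))) (Num (nat (snd (quotient_of q))))"

definition enc_strategy :: "bmfni \<Rightarrow> (nat \<Rightarrow> nat) \<Rightarrow> data" where
  "enc_strategy I \<gamma> = enc_list (map (\<lambda>a. Num (\<gamma> a)) [0..<num_arcs I])"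

definition poly2 :: "real poly poly \<Rightarrow> real \<Rightarrow> real \<Rightarrow> real" where
  "poly2 p x y = poly (poly p [:y:]) x"

text \<open>\<open>bmfni_fptas \<C> P\<close>: the program \<open>P\<close> is an FPTAS for the instances in
  \<open>\<C>\<close>. The running time is polynomial in the encoding size of the instance and in
  \<open>1/\<epsilon>\<close>. The binary encoding of \<open>\<epsilon>\<close>, whose length is not bounded in terms of
  these two quantities, contributes only the time needed to read it: an additive term
  linear in its length.\<close>

definition bmfni_fptas :: "bmfni set \<Rightarrow> program \<Rightarrow> bool" where
  "bmfni_fptas \<C> P \<longleftrightarrow>
     (\<exists>(p :: real poly poly) (d :: real). \<forall>I\<in>\<C>. \<forall>\<epsilon>::rat. \<epsilon> > 0 \<longrightarrow>
        (\<exists>\<gamma>s k.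
           runs P (Node (enc_instance I) (enc_pos_rat \<epsilon>))
             (enc_list (map (enc_strategy I) \<gamma>s)) k \<and>
           eps_approximation I (of_rat \<epsilon>) (set \<gamma>s) \<and>
           real k \<le> poly2 p (real (data_size (enc_instance I))) (1 / of_rat \<epsilon>)
                    + d * real (data_size (enc_pos_rat \<epsilon>))))"

end

theory Submission
  imports Defs "HOL-Library.Multiset" "HOL-Library.Nat_Bijection"
begin

text \<open>
The scheme rests on two facts about a series-parallel graph. Its maximum flow value is computed along
a decomposition tree, as a sum at a parallel and as a minimum at a series composition
(\<open>tval\<close>), and interdicting an arc replaces the capacity at a leaf by 0. Hence, for all
subgraphs of the tree from the leaves upwards, one can list the attainable triples of interdiction cost
and the two flow values. These lists are exponentially long, but sums and minima preserve
multiplicative errors. So after each composition a triple may be dropped if one that is already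
listed costs no more and is at most a factor \<open>1 + 1 / D\<close> worse in both values. With \<open>m\<close> arcs there are
fewer than \<open>m\<close> compositions, and \<open>D = 2 * m * N\<close> with \<open>1 / N \<le> \<epsilon>\<close> gives a total error factor of at
most \<open>1 + \<epsilon>\<close> (\<open>cands_complete\<close>, \<open>precision_error\<close>). The trimmed lists have polynomial length because a
flow value falls into one of polynomially many geometric intervals and, with unit costs, the cost of a
triple is a number up to \<open>m\<close> (\<open>length_spread_le\<close>).

The decomposition tree is found by greedily merging two parallel arcs, or the two arcs at an inner
vertex of degree 2, until a single arc is left. The lemmas \<open>sp_delete_parallel_edge\<close> and
\<open>sp_contract_series_vertex\<close> show that an arbitrary such step stays among series-parallel graphs, and
\<open>sp_reducible\<close> that a step exists as long as there are two arcs. Since the set of attainable flow values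
does not change in a step (\<open>flow_values_parallel\<close>, \<open>flow_values_series\<close>), the tree found in this way
computes the maximum flow for all capacities and all strategies simultaneously, whether or not it is the
tree by which the graph was built.

The rest is an implementation in the given language with an analysis of its running time. The number
of evaluation steps and the size of the operands are bounded separately (\<open>eval_if_ev\<close>); the
specifications \<open>calls\<close> of the functions are proved by symbolic execution (\<open>wp_simps\<close>). Only a single
division reads the binary representation of \<open>\<epsilon>\<close>; it produces \<open>N\<close>, and everything after it is
polynomial in the size of the instance and in \<open>N \<le> 1 / \<epsilon> + 1\<close>.
\<close>

section \<open>Series-parallel multigraphs and their reductions\<close>

definition ends :: "('v \<times> 'v) multiset \<Rightarrow> 'v set" where
  "ends M = (\<Union>(a, b)\<in>set_mset M. {a, b})"

lemma ends_simps [simp]: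
  "ends {#} = {}"
  "ends (add_mset (a, b) M) = {a, b} \<union> ends M"
  "ends (M + N) = ends M \<union> ends N"
  by (auto simp: ends_def)

lemma endsI: "(a, b) \<in># M \<Longrightarrow> a \<in> ends M \<and> b \<in> ends M"
  by (force simp: ends_def)

lemma ends_diff_subset: "ends (M - N) \<subseteq> ends M"
  by (auto simp: ends_def dest: in_diffD)

text \<open>Only the ends of the arcs matter for the shape of a graph, so a graph is represented by the
multiset of the pairs of ends of its arcs. Arc names would have to be carried through every
reduction; multiplicities keep parallel arcs apart without them. Every vertex of a two-terminal
series-parallel graph lies on an arc, hence \<open>ends\<close> recovers the vertex set.\<close>

inductive sp :: "('v \<times> 'v) multiset \<Rightarrow> 'v \<Rightarrow> 'v \<Rightarrow> bool" where
  edge: "s \<noteq> t \<Longrightarrow> sp {#(s, t)#} s t"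
| par: "\<lbrakk>sp M s t; sp N s t; ends M \<inter> ends N = {s, t}\<rbrakk> \<Longrightarrow> sp (M + N) s t"
| ser: "\<lbrakk>sp M s x; sp N x t; ends M \<inter> ends N = {x}\<rbrakk> \<Longrightarrow> sp (M + N) s t"

lemma sp_basic:
  assumes "sp M s t"
  shows "s \<noteq> t" "s \<in> ends M" "t \<in> ends M" "(a, s) \<notin># M" "(t, a) \<notin># M" "(a, a) \<notin># M" "M \<noteq> {#}"
proof -
  have "s \<noteq> t \<and> s \<in> ends M \<and> t \<in> ends M \<and> (\<forall>a. (a, s) \<notin># M \<and> (t, a) \<notin># M \<and> (a, a) \<notin># M)"
    using assms
  proof induction
    case (ser M s x N t)
    have "s \<noteq> t" using ser by auto
    moreover have "(a, s) \<notin># N" for a using ser endsI[of a s N] by auto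
    moreover have "(t, a) \<notin># M" for a using ser endsI[of t a M] by auto
    ultimately show ?case using ser by auto
  qed auto
  then show "s \<noteq> t" "s \<in> ends M" "t \<in> ends M" "(a, s) \<notin># M" "(t, a) \<notin># M" "(a, a) \<notin># M" "M \<noteq> {#}"
    by auto
qed

lemma sp_single: "sp {#(a, b)#} s t \<longleftrightarrow> a = s \<and> b = t \<and> s \<noteq> t"
proof
  assume "sp {#(a, b)#} s t"
  from sp_basic[OF this] show "a = s \<and> b = t \<and> s \<noteq> t"
    by auto
qed (auto intro: edge)

lemma diff_union_left: "N \<subseteq># M1 \<Longrightarrow> M1 + M2 - N = (M1 - N) + (M2 :: 'b multiset)"
  by simp

lemma diff_union_right: "N \<subseteq># M2 \<Longrightarrow> M1 + M2 - N = M1 + (M2 - N :: 'b multiset)"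
  by simp

text \<open>The case of two parallel arcs in different components of a parallel composition: both join the
terminals, and removing one leaves either nothing of its component or a series-parallel graph.\<close>

lemma sp_delete_terminal_edge:
  assumes "sp M s t" "(s, t) \<in># M"
  shows "M = {#(s, t)#} \<or> sp (M - {#(s, t)#}) s t"
  using assms
proof induction
  case (par M s t N)
  have *: "sp (M + N - {#(s, t)#}) s t"
    if "sp M s t" "sp N s t" "ends M \<inter> ends N = {s, t}" "(s, t) \<in># M"
      "M = {#(s, t)#} \<or> sp (M - {#(s, t)#}) s t" for M N
    using that(5)
  proof
    assume sp': "sp (M - {#(s, t)#}) s t"
    then have "ends (M - {#(s, t)#}) \<inter> ends N = {s, t}"
      using sp_basic(2,3)[OF sp'] that(3) ends_diff_subset[of M "{#(s, t)#}"] by auto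
    from sp.par[OF sp' that(2) this] show ?thesis using that(4) by simp
  qed (use that in simp)
  show ?case
  proof (cases "(s, t) \<in># M")
    case True
    then show ?thesis using *[of M N] par by auto
  next
    case False
    then show ?thesis using *[of N M] par.hyps par.prems par.IH
      by (simp add: Int_commute add.commute)
  qed
next
  case (ser M s x N t)
  have x: "x \<noteq> s" "x \<noteq> t" "s \<in> ends M" "t \<in> ends N"
    using sp_basic[OF ser.hyps(1)] sp_basic[OF ser.hyps(2)] by auto
  have "(s, t) \<in># M \<or> (s, t) \<in># N" using ser.prems by simp
  then have "t \<in> ends M \<inter> ends N \<or> s \<in> ends M \<inter> ends N"
    using endsI[of s t M] endsI[of s t N] x by blast
  then show ?case using ser.hyps(3) x by simp
qed auto

lemma count_union_ge_2:
  assumes "count (M + N) e \<ge> 2"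
  shows "count M e \<ge> 2 \<or> count N e \<ge> 2 \<or> e \<in># M \<and> e \<in># N"
proof -
  have "count M e + count N e \<ge> 2" using assms by simp
  then have "count M e \<ge> 2 \<or> count N e \<ge> 2 \<or> count M e > 0 \<and> count N e > 0" by linarith
  then show ?thesis by (simp add: count_greater_zero_iff)
qed

text \<open>Merging two parallel arcs preserves the property for every pair of parallel arcs, not only for
those that some decomposition merges. This confluence lets the algorithm reduce greedily.\<close>

lemma sp_delete_parallel_edge:
  assumes "sp M s t" "count M e \<ge> 2"
  shows "sp (M - {#e#}) s t"
  using assms
proof induction
  case (edge s t)
  then show ?case by (auto split: if_splits)
next
  case (par M s t N)
  have *: "sp (M + N - {#e#}) s t"
    if "sp M s t" "sp N s t" "ends M \<inter> ends N = {s, t}"  "e \<in># M" "sp (M - {#e#}) s t" for M N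
  proof -
    have "ends (M - {#e#}) \<inter> ends N = {s, t}"
      using sp_basic(2,3)[OF that(5)] that(3) ends_diff_subset[of M "{#e#}"] by auto
    from sp.par[OF that(5,2) this] show ?thesis using that(4) by simp
  qed
  consider "count M e \<ge> 2" | "count N e \<ge> 2" | "e \<in># M" "e \<in># N"
    using count_union_ge_2[OF par.prems] by blast
  then show ?case
  proof cases
    case 1
    then have "e \<in># M" by (simp flip: count_greater_zero_iff)
    then show ?thesis using * par 1 by blast
  next
    case 2
    then have "e \<in># N" by (simp flip: count_greater_zero_iff)
    then show ?thesis using *[of N M] par 2 by (auto simp: Int_commute add.commute)
  next
    case 3
    obtain a b where e: "e = (a, b)" by fastforce
    have "a \<in> {s, t}" "b \<in> {s, t}" using 3 endsI[of a b] par.hyps(3) e by blast+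
    moreover have "a \<noteq> b" "a \<noteq> t" "b \<noteq> s" using 3 e sp_basic(4-6)[OF par.hyps(1)] by blast+
    ultimately have e: "e = (s, t)" using e by auto
    from sp_delete_terminal_edge[OF par.hyps(1)] 3
    consider "M = {#e#}" | "sp (M - {#e#}) s t" unfolding e by blast
    then show ?thesis using * par 3 by cases auto
  qed
next
  case (ser M s x N t)
  consider "count M e \<ge> 2" | "count N e \<ge> 2" | "e \<in># M" "e \<in># N"
    using count_union_ge_2[OF ser.prems] by blast
  then show ?case
  proof cases
    case 1
    then have "e \<in># M" by (simp flip: count_greater_zero_iff)
    moreover have sp': "sp (M - {#e#}) s x" using 1 ser by blast
    moreover have "ends (M - {#e#}) \<inter> ends N = {x}"
      using sp_basic(2,3)[OF sp'] ser ends_diff_subset[of M "{#e#}"] by auto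
    ultimately show ?thesis using sp.ser[OF sp' ser.hyps(2)] by simp
  next
    case 2
    then have "e \<in># N" by (simp flip: count_greater_zero_iff)
    moreover have sp': "sp (N - {#e#}) x t" using 2 ser by blast
    moreover have "ends M \<inter> ends (N - {#e#}) = {x}"
      using sp_basic(2,3)[OF sp'] ser ends_diff_subset[of N "{#e#}"] by auto
    ultimately show ?thesis using sp.ser[OF ser.hyps(1) sp'] by simp
  next
    case 3
    obtain a b where e: "e = (a, b)" by fastforce
    have "a = x" "b = x" using 3 endsI[of a b] ser.hyps(3) e by blast+
    then show ?thesis using 3 e sp_basic(6)[OF ser.hyps(1)] by blast
  qed
qed

text \<open>Together with the mirror image \<open>sp_delete_first_edge\<close>, this treats the contraction of a vertex that
is the middle of a series composition: the component on each side has a single arc at its terminal,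
and stripping that arc moves the terminal to its other end.\<close>

lemma sp_delete_last_edge:
  assumes "sp M s t" "(a, t) \<in># M" "t \<notin> ends (M - {#(a, t)#})"
  shows "M = {#(a, t)#} \<or> sp (M - {#(a, t)#}) s a"
  using assms
proof induction
  case (par M s t N)
  have "t \<in> ends M" "t \<in> ends N" using par.hyps(3) by auto
  moreover have "{#(a, t)#} \<subseteq># M \<or> {#(a, t)#} \<subseteq># N" using par.prems by auto
  then have "ends N \<subseteq> ends (M + N - {#(a, t)#}) \<or> ends M \<subseteq> ends (M + N - {#(a, t)#})"
    by (metis Un_upper1 Un_upper2 diff_union_left diff_union_right ends_simps(3))
  ultimately show ?case using par.prems(2) by blast
next
  case (ser M s x N t)
  have "x \<noteq> t" "t \<in> ends N" using sp_basic[OF ser.hyps(2)] by auto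
  then have "t \<notin> ends M" using ser.hyps(3) by (metis IntI singletonD)
  then have in_N: "(a, t) \<in># N" using ser.prems(1) endsI by fastforce
  then have diff: "M + N - {#(a, t)#} = M + (N - {#(a, t)#})" by simp
  have "t \<notin> ends (N - {#(a, t)#})" using ser.prems(2) unfolding diff by simp
  from ser.IH(2)[OF in_N this]
  consider "N = {#(a, t)#}" | "sp (N - {#(a, t)#}) x a" by blast
  then show ?case
  proof cases
    case 1
    then have "a = x" using ser.hyps(2) by (simp add: sp_single)
    then show ?thesis using ser.hyps(1) 1 by simp
  next
    case 2
    have "ends M \<inter> ends (N - {#(a, t)#}) = {x}"
      using sp_basic(2)[OF 2] ser.hyps(3) ends_diff_subset[of N "{#(a, t)#}"] by auto
    from sp.ser[OF ser.hyps(1) 2 this] show ?thesis using diff by simp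
  qed
qed auto

lemma sp_delete_first_edge:
  assumes "sp M s t" "(s, b) \<in># M" "s \<notin> ends (M - {#(s, b)#})"
  shows "M = {#(s, b)#} \<or> sp (M - {#(s, b)#}) b t"
  using assms
proof induction
  case (par M s t N)
  have "s \<in> ends M" "s \<in> ends N" using par.hyps(3) by auto
  moreover have "{#(s, b)#} \<subseteq># M \<or> {#(s, b)#} \<subseteq># N" using par.prems by auto
  then have "ends N \<subseteq> ends (M + N - {#(s, b)#}) \<or> ends M \<subseteq> ends (M + N - {#(s, b)#})"
    by (metis Un_upper1 Un_upper2 diff_union_left diff_union_right ends_simps(3))
  ultimately show ?case using par.prems(2) by blast
next
  case (ser M s x N t)
  have "x \<noteq> s" "s \<in> ends M" using sp_basic[OF ser.hyps(1)] by auto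
  then have "s \<notin> ends N" using ser.hyps(3) by (metis IntI singletonD)
  then have in_M: "(s, b) \<in># M" using ser.prems(1) endsI by fastforce
  then have diff: "M + N - {#(s, b)#} = (M - {#(s, b)#}) + N" by simp
  have "s \<notin> ends (M - {#(s, b)#})" using ser.prems(2) unfolding diff by simp
  from ser.IH(1)[OF in_M this]
  consider "M = {#(s, b)#}" | "sp (M - {#(s, b)#}) b x" by blast
  then show ?case
  proof cases
    case 1
    then have "b = x" using ser.hyps(1) by (simp add: sp_single)
    then show ?thesis using ser.hyps(2) 1 by simp
  next
    case 2
    have "ends (M - {#(s, b)#}) \<inter> ends N = {x}"
      using sp_basic(3)[OF 2] ser.hyps(3) ends_diff_subset[of M "{#(s, b)#}"] by auto
    from sp.ser[OF 2 ser.hyps(2) this] show ?thesis using diff by simp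
  qed
qed auto

text \<open>Confluence for the second reduction. An inner vertex of a component of a composition is contracted
within that component; the middle vertex of a series composition needs the two lemmas above.\<close>

lemma sp_contract_series_vertex:
  assumes "sp M s t" "v \<noteq> s" "v \<noteq> t" "(a, v) \<in># M" "(v, b) \<in># M"
    "v \<notin> ends (M - {#(a, v), (v, b)#})"
  shows "sp (M - {#(a, v), (v, b)#} + {#(a, b)#}) s t"
  using assms
proof induction
  case (edge s t)
  then show ?case by auto
next
  case (par M s t N)
  have *: "sp (M + N - {#(a, v), (v, b)#} + {#(a, b)#}) s t"
    if "sp M s t" "sp N s t" "ends M \<inter> ends N = {s, t}" "v \<notin> ends N" "(a, v) \<in># M + N" "(v, b) \<in># M + N"
      "v \<notin> ends (M + N - {#(a, v), (v, b)#})"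
      and IH: "\<lbrakk>(a, v) \<in># M; (v, b) \<in># M; v \<notin> ends (M - {#(a, v), (v, b)#})\<rbrakk> \<Longrightarrow> sp (M - {#(a, v), (v, b)#} + {#(a, b)#}) s t"
    for M N
  proof -
    have in_M: "(a, v) \<in># M" "(v, b) \<in># M" using that(4-6) endsI by fastforce+
    have "a \<noteq> v" using in_M(1) sp_basic(6)[OF that(1)] by blast
    then have sub: "{#(a, v), (v, b)#} \<subseteq># M"
      using in_M by (auto simp: subset_mset.le_diff_conv2 insert_subset_eq_iff in_diff_count)
    note diff = diff_union_left[OF sub, of N]
    have sp': "sp (M - {#(a, v), (v, b)#} + {#(a, b)#}) s t" using IH in_M that(7) diff by auto
    have "ends (M - {#(a, v), (v, b)#} + {#(a, b)#}) \<inter> ends N = {s, t}"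
      using sp_basic(2,3)[OF sp'] that(3) ends_diff_subset[of M "{#(a, v), (v, b)#}"]
        endsI[OF in_M(1)] endsI[OF in_M(2)] by auto
    from sp.par[OF sp' that(2) this] show ?thesis using diff by (simp add: ac_simps)
  qed
  have "v \<notin> ends M \<or> v \<notin> ends N" using par by blast
  then show ?case
  proof
    assume "v \<notin> ends N"
    then show ?thesis using *[of M N] par by auto
  next
    assume "v \<notin> ends M"
    then show ?thesis using *[of N M] par by (auto simp: Int_commute add.commute)
  qed
next
  case (ser M s x N t)
  let ?A = "{#(a, v), (v, b)#}"
  have "a \<noteq> v" using ser.prems sp_basic(6)[OF sp.ser[OF ser.hyps]] by blast
  consider "v = x" | "v \<noteq> x" "v \<notin> ends N" | "v \<noteq> x" "v \<notin> ends M" using ser.hyps(3) by blast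
  then show ?case
  proof cases
    case 1
    have in_M: "(a, v) \<in># M" using ser.prems(3) sp_basic(4)[OF ser.hyps(2)] 1 by auto
    have in_N: "(v, b) \<in># N" using ser.prems(4) sp_basic(5)[OF ser.hyps(1)] 1 by auto
    have diff: "M + N - ?A = (M - {#(a, v)#}) + (N - {#(v, b)#})"
      using diff_union_left[of "{#(a, v)#}" M N]
        diff_union_right[of "{#(v, b)#}" N "M - {#(a, v)#}"] in_M in_N
      by (simp add: add_mset_commute)
    let ?M = "M - {#(a, v)#}" and ?N = "N - {#(v, b)#}"
    have v: "v \<notin> ends ?M" "v \<notin> ends ?N" using ser.prems(5) diff by auto
    from sp_delete_last_edge[of M s v a] v in_M ser.hyps(1) 1
    have M: "M = {#(a, v)#} \<or> sp ?M s a" by auto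
    from sp_delete_first_edge[of N v t b] v in_N ser.hyps(2) 1
    have N: "N = {#(v, b)#} \<or> sp ?N b t" by auto
    have ab: "a \<in> ends M" "b \<in> ends N" using in_M in_N endsI by fastforce+
    have "b \<noteq> v" using in_N sp_basic(6)[OF ser.hyps(2)] by auto
    then have ab': "a \<notin> ends N" "b \<notin> ends M" using ab \<open>a \<noteq> v\<close> ser.hyps(3) 1 by blast+
    then have "a \<noteq> b" using ab by auto
    note sub = ends_diff_subset[of M "{#(a, v)#}"] ends_diff_subset[of N "{#(v, b)#}"]
    have M': "sp (?M + {#(a, b)#}) s b"
      using M
    proof
      assume "M = {#(a, v)#}"
      then show ?thesis using ser.hyps(1) \<open>a \<noteq> b\<close> by (auto simp: sp_single)
    next
      assume sp': "sp ?M s a"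
      have "ends ?M \<inter> ends {#(a, b)#} = {a}" using sp_basic(3)[OF sp'] ab' sub by auto
      then show ?thesis using sp.ser[OF sp' edge[OF \<open>a \<noteq> b\<close>]] by simp
    qed
    show ?thesis
      using N
    proof
      assume "N = {#(v, b)#}"
      then show ?thesis using M' ser.hyps(2) diff by (auto simp: sp_single)
    next
      assume sp': "sp ?N b t"
      have "ends (?M + {#(a, b)#}) \<inter> ends ?N = {b}"
        using sp_basic(2)[OF sp'] ab ab' sub v ser.hyps(3) 1 by auto
      from sp.ser[OF M' sp' this] show ?thesis using diff by (simp add: ac_simps)
    qed
  next
    case 2
    have in_M: "(a, v) \<in># M" "(v, b) \<in># M" using 2 ser.prems(3,4) endsI by fastforce+
    then have "?A \<subseteq># M" using \<open>a \<noteq> v\<close>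
      by (auto simp: insert_subset_eq_iff in_diff_count)
    note diff = diff_union_left[OF this, of N]
    have sp': "sp (M - ?A + {#(a, b)#}) s x" using 2 ser diff in_M by auto
    have "ends (M - ?A + {#(a, b)#}) \<inter> ends N = {x}"
      using sp_basic(2,3)[OF sp'] ser.hyps(3) ends_diff_subset[of M ?A]
        endsI[OF in_M(1)] endsI[OF in_M(2)] by auto
    from sp.ser[OF sp' ser.hyps(2) this] show ?thesis using diff by (simp add: ac_simps)
  next
    case 3
    have in_N: "(a, v) \<in># N" "(v, b) \<in># N" using 3 ser.prems(3,4) endsI by fastforce+
    then have "?A \<subseteq># N" using \<open>a \<noteq> v\<close>
      by (auto simp: insert_subset_eq_iff in_diff_count)
    note diff = diff_union_right[OF this, of M]
    have sp': "sp (N - ?A + {#(a, b)#}) x t" using 3 ser diff in_N by auto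
    have "ends M \<inter> ends (N - ?A + {#(a, b)#}) = {x}"
      using sp_basic(2,3)[OF sp'] ser.hyps(3) ends_diff_subset[of N ?A]
        endsI[OF in_N(1)] endsI[OF in_N(2)] by auto
    from sp.ser[OF ser.hyps(1) sp' this] show ?thesis using diff by (simp add: ac_simps)
  qed
qed

definition series_vertex :: "('v \<times> 'v) multiset \<Rightarrow> 'v \<Rightarrow> 'v \<Rightarrow> 'v \<Rightarrow> bool" where
  "series_vertex M a v b \<longleftrightarrow> (a, v) \<in># M \<and> (v, b) \<in># M \<and> v \<notin> ends (M - {#(a, v), (v, b)#})"

lemma series_vertex_mono:
  assumes "series_vertex M a v b" "v \<notin> ends N" "(v, v) \<notin># M"
  shows "series_vertex (M + N) a v b"
proof -
  have "{#(a, v), (v, b)#} \<subseteq># M" using assms(1,3)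
    by (auto simp: insert_subset_eq_iff in_diff_count series_vertex_def)
  from diff_union_left[OF this, of N] show ?thesis using assms by (auto simp: series_vertex_def)
qed

text \<open>The reductions do not get stuck: a reducible pair of arcs of a component remains reducible in the
composition because inner vertices are not shared, and if both components are single arcs, these two
arcs are reducible themselves.\<close>

lemma sp_reducible:
  assumes "sp M s t" "size M \<ge> 2"
  shows "(\<exists>e. count M e \<ge> 2) \<or> (\<exists>a v b. v \<noteq> s \<and> v \<noteq> t \<and> series_vertex M a v b)"
  using assms
proof induction
  case (par M s t N)
  have *: "(\<exists>e. count (M + N) e \<ge> 2) \<or> (\<exists>a v b. v \<noteq> s \<and> v \<noteq> t \<and> series_vertex (M + N) a v b)"
    if "sp M s t" "ends M \<inter> ends N = {s, t}"
      "(\<exists>e. count M e \<ge> 2) \<or> (\<exists>a v b. v \<noteq> s \<and> v \<noteq> t \<and> series_vertex M a v b)" for M N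
    using that(3)
  proof (elim disjE exE conjE)
    fix a v b assume v: "v \<noteq> s" "v \<noteq> t" "series_vertex M a v b"
    then have "v \<in> ends M" using endsI by (fastforce simp: series_vertex_def)
    then have "series_vertex (M + N) a v b"
      using that v series_vertex_mono sp_basic(6) by (metis Int_iff insertE singletonD)
    then show ?thesis using v by blast
  qed (auto intro: trans_le_add1)
  consider "size M \<ge> 2" | "size N \<ge> 2" | "size M \<le> 1" "size N \<le> 1" by linarith
  then show ?case
  proof cases
    case 3
    then obtain e f where ef: "M = {#e#}" "N = {#f#}"
      using sp_basic(7) par.hyps
      by (metis One_nat_def le_Suc_eq le_zero_eq size_1_singleton_mset size_eq_0_iff_empty)
    then have "e = (s, t)" "f = (s, t)" using par.hyps by (metis prod.collapse sp_single)+
    then have "count (M + N) (s, t) \<ge> 2" using ef by simp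
    then show ?thesis by blast
  next
    case 1 then show ?thesis using *[of M N] par by blast
  next
    case 2 then show ?thesis using *[of N M] par by (simp add: Int_commute add.commute)
  qed
next
  case (ser M s x N t)
  have loop: "(v, v) \<notin># M" "(v, v) \<notin># N" for v
    using sp_basic(6)[OF ser.hyps(1)] sp_basic(6)[OF ser.hyps(2)] by auto
  consider "size M \<ge> 2" | "size N \<ge> 2" | "size M \<le> 1" "size N \<le> 1" by linarith
  then show ?case
  proof cases
    case 1
    from ser.IH(1)[OF this] show ?thesis
    proof (elim disjE exE conjE)
      fix a v b assume v: "v \<noteq> s" "v \<noteq> x" "series_vertex M a v b"
      then have "v \<in> ends M" using endsI by (fastforce simp: series_vertex_def)
      then have "v \<notin> ends N" "v \<noteq> t" using ser.hyps(3) v sp_basic(3)[OF ser.hyps(2)] by blast+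
      then show ?thesis using v loop series_vertex_mono[of M a v b N] by blast
    qed (auto intro: trans_le_add1)
  next
    case 2
    from ser.IH(2)[OF this] show ?thesis
    proof (elim disjE exE conjE)
      fix a v b assume v: "v \<noteq> x" "v \<noteq> t" "series_vertex N a v b"
      then have "v \<in> ends N" using endsI by (fastforce simp: series_vertex_def)
      then have "v \<notin> ends M" "v \<noteq> s" using ser.hyps(3) v sp_basic(2)[OF ser.hyps(1)] by blast+
      then show ?thesis using v loop series_vertex_mono[of N a v b M]
        by (simp only: add.commute[of M]) blast
    qed (auto intro: trans_le_add2)
  next
    case 3
    then obtain e f where ef: "M = {#e#}" "N = {#f#}"
      using sp_basic(7) ser.hyps
      by (metis One_nat_def le_Suc_eq le_zero_eq size_1_singleton_mset size_eq_0_iff_empty)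
    then have "e = (s, x)" "f = (x, t)" using ser.hyps by (metis prod.collapse sp_single)+
    then have "series_vertex (M + N) s x t" using ef by (simp add: series_vertex_def)
    moreover have "x \<noteq> s" "x \<noteq> t" using ser.hyps sp_basic(1) by metis+
    ultimately show ?thesis by blast
  qed
qed simp

section \<open>Flow values under reductions\<close>

type_synonym 'v cap_edge = "'v \<times> 'v \<times> real"
type_synonym 'v flow_edge = "'v \<times> 'v \<times> real \<times> real"

definition net :: "'v flow_edge multiset \<Rightarrow> 'v \<Rightarrow> real" where
  "net F x = (\<Sum>(a, b, w, f)\<in>#F. f * (of_bool (a = x) - of_bool (b = x)))"

text \<open>A flow is a multiset of arcs labelled with capacity and flow. Since flow conservation depends on
a flow only through the net outflow of each vertex, each reduction changes a flow locally, leaving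
\<open>net\<close> as it is, and the set of attainable values stays the same.\<close>

definition flow_values :: "'v \<Rightarrow> 'v \<Rightarrow> 'v cap_edge multiset \<Rightarrow> real set" where
  "flow_values s t M = {net F s |F.
     image_mset (\<lambda>(a, b, w, f). (a, b, w)) F = M \<and>
     (\<forall>(a, b, w, f)\<in>#F. 0 \<le> f \<and> f \<le> w) \<and> (\<forall>x. x \<noteq> s \<longrightarrow> x \<noteq> t \<longrightarrow> net F x = 0)}"

lemma net_simps [simp]:
  "net {#} x = 0"
  "net (add_mset (a, b, w, f) F) x = f * (of_bool (a = x) - of_bool (b = x)) + net F x"
  by (simp_all add: net_def)

lemma flow_valuesE:
  assumes "r \<in> flow_values s t M"
  obtains F where "image_mset (\<lambda>(a, b, w, f). (a, b, w)) F = M"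
    "\<forall>(a, b, w, f)\<in>#F. 0 \<le> f \<and> f \<le> w" "\<forall>x. x \<noteq> s \<longrightarrow> x \<noteq> t \<longrightarrow> net F x = 0" "r = net F s"
  using assms by (auto simp: flow_values_def)

lemma flow_valuesI:
  assumes "image_mset (\<lambda>(a, b, w, f). (a, b, w)) F = M"
    "\<forall>(a, b, w, f)\<in>#F. 0 \<le> f \<and> f \<le> w" "\<And>x. x \<noteq> s \<Longrightarrow> x \<noteq> t \<Longrightarrow> net F x = 0" "r = net F s"
  shows "r \<in> flow_values s t M"
  using assms by (auto simp: flow_values_def)

lemma image_flow_edges_add_mset:
  "image_mset (\<lambda>(a, b, w, f). (a, b, w)) F = add_mset (a, b, w) M \<longleftrightarrow>
   (\<exists>f F'. F = add_mset (a, b, w, f) F' \<and> image_mset (\<lambda>(a, b, w, f). (a, b, w)) F' = M)"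
  by (fastforce dest!: msed_map_invR)

text \<open>Conversely to adding the two flows, a flow of the merged arc is split greedily: the first arc
takes as much as its capacity permits.\<close>

lemma flow_values_parallel:
  assumes "0 \<le> w" "0 \<le> w'"
  shows "flow_values s t (add_mset (a, b, w) (add_mset (a, b, w') M)) =
    flow_values s t (add_mset (a, b, w + w') M)"
proof (intro equalityI subsetI)
  fix r assume "r \<in> flow_values s t (add_mset (a, b, w) (add_mset (a, b, w') M))"
  then obtain f f' F where F: "image_mset (\<lambda>(a, b, w, f). (a, b, w)) F = M"
    and *: "0 \<le> f" "f \<le> w" "0 \<le> f'" "f' \<le> w'" "\<forall>(a, b, w, f)\<in>#F. 0 \<le> f \<and> f \<le> w"
      "\<forall>x. x \<noteq> s \<longrightarrow> x \<noteq> t \<longrightarrow> net (add_mset (a, b, w, f) (add_mset (a, b, w', f') F)) x = 0"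
      "r = net (add_mset (a, b, w, f) (add_mset (a, b, w', f') F)) s"
    by (elim flow_valuesE) (auto simp: image_flow_edges_add_mset simp del: net_simps)
  show "r \<in> flow_values s t (add_mset (a, b, w + w') M)"
    by (rule flow_valuesI[of "add_mset (a, b, w + w', f + f') F"]) (use F * in \<open>auto simp: algebra_simps\<close>)
next
  fix r assume "r \<in> flow_values s t (add_mset (a, b, w + w') M)"
  then obtain f F where F: "image_mset (\<lambda>(a, b, w, f). (a, b, w)) F = M"
    and *: "0 \<le> f" "f \<le> w + w'" "\<forall>(a, b, w, f)\<in>#F. 0 \<le> f \<and> f \<le> w"
      "\<forall>x. x \<noteq> s \<longrightarrow> x \<noteq> t \<longrightarrow> net (add_mset (a, b, w + w', f) F) x = 0"
      "r = net (add_mset (a, b, w + w', f) F) s"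
    by (elim flow_valuesE) (auto simp: image_flow_edges_add_mset simp del: net_simps)
  define g where "g = min f w"
  have "net (add_mset (a, b, w, g) (add_mset (a, b, w', f - g) F)) x =
      net (add_mset (a, b, w + w', f) F) x" for x
    by (simp add: algebra_simps)
  then show "r \<in> flow_values s t (add_mset (a, b, w) (add_mset (a, b, w') M))"
    by (intro flow_valuesI[of "add_mset (a, b, w, g) (add_mset (a, b, w', f - g) F)"])
      (use F * assms in \<open>auto simp: g_def simp del: net_simps\<close>)
qed

lemma net_outside:
  assumes "image_mset (\<lambda>(a, b, w, f). (a, b, w)) F = M"
    "v \<notin> ends (image_mset (\<lambda>(a, b, w). (a, b)) M)"
  shows "net F v = 0"
proof -
  have "f * (of_bool (a = v) - of_bool (b = v)) = 0" if "(a, b, w, f) \<in># F" for a b w f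
    using assms that by (force simp: ends_def)
  then show ?thesis unfolding net_def by (intro sum_mset.neutral) auto
qed

text \<open>Conservation at \<open>v\<close> forces the same flow on both arcs.\<close>

lemma flow_values_series:
  assumes "v \<noteq> s" "v \<noteq> t" "a \<noteq> v" "b \<noteq> v" "v \<notin> ends (image_mset (\<lambda>(a, b, w). (a, b)) M)"
  shows "flow_values s t (add_mset (a, v, w) (add_mset (v, b, w') M)) =
    flow_values s t (add_mset (a, b, min w w') M)"
proof (intro equalityI subsetI)
  fix r assume "r \<in> flow_values s t (add_mset (a, v, w) (add_mset (v, b, w') M))"
  then obtain f f' F where F: "image_mset (\<lambda>(a, b, w, f). (a, b, w)) F = M"
    and *: "0 \<le> f" "f \<le> w" "0 \<le> f'" "f' \<le> w'" "\<forall>(a, b, w, f)\<in>#F. 0 \<le> f \<and> f \<le> w"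
      "\<And>x. x \<noteq> s \<Longrightarrow> x \<noteq> t \<Longrightarrow> net (add_mset (a, v, w, f) (add_mset (v, b, w', f') F)) x = 0"
      "r = net (add_mset (a, v, w, f) (add_mset (v, b, w', f') F)) s"
    by (elim flow_valuesE) (auto simp: image_flow_edges_add_mset simp del: net_simps)
  have "f' = f" using *(6)[OF assms(1,2)] net_outside[OF F assms(5)] assms(3,4) by simp
  then have "net (add_mset (a, b, min w w', f) F) x =
      net (add_mset (a, v, w, f) (add_mset (v, b, w', f') F)) x" for x
    by (simp add: algebra_simps)
  then show "r \<in> flow_values s t (add_mset (a, b, min w w') M)"
    by (intro flow_valuesI[of "add_mset (a, b, min w w', f) F"])
      (use F * \<open>f' = f\<close> in \<open>auto simp del: net_simps\<close>)
next
  fix r assume "r \<in> flow_values s t (add_mset (a, b, min w w') M)"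
  then obtain f F where F: "image_mset (\<lambda>(a, b, w, f). (a, b, w)) F = M"
    and *: "0 \<le> f" "f \<le> w" "f \<le> w'" "\<forall>(a, b, w, f)\<in>#F. 0 \<le> f \<and> f \<le> w"
      "\<forall>x. x \<noteq> s \<longrightarrow> x \<noteq> t \<longrightarrow> net (add_mset (a, b, min w w', f) F) x = 0"
      "r = net (add_mset (a, b, min w w', f) F) s"
    by (elim flow_valuesE) (auto simp: image_flow_edges_add_mset simp del: net_simps)
  have "net (add_mset (a, v, w, f) (add_mset (v, b, w', f) F)) x =
      net (add_mset (a, b, min w w', f) F) x" for x
    by (simp add: algebra_simps)
  then show "r \<in> flow_values s t (add_mset (a, v, w) (add_mset (v, b, w') M))"
    by (intro flow_valuesI[of "add_mset (a, v, w, f) (add_mset (v, b, w', f) F)"])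
      (use F * in \<open>auto simp del: net_simps\<close>)
qed

lemma flow_values_single:
  assumes "s \<noteq> t"
  shows "flow_values s t {#(s, t, w)#} = {0..w}"
proof (intro equalityI subsetI)
  fix r assume "r \<in> flow_values s t {#(s, t, w)#}"
  then show "r \<in> {0..w}" using assms
    by (elim flow_valuesE) (auto simp: image_flow_edges_add_mset)
next
  fix r assume "r \<in> {0..w}"
  then show "r \<in> flow_values s t {#(s, t, w)#}" using assms
    by (intro flow_valuesI[of "{#(s, t, w, r)#}"]) auto
qed

lemma image_mset_lift:
  assumes "image_mset p F = image_mset g (mset_set A)" "finite A"
  shows "\<exists>h. F = image_mset h (mset_set A) \<and> (\<forall>a\<in>A. p (h a) = g a)"
  using assms(2,1)
proof (induction A arbitrary: F rule: finite_induct)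
  case (insert a A)
  then have "image_mset p F = add_mset (g a) (image_mset g (mset_set A))" by simp
  from msed_map_invR[OF this] obtain e F' where e: "F = add_mset e F'" "p e = g a"
    "image_mset p F' = image_mset g (mset_set A)" by blast
  with insert.IH obtain h where "F' = image_mset h (mset_set A)" "\<forall>a\<in>A. p (h a) = g a" by blast
  moreover have "image_mset (h(a := e)) (mset_set A) = image_mset h (mset_set A)"
    using insert.hyps by (intro image_mset_cong) auto
  ultimately show ?case using e insert.hyps
    by (intro exI[of _ "h(a := e)"]) (auto simp: fun_upd_def)
qed simp

definition graph_ends :: "('v, 'e) pre_digraph \<Rightarrow> ('v \<times> 'v) multiset" where
  "graph_ends G = image_mset (\<lambda>a. (tail G a, head G a)) (mset_set (arcs G))"

text \<open>Deleting arcs amounts to setting their capacities to 0. In this form the graph does not depend on the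
interdiction strategy, so that one decomposition serves all strategies. The proof turns a flow
on named arcs into a multiset of labelled arcs and back by \<open>image_mset_lift\<close>.\<close>

lemma max_flow_eq_Sup_flow_values:
  fixes G :: "('v, 'e) pre_digraph"
  assumes G: "fin_digraph G" "s \<in> verts G" and w: "\<And>a. a \<in> arcs G \<Longrightarrow> 0 \<le> w a"
  shows "max_flow (G\<lparr>arcs := arcs G - S\<rparr>) s t w = Sup (flow_values s t
    (image_mset (\<lambda>a. (tail G a, head G a, if a \<in> S then 0 else w a)) (mset_set (arcs G))))"
proof -
  interpret fin_digraph G by (rule G)
  let ?H = "G\<lparr>arcs := arcs G - S\<rparr>"
  let ?w = "\<lambda>a. if a \<in> S then 0 else w a"
  let ?M = "image_mset (\<lambda>a. (tail G a, head G a, ?w a)) (mset_set (arcs G))"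
  have net: "net (image_mset (\<lambda>a. (tail G a, head G a, ?w a, g a)) (mset_set (arcs G))) x =
      sum g (out_arcs ?H x) - sum g (in_arcs ?H x)" (is "?l = _")
    if "\<And>a. a \<in> arcs G \<Longrightarrow> a \<in> S \<Longrightarrow> g a = 0" for g x
  proof -
    have "?l = (\<Sum>a\<in>arcs G. g a * (of_bool (tail G a = x) - of_bool (head G a = x)))"
      by (simp add: net_def image_mset.compositionality comp_def sum_unfold_sum_mset)
    also have "\<dots> = (\<Sum>a\<in>arcs G. if tail G a = x then g a else 0) - (\<Sum>a\<in>arcs G. if head G a = x then g a else 0)"
      by (subst sum_subtractf[symmetric]) (intro sum.cong, auto)
    also have "(\<Sum>a\<in>arcs G. if tail G a = x then g a else 0) = sum g (out_arcs ?H x)"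
      by (rule sum.mono_neutral_cong_right) (auto simp: out_arcs_def that)
    also have "(\<Sum>a\<in>arcs G. if head G a = x then g a else 0) = sum g (in_arcs ?H x)"
      by (rule sum.mono_neutral_cong_right) (auto simp: in_arcs_def that)
    finally show ?thesis .
  qed
  have "{flow_value ?H s f |f. is_flow ?H s t w f} = flow_values s t ?M"
  proof (intro equalityI subsetI)
    fix r assume "r \<in> {flow_value ?H s f |f. is_flow ?H s t w f}"
    then obtain f where f: "is_flow ?H s t w f" "r = flow_value ?H s f" by blast
    define g where "g a = (if a \<in> S then 0 else f a)" for a
    have sums: "sum g (out_arcs ?H x) = sum f (out_arcs ?H x)"
      "sum g (in_arcs ?H x) = sum f (in_arcs ?H x)" for x
      by (rule sum.cong; auto simp: g_def in_arcs_def out_arcs_def)+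
    let ?F = "image_mset (\<lambda>a. (tail G a, head G a, ?w a, g a)) (mset_set (arcs G))"
    have net': "net ?F x = sum f (out_arcs ?H x) - sum f (in_arcs ?H x)" for x
      by (subst net) (auto simp: sums g_def)
    show "r \<in> flow_values s t ?M"
    proof (rule flow_valuesI[of ?F])
      show "\<forall>(a, b, w, f)\<in>#?F. 0 \<le> f \<and> f \<le> w"
        using f(1) by (auto simp: g_def is_flow_def)
      show "net ?F x = 0" if "x \<noteq> s" "x \<noteq> t" for x
      proof (cases "x \<in> verts G")
        case True
        then show ?thesis using f(1) that unfolding net' is_flow_def by auto
      next
        case False
        then have "out_arcs ?H x = {}" "in_arcs ?H x = {}"
          using wellformed by (auto simp: in_arcs_def out_arcs_def)
        then show ?thesis unfolding net' by simp
      qed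
      show "r = net ?F s" unfolding net' f(2) flow_value_def ..
    qed (auto simp: image_mset.compositionality comp_def)
  next
    fix r assume "r \<in> flow_values s t ?M"
    then obtain F where F: "image_mset (\<lambda>(a, b, w, f). (a, b, w)) F = ?M"
      "\<forall>(a, b, w, f)\<in>#F. 0 \<le> f \<and> f \<le> w" "\<forall>x. x \<noteq> s \<longrightarrow> x \<noteq> t \<longrightarrow> net F x = 0" "r = net F s"
      by (rule flow_valuesE)
    from image_mset_lift[OF F(1) finite_arcs] obtain h where h: "F = image_mset h (mset_set (arcs G))"
      "\<And>a. a \<in> arcs G \<Longrightarrow> (\<lambda>(a, b, w, f). (a, b, w)) (h a) = (tail G a, head G a, ?w a)" by blast
    define g where "g a = snd (snd (snd (h a)))" for a
    have "h a = (tail G a, head G a, ?w a, g a)" if "a \<in> arcs G" for a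
      using h(2)[OF that] by (auto simp: g_def split: prod.splits)
    then have Fg: "F = image_mset (\<lambda>a. (tail G a, head G a, ?w a, g a)) (mset_set (arcs G))"
      unfolding h(1) by (intro image_mset_cong) auto
    have g: "0 \<le> g a \<and> g a \<le> ?w a" if "a \<in> arcs G" for a
      using F(2) that unfolding Fg by auto
    have net': "net F x = sum g (out_arcs ?H x) - sum g (in_arcs ?H x)" for x
      unfolding Fg by (rule net) (use g in force)
    have "is_flow ?H s t w g"
      using g F(3) unfolding is_flow_def net' by fastforce
    moreover have "r = flow_value ?H s g" using F(4) by (simp add: net' flow_value_def)
    ultimately show "r \<in> {flow_value ?H s f |f. is_flow ?H s t w f}" by blast
  qed
  then show ?thesis by (simp add: max_flow_def)
qed

lemma two_terminal_sp_graph_ends: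
  assumes "two_terminal_sp G s t"
  shows "finite (arcs G) \<and> ends (graph_ends G) = verts G \<and> sp (graph_ends G) s t"
  using assms
proof induction
  case (primitive s t G a)
  then show ?case by (auto simp: graph_ends_def intro: sp.edge)
next
  case (parallel G1 s t G2)
  then have "graph_ends (union G1 G2) = graph_ends G1 + graph_ends G2"
    by (simp add: graph_ends_def union_def compatible_def mset_set_Union)
  then show ?case using parallel sp.par[of "graph_ends G1" s t "graph_ends G2"] by (auto simp: union_def)
next
  case (series G1 s x G2 t)
  then have "graph_ends (union G1 G2) = graph_ends G1 + graph_ends G2"
    by (simp add: graph_ends_def union_def compatible_def mset_set_Union)
  then show ?case using series sp.ser[of "graph_ends G1" s x "graph_ends G2" t] by (auto simp: union_def)
qed

section \<open>Step counts and symbolic execution\<close>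

text \<open>\<open>ev P M E e v n\<close> is evaluation in \<open>n\<close> steps during which all operands of arithmetic are at most
\<open>M\<close>. It separates the two sources of cost: the steps of a program are counted
without regard to bit lengths, and these are bounded once and for all by that of \<open>M\<close>.\<close>

inductive
  ev :: "program \<Rightarrow> nat \<Rightarrow> data list \<Rightarrow> expr \<Rightarrow> data \<Rightarrow> nat \<Rightarrow> bool" and
  evs :: "program \<Rightarrow> nat \<Rightarrow> data list \<Rightarrow> expr list \<Rightarrow> data list \<Rightarrow> nat \<Rightarrow> bool"
  for P :: program and M :: nat
where
  ev_Var: "i < length E \<Longrightarrow> ev P M E (Var i) (E ! i) 1"
| ev_Lit: "ev P M E (Lit n) (Num n) 1"
| ev_Arith:
    "\<lbrakk>ev P M E e1 (Num x) k1; ev P M E e2 (Num y) k2; x \<le> M; y \<le> M\<rbrakk>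
      \<Longrightarrow> ev P M E (Arith b e1 e2) (Num (arith_op b x y)) (1 + k1 + k2)"
| ev_MkNode:
    "\<lbrakk>ev P M E e1 v1 k1; ev P M E e2 v2 k2\<rbrakk>
      \<Longrightarrow> ev P M E (MkNode e1 e2) (Node v1 v2) (1 + k1 + k2)"
| ev_Left: "ev P M E e (Node v1 v2) k \<Longrightarrow> ev P M E (Left e) v1 (1 + k)"
| ev_Right: "ev P M E e (Node v1 v2) k \<Longrightarrow> ev P M E (Right e) v2 (1 + k)"
| ev_IsNum: "ev P M E e v k \<Longrightarrow>
    ev P M E (IsNum e) (Num (case v of Num _ \<Rightarrow> 1 | Node _ _ \<Rightarrow> 0)) (1 + k)"
| ev_Cond: "\<lbrakk>ev P M E e (Num n) k; ev P M E (if n \<noteq> 0 then e1 else e2) v k1\<rbrakk>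
      \<Longrightarrow> ev P M E (Cond e e1 e2) v (1 + k + k1)"
| ev_Bind:
    "\<lbrakk>ev P M E e1 v1 k1; ev P M (v1 # E) e2 v k2\<rbrakk>
      \<Longrightarrow> ev P M E (Bind e1 e2) v (1 + k1 + k2)"
| ev_Call:
    "\<lbrakk>f < length P; evs P M E es vs k1; ev P M vs (P ! f) v k2\<rbrakk>
      \<Longrightarrow> ev P M E (Call f es) v (1 + k1 + k2)"
| evs_Nil: "evs P M E [] [] 0"
| evs_Cons:
    "\<lbrakk>ev P M E e v k1; evs P M E es vs k2\<rbrakk>
      \<Longrightarrow> evs P M E (e # es) (v # vs) (k1 + k2)"

lemma bitlength_mono: "x \<le> y \<Longrightarrow> bitlength x \<le> bitlength y"
  by (simp add: bitlength_def floorlog_mono)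

lemma eval_if_ev:
  "ev P M E e v n \<Longrightarrow> \<exists>k. eval P E e v k \<and> k \<le> n * (1 + 2 * bitlength M)"
  "evs P M E es vs n \<Longrightarrow> \<exists>k. evals P E es vs k \<and> k \<le> n * (1 + 2 * bitlength M)"
proof (induction rule: ev_evs.inducts)
  case (ev_Arith E e1 x k1 e2 y k2 b)
  then obtain n1 n2 where "eval P E e1 (Num x) n1" "n1 \<le> k1 * (1 + 2 * bitlength M)"
    "eval P E e2 (Num y) n2" "n2 \<le> k2 * (1 + 2 * bitlength M)" by blast
  moreover have "bitlength x \<le> bitlength M" "bitlength y \<le> bitlength M"
    using ev_Arith bitlength_mono by blast+
  ultimately show ?case
    by (intro exI[of _ "1 + n1 + n2 + bitlength x + bitlength y"] conjI eval_evals.intros)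
      (auto simp: algebra_simps)
next
  case (ev_IsNum E e v k)
  then obtain n where "eval P E e v n" "n \<le> k * (1 + 2 * bitlength M)" by blast
  then show ?case
    using eval_IsNum_Num[of P E e _ n] eval_IsNum_Node[of P E e _ _ n]
    by (intro exI[of _ "1 + n"] conjI) (cases v; simp add: algebra_simps)+
next
  case (ev_Cond E e c k e1 e2 v k1)
  then obtain n n1 where "eval P E e (Num c) n" "n \<le> k * (1 + 2 * bitlength M)"
    "eval P E (if c \<noteq> 0 then e1 else e2) v n1" "n1 \<le> k1 * (1 + 2 * bitlength M)" by blast
  then show ?case
    using eval_Cond_False[of P E e n e2 v n1 e1] eval_Cond_True[of P E e "c - 1" n e1 v n1 e2]
    by (intro exI[of _ "1 + n + n1"] conjI) (cases c; simp add: algebra_simps)+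
next
  case (ev_Var i E)
  then show ?case by (intro exI[of _ 1] conjI eval_evals.intros) auto
next
  case (ev_Lit E n)
  then show ?case by (intro exI[of _ 1] conjI eval_evals.intros) auto
next
  case (ev_MkNode E e1 v1 k1 e2 v2 k2)
  then obtain n1 n2 where "eval P E e1 v1 n1" "n1 \<le> k1 * (1 + 2 * bitlength M)"
    "eval P E e2 v2 n2" "n2 \<le> k2 * (1 + 2 * bitlength M)" by blast
  then show ?case
    by (intro exI[of _ "1 + n1 + n2"] conjI eval_evals.intros) (auto simp: algebra_simps)
next
  case (ev_Left E e v1 v2 k)
  then obtain n where "eval P E e (Node v1 v2) n" "n \<le> k * (1 + 2 * bitlength M)" by blast
  then show ?case
    by (intro exI[of _ "1 + n"] conjI eval_evals.intros) (auto simp: algebra_simps)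
next
  case (ev_Right E e v1 v2 k)
  then obtain n where "eval P E e (Node v1 v2) n" "n \<le> k * (1 + 2 * bitlength M)" by blast
  then show ?case
    by (intro exI[of _ "1 + n"] conjI eval_evals.intros) (auto simp: algebra_simps)
next
  case (ev_Bind E e1 v1 k1 e2 v k2)
  then obtain n1 n2 where "eval P E e1 v1 n1" "n1 \<le> k1 * (1 + 2 * bitlength M)"
    "eval P (v1 # E) e2 v n2" "n2 \<le> k2 * (1 + 2 * bitlength M)" by blast
  then show ?case
    by (intro exI[of _ "1 + n1 + n2"] conjI eval_evals.intros) (auto simp: algebra_simps)
next
  case (ev_Call f E es vs k1 v k2)
  then obtain n1 n2 where "evals P E es vs n1" "n1 \<le> k1 * (1 + 2 * bitlength M)"
    "eval P vs (P ! f) v n2" "n2 \<le> k2 * (1 + 2 * bitlength M)" by blast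
  then show ?case using ev_Call(1)
    by (intro exI[of _ "1 + n1 + n2"] conjI eval_evals.intros) (auto simp: algebra_simps)
next
  case (evs_Cons E e v k1 es vs k2)
  then obtain n1 n2 where "eval P E e v n1" "n1 \<le> k1 * (1 + 2 * bitlength M)"
    "evals P E es vs n2" "n2 \<le> k2 * (1 + 2 * bitlength M)" by blast
  then show ?case
    by (intro exI[of _ "n1 + n2"] conjI eval_evals.intros) (auto simp: algebra_simps)
qed (auto intro: eval_evals.evals_Nil)

text \<open>A precondition calculus in continuation-passing style. The equations \<open>wp_simps\<close> let the simplifier
execute a program symbolically, with its environment and step count, until it reaches a call,
where \<open>wpc_if_calls\<close> applies the specification \<open>calls\<close> of the called function.\<close>

definition wp :: "program \<Rightarrow> nat \<Rightarrow> data list \<Rightarrow> expr \<Rightarrow> (data \<Rightarrow> nat \<Rightarrow> bool) \<Rightarrow> bool" where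
  "wp P M E e Q \<longleftrightarrow> (\<exists>v n. ev P M E e v n \<and> Q v n)"

definition wps :: "program \<Rightarrow> nat \<Rightarrow> data list \<Rightarrow> expr list \<Rightarrow> (data list \<Rightarrow> nat \<Rightarrow> bool) \<Rightarrow> bool" where
  "wps P M E es Q \<longleftrightarrow> (\<exists>vs n. evs P M E es vs n \<and> Q vs n)"

definition wpc :: "program \<Rightarrow> nat \<Rightarrow> nat \<Rightarrow> data list \<Rightarrow> (data \<Rightarrow> nat \<Rightarrow> bool) \<Rightarrow> bool" where
  "wpc P M f vs Q \<longleftrightarrow> f < length P \<and> wp P M vs (P ! f) Q"

lemma ev_iff:
  "ev P M E (Var i) v k \<longleftrightarrow> i < length E \<and> v = E ! i \<and> k = 1"
  "ev P M E (Lit n) v k \<longleftrightarrow> v = Num n \<and> k = 1"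
  "ev P M E (Arith b e1 e2) v k \<longleftrightarrow> (\<exists>x y k1 k2. ev P M E e1 (Num x) k1 \<and> ev P M E e2 (Num y) k2 \<and>
     x \<le> M \<and> y \<le> M \<and> v = Num (arith_op b x y) \<and> k = 1 + k1 + k2)"
  "ev P M E (MkNode e1 e2) v k \<longleftrightarrow> (\<exists>v1 v2 k1 k2. ev P M E e1 v1 k1 \<and> ev P M E e2 v2 k2 \<and>
     v = Node v1 v2 \<and> k = 1 + k1 + k2)"
  "ev P M E (Left e) v k \<longleftrightarrow> (\<exists>v2 k1. ev P M E e (Node v v2) k1 \<and> k = 1 + k1)"
  "ev P M E (Right e) v k \<longleftrightarrow> (\<exists>v1 k1. ev P M E e (Node v1 v) k1 \<and> k = 1 + k1)"
  "ev P M E (IsNum e) v k \<longleftrightarrow> (\<exists>v1 k1. ev P M E e v1 k1 \<and>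
     v = Num (case v1 of Num _ \<Rightarrow> 1 | Node _ _ \<Rightarrow> 0) \<and> k = 1 + k1)"
  "ev P M E (Cond e e1 e2) v k \<longleftrightarrow> (\<exists>n k1 k2. ev P M E e (Num n) k1 \<and>
     ev P M E (if n \<noteq> 0 then e1 else e2) v k2 \<and> k = 1 + k1 + k2)"
  "ev P M E (Bind e1 e2) v k \<longleftrightarrow> (\<exists>v1 k1 k2. ev P M E e1 v1 k1 \<and> ev P M (v1 # E) e2 v k2 \<and>
     k = 1 + k1 + k2)"
  "ev P M E (Call f es) v k \<longleftrightarrow> (\<exists>vs k1 k2. f < length P \<and> evs P M E es vs k1 \<and>
     ev P M vs (P ! f) v k2 \<and> k = 1 + k1 + k2)"
  "evs P M E [] vs k \<longleftrightarrow> vs = [] \<and> k = 0"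
  "evs P M E (e # es) vs k \<longleftrightarrow> (\<exists>v1 vs1 k1 k2. ev P M E e v1 k1 \<and> evs P M E es vs1 k2 \<and>
     vs = v1 # vs1 \<and> k = k1 + k2)"
  by - ((subst ev.simps evs.simps; auto; fail)+)

lemma case_data_iff:
  "(case v of Node _ _ \<Rightarrow> False | Num x \<Rightarrow> R x) \<longleftrightarrow> (\<exists>x. v = Num x \<and> R x)"
  "(case v of Num _ \<Rightarrow> False | Node l r \<Rightarrow> R' l r) \<longleftrightarrow> (\<exists>l r. v = Node l r \<and> R' l r)"
  by (cases v; simp)+

lemma wp_Cond:
  "wp P M E (Cond e e1 e2) Q \<longleftrightarrow> wp P M E e (\<lambda>v k1. case v of Node _ _ \<Rightarrow> False | Num n \<Rightarrow>
     if n \<noteq> 0 then wp P M E e1 (\<lambda>v k2. Q v (1 + k1 + k2)) else wp P M E e2 (\<lambda>v k2. Q v (1 + k1 + k2)))" (is "?L = ?R")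
proof
  assume ?L
  then obtain n v k1 k2 where "ev P M E e (Num n) k1" "ev P M E (if n \<noteq> 0 then e1 else e2) v k2"
    "Q v (1 + k1 + k2)" by (auto simp: wp_def ev_iff)
  then show ?R unfolding wp_def case_data_iff
    by (intro exI[of _ "Num n"] exI[of _ k1] exI[of _ n] conjI) (auto split: if_splits)
next
  assume ?R
  then obtain n k1 where 1: "ev P M E e (Num n) k1"
    "if n \<noteq> 0 then wp P M E e1 (\<lambda>v k2. Q v (1 + k1 + k2)) else wp P M E e2 (\<lambda>v k2. Q v (1 + k1 + k2))"
    unfolding wp_def[of P M E e] case_data_iff by blast
  then obtain v k2 where "ev P M E (if n \<noteq> 0 then e1 else e2) v k2" "Q v (1 + k1 + k2)"
    by (cases "n = 0") (auto simp: wp_def)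
  with 1 show ?L unfolding wp_def ev_iff by blast
qed

lemma wp_simps_other:
  "wp P M E (Var i) Q \<longleftrightarrow> i < length E \<and> Q (E ! i) 1"
  "wp P M E (Lit n) Q \<longleftrightarrow> Q (Num n) 1"
  "wp P M E (Arith b e1 e2) Q \<longleftrightarrow> wp P M E e1 (\<lambda>v k1. case v of Node _ _ \<Rightarrow> False | Num x \<Rightarrow>
     wp P M E e2 (\<lambda>v k2. case v of Node _ _ \<Rightarrow> False | Num y \<Rightarrow>
       x \<le> M \<and> y \<le> M \<and> Q (Num (arith_op b x y)) (1 + k1 + k2)))"
  "wp P M E (MkNode e1 e2) Q \<longleftrightarrow> wp P M E e1 (\<lambda>v1 k1. wp P M E e2 (\<lambda>v2 k2.
     Q (Node v1 v2) (1 + k1 + k2)))"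
  "wp P M E (Left e) Q \<longleftrightarrow> wp P M E e (\<lambda>v k. case v of Num _ \<Rightarrow> False | Node v1 _ \<Rightarrow> Q v1 (1 + k))"
  "wp P M E (Right e) Q \<longleftrightarrow> wp P M E e (\<lambda>v k. case v of Num _ \<Rightarrow> False | Node _ v2 \<Rightarrow> Q v2 (1 + k))"
  "wp P M E (IsNum e) Q \<longleftrightarrow> wp P M E e (\<lambda>v k. Q (Num (case v of Num _ \<Rightarrow> 1 | Node _ _ \<Rightarrow> 0)) (1 + k))"
  "wp P M E (Bind e1 e2) Q \<longleftrightarrow> wp P M E e1 (\<lambda>v1 k1. wp P M (v1 # E) e2 (\<lambda>v k2. Q v (1 + k1 + k2)))"
  "wp P M E (Call f es) Q \<longleftrightarrow> wps P M E es (\<lambda>vs k1. wpc P M f vs (\<lambda>v k2. Q v (1 + k1 + k2)))"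
  "wps P M E [] R \<longleftrightarrow> R [] 0"
  "wps P M E (e # es) R \<longleftrightarrow> wp P M E e (\<lambda>v k1. wps P M E es (\<lambda>vs k2. R (v # vs) (k1 + k2)))"
  unfolding wp_def wps_def wpc_def ev_iff case_data_iff
  by - ((safe; (intro exI conjI; (assumption | rule refl | simp)); fail)+)

lemmas wp_simps = wp_Cond wp_simps_other

definition calls :: "program \<Rightarrow> nat \<Rightarrow> nat \<Rightarrow> data list \<Rightarrow> data \<Rightarrow> nat \<Rightarrow> bool" where
  "calls P M f vs v n \<longleftrightarrow> wpc P M f vs (\<lambda>v' n'. v' = v \<and> n' \<le> n)"

lemma wpc_if_calls:
  assumes "calls P M f vs v n" "\<And>n'. n' \<le> n \<Longrightarrow> Q v n'"
  shows "wpc P M f vs Q"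
  using assms by (auto simp: calls_def wpc_def wp_def)

lemma calls_mono: "calls P M f vs v n \<Longrightarrow> n \<le> n' \<Longrightarrow> calls P M f vs v n'"
  by (auto simp: calls_def wpc_def wp_def intro: le_trans)

section \<open>The algorithm on abstract data\<close>

datatype tree = Leaf nat | Par tree tree | Ser tree tree

text \<open>An edge of a partly reduced graph carries the decomposition tree of the subgraph that it replaces.\<close>

type_synonym edge = "nat \<times> nat \<times> tree"

text \<open>Loops count twice. A vertex \<open>v\<close> with an arc \<open>(a, v)\<close> and an arc \<open>(v, b)\<close> therefore has degree 2 iff
these are the only arcs at \<open>v\<close> and neither is a loop, which is the condition for a series reduction.\<close>

definition deg :: "nat \<Rightarrow> edge list \<Rightarrow> nat" where
  "deg v es = (\<Sum>(a, b, T)\<leftarrow>es. of_bool (a = v) + of_bool (b = v))"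

fun series_merge :: "nat \<Rightarrow> nat \<Rightarrow> edge list \<Rightarrow> edge \<Rightarrow> edge \<Rightarrow> edge option" where
  "series_merge s t es (a, b, T) (c, d, U) =
     (if b = c \<and> b \<noteq> s \<and> b \<noteq> t \<and> deg b es = 2 then Some (a, d, Ser T U) else None)"

fun merge :: "nat \<Rightarrow> nat \<Rightarrow> edge list \<Rightarrow> edge \<Rightarrow> edge \<Rightarrow> edge option" where
  "merge s t es (a, b, T) (c, d, U) =
     (if a = c \<and> b = d then Some (a, b, Par T U)
      else case series_merge s t es (a, b, T) (c, d, U) of
        Some e \<Rightarrow> Some e | None \<Rightarrow> series_merge s t es (c, d, U) (a, b, T))"

text \<open>The empty list signals that no two edges can be merged; it is unambiguous because the result of a
reduction contains the merged arc.\<close>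

fun merge_into :: "nat \<Rightarrow> nat \<Rightarrow> edge list \<Rightarrow> edge \<Rightarrow> edge list \<Rightarrow> edge list" where
  "merge_into s t es e [] = []"
| "merge_into s t es e (f # fs) = (case merge s t es e f of
     Some g \<Rightarrow> g # fs
   | None \<Rightarrow> (case merge_into s t es e fs of [] \<Rightarrow> [] | r \<Rightarrow> f # r))"

fun reduce :: "nat \<Rightarrow> nat \<Rightarrow> edge list \<Rightarrow> edge list \<Rightarrow> edge list" where
  "reduce s t es [] = []"
| "reduce s t es (e # fs) = (case merge_into s t es e fs of
     [] \<Rightarrow> (case reduce s t es fs of [] \<Rightarrow> [] | r \<Rightarrow> e # r)
   | r \<Rightarrow> r)"

text \<open>A candidate consists of the number of interdicted arcs, the two flow values, and the set \<open>S\<close> of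
interdicted arcs encoded as the number \<open>\<Sum>a\<in>S. 2 ^ a\<close>. Uniting disjoint sets is then an addition.\<close>

type_synonym cand = "nat \<times> nat \<times> nat \<times> nat"

text \<open>Domination up to the factor \<open>1 + 1 / D\<close> in both flow values, written without division.\<close>

fun dominates :: "nat \<Rightarrow> cand \<Rightarrow> cand \<Rightarrow> bool" where
  "dominates D (c, v1, v2, w) (c', v1', v2', w') \<longleftrightarrow>
     c \<le> c' \<and> D * v1 \<le> (D + 1) * v1' \<and> D * v2 \<le> (D + 1) * v2'"

text \<open>Checking new candidates only against the earlier ones keeps the error of one insertion to a single
factor: a candidate that is dropped is dominated by one that stays forever.\<close>

definition insert_cand :: "nat \<Rightarrow> cand \<Rightarrow> cand list \<Rightarrow> cand list" where
  "insert_cand D z L = (if \<exists>y\<in>set L. dominates D y z then L else z # L)"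

definition insert_rows :: "nat \<Rightarrow> (cand \<Rightarrow> cand \<Rightarrow> cand) \<Rightarrow> cand list \<Rightarrow> cand list \<Rightarrow> cand list \<Rightarrow> cand list" where
  "insert_rows D j R = fold (\<lambda>x. fold (\<lambda>y. insert_cand D (j x y)) R)"

definition combine :: "nat \<Rightarrow> (cand \<Rightarrow> cand \<Rightarrow> cand) \<Rightarrow> cand list \<Rightarrow> cand list \<Rightarrow> cand list" where
  "combine D j L R = insert_rows D j R L []"

fun join_par :: "cand \<Rightarrow> cand \<Rightarrow> cand" where
  "join_par (c, v1, v2, w) (c', v1', v2', w') = (c + c', v1 + v1', v2 + v2', w + w')"

fun join_ser :: "cand \<Rightarrow> cand \<Rightarrow> cand" where
  "join_ser (c, v1, v2, w) (c', v1', v2', w') = (c + c', min v1 v1', min v2 v2', w + w')"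

fun cands :: "(nat \<Rightarrow> nat) \<Rightarrow> (nat \<Rightarrow> nat) \<Rightarrow> nat \<Rightarrow> tree \<Rightarrow> cand list" where
  "cands u1 u2 D (Leaf a) = [(0, u1 a, u2 a, 0), (1, 0, 0, 2 ^ a)]"
| "cands u1 u2 D (Par T U) = combine D join_par (cands u1 u2 D T) (cands u1 u2 D U)"
| "cands u1 u2 D (Ser T U) = combine D join_ser (cands u1 u2 D T) (cands u1 u2 D U)"

fun bits :: "nat \<Rightarrow> nat \<Rightarrow> nat list" where
  "bits 0 w = []"
| "bits (Suc m) w = w mod 2 # bits m (w div 2)"

section \<open>The program\<close>

text \<open>The tag of a node is 0 for a leaf, and otherwise it tells \<open>f_join\<close> how to combine flow values. Leaves
carry what the leaf case of \<open>cands\<close> needs, so that no lookup in the instance is necessary.\<close>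

fun enc_tree :: "(nat \<Rightarrow> nat) \<Rightarrow> (nat \<Rightarrow> nat) \<Rightarrow> tree \<Rightarrow> data" where
  "enc_tree u1 u2 (Leaf a) = Node (Num 0) (Node (Num (2 ^ a)) (Node (Num (u1 a)) (Num (u2 a))))"
| "enc_tree u1 u2 (Par T U) = Node (Num 1) (Node (enc_tree u1 u2 T) (enc_tree u1 u2 U))"
| "enc_tree u1 u2 (Ser T U) = Node (Num 2) (Node (enc_tree u1 u2 T) (enc_tree u1 u2 U))"

fun enc_edge :: "(nat \<Rightarrow> nat) \<Rightarrow> (nat \<Rightarrow> nat) \<Rightarrow> edge \<Rightarrow> data" where
  "enc_edge u1 u2 (a, b, T) = Node (Num a) (Node (Num b) (enc_tree u1 u2 T))"

fun enc_edge_option :: "(nat \<Rightarrow> nat) \<Rightarrow> (nat \<Rightarrow> nat) \<Rightarrow> edge option \<Rightarrow> data" where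
  "enc_edge_option u1 u2 None = Num 0"
| "enc_edge_option u1 u2 (Some e) = enc_edge u1 u2 e"

abbreviation enc_edges :: "(nat \<Rightarrow> nat) \<Rightarrow> (nat \<Rightarrow> nat) \<Rightarrow> edge list \<Rightarrow> data" where
  "enc_edges u1 u2 es \<equiv> enc_list (map (enc_edge u1 u2) es)"

fun enc_cand :: "cand \<Rightarrow> data" where
  "enc_cand (c, v1, v2, w) = Node (Num c) (Node (Num v1) (Node (Num v2) (Num w)))"

abbreviation enc_cands :: "cand list \<Rightarrow> data" where
  "enc_cands L \<equiv> enc_list (map enc_cand L)"

text \<open>Functions are addressed by their position in the program; the main function is at position 0.\<close>

abbreviation (input) f_main :: nat where "f_main \<equiv> 0"
abbreviation (input) f_driver :: nat where "f_driver \<equiv> 1"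
abbreviation (input) f_length :: nat where "f_length \<equiv> 2"
abbreviation (input) f_init :: nat where "f_init \<equiv> 3"
abbreviation (input) f_degree :: nat where "f_degree \<equiv> 4"
abbreviation (input) f_merge :: nat where "f_merge \<equiv> 5"
abbreviation (input) f_series_merge :: nat where "f_series_merge \<equiv> 6"
abbreviation (input) f_merge_into :: nat where "f_merge_into \<equiv> 7"
abbreviation (input) f_reduce :: nat where "f_reduce \<equiv> 8"
abbreviation (input) f_solve :: nat where "f_solve \<equiv> 9"
abbreviation (input) f_cands :: nat where "f_cands \<equiv> 10"
abbreviation (input) f_combine :: nat where "f_combine \<equiv> 11"
abbreviation (input) f_row :: nat where "f_row \<equiv> 12"
abbreviation (input) f_insert :: nat where "f_insert \<equiv> 13"
abbreviation (input) f_join :: nat where "f_join \<equiv> 14"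
abbreviation (input) f_output :: nat where "f_output \<equiv> 15"
abbreviation (input) f_bits :: nat where "f_bits \<equiv> 16"
abbreviation (input) f_eq :: nat where "f_eq \<equiv> 17"

text \<open>Argument: the pair of the instance and \<open>\<epsilon> = p / q\<close>. The number \<open>N = q div p + 1\<close> satisfies
\<open>1 / N < \<epsilon>\<close> and \<open>N \<le> 1 / \<epsilon> + 1\<close>. After this division the numerals \<open>p\<close> and \<open>q\<close> are not touched again,
so that their lengths enter the running time only linearly.\<close>

definition body_main :: expr where
  "body_main = Call f_driver [Left (Var 0),
     Arith Add (Arith Div (Right (Right (Var 0))) (Left (Right (Var 0)))) (Lit 1)]"

text \<open>Arguments: instance, \<open>N\<close>. With \<open>m\<close> arcs there are at most \<open>m\<close> compositions, each of which costs
a factor \<open>1 + 1 / D\<close>; \<open>D = 2 * m * N\<close> keeps the product below \<open>1 + 1 / N\<close>.\<close>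

definition body_driver :: expr where
  "body_driver = Bind (Left (Right (Right (Right (Var 0)))))
    (Call f_output [Left (Right (Right (Right (Right (Var 1))))), Var 0,
      Call f_cands [Arith Mul (Lit 2) (Arith Mul (Call f_length [Var 0]) (Var 2)),
        Call f_solve [Call f_init [Var 0, Lit 1], Left (Right (Var 1)), Left (Right (Right (Var 1)))]]])"

definition body_length :: expr where
  "body_length = Cond (IsNum (Var 0)) (Lit 0) (Arith Add (Lit 1) (Call f_length [Right (Var 0)]))"

text \<open>Arguments: the arcs of the instance from number \<open>i\<close> on, \<open>2 ^ i\<close>.\<close>

definition body_init :: expr where
  "body_init = Cond (IsNum (Var 0)) (Lit 0) (Bind (Left (Var 0))
    (MkNode (MkNode (Left (Var 0)) (MkNode (Left (Right (Var 0)))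
        (MkNode (Lit 0) (MkNode (Var 2)
          (MkNode (Left (Right (Right (Var 0)))) (Left (Right (Right (Right (Var 0))))))))))
      (Call f_init [Right (Var 1), Arith Mul (Lit 2) (Var 2)])))"

text \<open>Arguments: vertex, list of edges.\<close>

definition body_degree :: expr where
  "body_degree = Cond (IsNum (Var 1)) (Lit 0)
    (Arith Add (Arith Add (Call f_eq [Left (Left (Var 1)), Var 0]) (Call f_eq [Left (Right (Left (Var 1))), Var 0]))
      (Call f_degree [Var 0, Right (Var 1)]))"

text \<open>Arguments: edge, edge, list of all edges, source, sink. The function for series
reductions takes the same arguments.\<close>

definition body_merge :: expr where
  "body_merge = Cond (Arith Mul (Call f_eq [Left (Var 0), Left (Var 1)])
      (Call f_eq [Left (Right (Var 0)), Left (Right (Var 1))]))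
    (MkNode (Left (Var 0)) (MkNode (Left (Right (Var 0)))
      (MkNode (Lit 1) (MkNode (Right (Right (Var 0))) (Right (Right (Var 1)))))))
    (Bind (Call f_series_merge [Var 0, Var 1, Var 2, Var 3, Var 4])
      (Cond (IsNum (Var 0)) (Call f_series_merge [Var 2, Var 1, Var 3, Var 4, Var 5]) (Var 0)))"

definition body_series_merge :: expr where
  "body_series_merge = Bind (Left (Right (Var 0)))
    (Cond (Call f_eq [Var 0, Left (Var 2)])
      (Cond (Call f_eq [Var 0, Var 4]) (Lit 0)
        (Cond (Call f_eq [Var 0, Var 5]) (Lit 0)
          (Cond (Call f_eq [Call f_degree [Var 0, Var 3], Lit 2])
            (MkNode (Left (Var 1)) (MkNode (Left (Right (Var 2)))
              (MkNode (Lit 2) (MkNode (Right (Right (Var 1))) (Right (Right (Var 2)))))))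
            (Lit 0))))
      (Lit 0))"

text \<open>Arguments: edge, list of edges to try, list of all edges, source, sink.\<close>

definition body_merge_into :: expr where
  "body_merge_into = Cond (IsNum (Var 1)) (Lit 0)
    (Bind (Call f_merge [Var 0, Left (Var 1), Var 2, Var 3, Var 4])
      (Cond (IsNum (Var 0))
        (Bind (Call f_merge_into [Var 1, Right (Var 2), Var 3, Var 4, Var 5])
          (Cond (IsNum (Var 0)) (Lit 0) (MkNode (Left (Var 3)) (Var 0))))
        (MkNode (Var 0) (Right (Var 2)))))"

text \<open>Arguments: list of edges to try, list of all edges, source, sink.\<close>

definition body_reduce :: expr where
  "body_reduce = Cond (IsNum (Var 0)) (Lit 0)
    (Bind (Call f_merge_into [Left (Var 0), Right (Var 0), Var 1, Var 2, Var 3])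
      (Cond (IsNum (Var 0))
        (Bind (Call f_reduce [Right (Var 1), Var 2, Var 3, Var 4])
          (Cond (IsNum (Var 0)) (Lit 0) (MkNode (Left (Var 2)) (Var 0))))
        (Var 0)))"

text \<open>Arguments: nonempty list of edges, source, sink.\<close>

definition body_solve :: expr where
  "body_solve = Cond (IsNum (Right (Var 0))) (Right (Right (Left (Var 0))))
    (Call f_solve [Call f_reduce [Var 0, Var 0, Var 1, Var 2], Var 1, Var 2])"

text \<open>Arguments: \<open>D\<close>, tree.\<close>

definition body_cands :: expr where
  "body_cands = Cond (Left (Var 1))
    (Call f_combine [Left (Var 1), Call f_cands [Var 0, Left (Right (Var 1))], Call f_cands [Var 0, Right (Right (Var 1))],
      Var 0, Lit 0])
    (MkNode
      (MkNode (Lit 0) (MkNode (Left (Right (Right (Var 1)))) (MkNode (Right (Right (Right (Var 1)))) (Lit 0))))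
      (MkNode
        (MkNode (Lit 1) (MkNode (Lit 0) (MkNode (Lit 0) (Left (Right (Var 1))))))
        (Lit 0)))"

text \<open>Arguments: tag, two candidate lists, \<open>D\<close>, accumulator.\<close>

definition body_combine :: expr where
  "body_combine = Cond (IsNum (Var 1)) (Var 4)
    (Call f_combine [Var 0, Right (Var 1), Var 2, Var 3, Call f_row [Var 0, Left (Var 1), Var 2, Var 3, Var 4]])"

text \<open>Arguments: tag, candidate, candidate list, \<open>D\<close>, accumulator.\<close>

definition body_row :: expr where
  "body_row = Cond (IsNum (Var 2)) (Var 4)
    (Call f_row [Var 0, Var 1, Right (Var 2), Var 3,
      Call f_insert [Var 3, Call f_join [Var 0, Var 1, Left (Var 2)], Var 4, Var 4]])"

text \<open>Arguments: \<open>D\<close>, new candidate, part of the accumulator still to be compared with it, accumulator.\<close>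

definition body_insert :: expr where
  "body_insert = Cond (IsNum (Var 2)) (MkNode (Var 1) (Var 3))
    (Bind (Left (Var 2))
      (Cond (Arith Add (Arith Less (Left (Var 2)) (Left (Var 0)))
          (Arith Add
            (Arith Less (Arith Mul (Arith Add (Var 1) (Lit 1)) (Left (Right (Var 2))))
              (Arith Mul (Var 1) (Left (Right (Var 0)))))
            (Arith Less (Arith Mul (Arith Add (Var 1) (Lit 1)) (Left (Right (Right (Var 2)))))
              (Arith Mul (Var 1) (Left (Right (Right (Var 0))))))))
        (Call f_insert [Var 1, Var 2, Right (Var 3), Var 4])
        (Var 4)))"

text \<open>Arguments: tag, two candidates.\<close>

definition body_join :: expr where
  "body_join =
    (let x1 = Left (Right (Var 1)); y1 = Left (Right (Var 2));
         x2 = Left (Right (Right (Var 1))); y2 = Left (Right (Right (Var 2)));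
         flow = (\<lambda>x y. Cond (Arith Less (Var 0) (Lit 2)) (Arith Add x y) (Cond (Arith Less x y) x y))
     in MkNode (Arith Add (Left (Var 1)) (Left (Var 2))) (MkNode (flow x1 y1) (MkNode (flow x2 y2)
       (Arith Add (Right (Right (Right (Var 1)))) (Right (Right (Right (Var 2))))))))"

text \<open>Arguments: budget, list as long as the list of arcs, candidate list.\<close>

definition body_output :: expr where
  "body_output = Cond (IsNum (Var 2)) (Lit 0)
    (Cond (Arith Less (Var 0) (Left (Left (Var 2))))
      (Call f_output [Var 0, Var 1, Right (Var 2)])
      (MkNode (Call f_bits [Var 1, Right (Right (Right (Left (Var 2))))])
        (Call f_output [Var 0, Var 1, Right (Var 2)])))"

text \<open>Arguments: list whose length is the number of digits, number.\<close>

definition body_bits :: expr where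
  "body_bits = Cond (IsNum (Var 0)) (Lit 0)
    (Bind (Arith Div (Var 1) (Lit 2))
      (MkNode (Arith Sub (Var 2) (Arith Mul (Lit 2) (Var 0))) (Call f_bits [Right (Var 1), Var 0])))"

definition body_eq :: expr where
  "body_eq = Arith Sub (Lit 1) (Arith Add (Arith Less (Var 0) (Var 1)) (Arith Less (Var 1) (Var 0)))"

definition prog :: program where
  "prog = [body_main, body_driver, body_length, body_init, body_degree, body_merge, body_series_merge,
    body_merge_into, body_reduce, body_solve, body_cands, body_combine, body_row, body_insert,
    body_join, body_output, body_bits, body_eq]"

lemma prog_simps [simp]:
  "length prog = 18" "prog ! 0 = body_main" "prog ! Suc 0 = body_driver" "prog ! 1 = body_driver" "prog ! 2 = body_length"
  "prog ! 3 = body_init" "prog ! 4 = body_degree" "prog ! 5 = body_merge" "prog ! 6 = body_series_merge"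
  "prog ! 7 = body_merge_into" "prog ! 8 = body_reduce" "prog ! 9 = body_solve" "prog ! 10 = body_cands"
  "prog ! 11 = body_combine" "prog ! 12 = body_row" "prog ! 13 = body_insert" "prog ! 14 = body_join"
  "prog ! 15 = body_output" "prog ! 16 = body_bits" "prog ! 17 = body_eq"
  by (simp_all add: prog_def)

text \<open>With these congruence rules the simplifier does not enter continuations, whose variables are not
yet instantiated.\<close>

lemma wp_cong [cong]: "E = E' \<Longrightarrow> e = e' \<Longrightarrow> wp P M E e Q = wp P M E' e' Q" by simp
lemma wps_cong [cong]: "E = E' \<Longrightarrow> wps P M E e Q = wps P M E' e Q" by simp
lemma wpc_cong [cong]: "vs = vs' \<Longrightarrow> wpc P M f vs Q = wpc P M f vs' Q" by simp

section \<open>The functions of the program compute the abstract functions\<close>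

lemma calls_prog: "calls prog M f vs v n \<longleftrightarrow> f < 18 \<and> wp prog M vs (prog ! f) (\<lambda>v' n'. v' = v \<and> n' \<le> n)"
  by (simp add: calls_def wpc_def)

text \<open>The truth value of an equation as a number. As a constant of its own it is not split into cases by the
simplifier in the middle of a symbolic execution.\<close>

definition eqn :: "nat \<Rightarrow> nat \<Rightarrow> nat" where
  "eqn x y = of_bool (x = y)"

lemma eqn_simps [simp]: "eqn x x = 1" "x \<noteq> y \<Longrightarrow> eqn x y = 0" "eqn x y = 0 \<longleftrightarrow> x \<noteq> y" "1 \<le> M \<Longrightarrow> eqn x y \<le> M"
  by (auto simp: eqn_def)

lemma wpc_eq [simp]:
  "2 \<le> M \<Longrightarrow> wpc prog M f_eq [Num x, Num y] Q \<longleftrightarrow> x \<le> M \<and> y \<le> M \<and> Q (Num (eqn x y)) 9"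
  by (simp add: wpc_def body_eq_def wp_simps eqn_def) (auto simp: eval_nat_numeral)

lemma calls_degree_and_bound:
  assumes "x \<le> M" "2 * length es + 2 \<le> M" "\<forall>(a, b, T)\<in>set es. a \<le> M \<and> b \<le> M"
  shows "calls prog M f_degree [Num x, enc_edges u1 u2 es] (Num (deg x es)) (40 * length es + 10) \<and> deg x es \<le> 2 * length es"
  using assms(2-)
proof (induction es)
  case Nil
  show ?case by (simp add: calls_prog body_degree_def wp_simps deg_def)
next
  case (Cons e es)
  obtain a b T where [simp]: "e = (a, b, T)" by (cases e)
  from Cons have IH: "calls prog M f_degree [Num x, enc_edges u1 u2 es] (Num (deg x es)) (40 * length es + 10)"
    and len: "deg x es \<le> 2 * length es" by auto
  show ?case using Cons.prems assms(1) len
    by (auto simp: calls_prog body_degree_def wp_simps deg_def eqn_def intro!: wpc_if_calls[OF IH])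
qed


lemma calls_degree:
  assumes "x \<le> M" "2 * length es + 2 \<le> M" "\<forall>(a, b, T)\<in>set es. a \<le> M \<and> b \<le> M"
  shows "calls prog M f_degree [Num x, enc_edges u1 u2 es] (Num (deg x es)) (40 * length es + 10)"
    "deg x es \<le> M"
  using calls_degree_and_bound[OF assms, of u1 u2] assms(2) by auto

definition edges_bounded :: "nat \<Rightarrow> edge list \<Rightarrow> bool" where
  "edges_bounded M es \<longleftrightarrow> 2 * length es + 2 \<le> M \<and> (\<forall>(a, b, T)\<in>set es. a \<le> M \<and> b \<le> M)"

lemma calls_series_merge:
  assumes "edges_bounded M es" "a \<le> M" "b \<le> M" "c \<le> M" "d \<le> M" "s \<le> M" "t \<le> M"
  shows "calls prog M f_series_merge [enc_edge u1 u2 (a, b, T), enc_edge u1 u2 (c, d, U), enc_edges u1 u2 es, Num s, Num t]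
    (enc_edge_option u1 u2 (series_merge s t es (a, b, T) (c, d, U))) (40 * length es + 120)"
proof -
  have *: "2 \<le> M" "2 * length es + 2 \<le> M" "\<forall>(a, b, T)\<in>set es. a \<le> M \<and> b \<le> M"
    using assms(1) by (simp_all add: edges_bounded_def)
  note deg = calls_degree[OF _ *(2,3)]
  show ?thesis
  proof (cases "b = c \<and> b \<noteq> s \<and> b \<noteq> t")
    case True
    then have b: "b = c" "c \<noteq> s" "c \<noteq> t" by auto
    show ?thesis using assms(2-) *(1) deg(2)[of c] b(2,3) unfolding b(1)
      apply (simp add: calls_prog body_series_merge_def wp_simps)
      apply (intro conjI impI; rule wpc_if_calls[OF deg(1)])
         apply (simp_all add: wp_simps)
      done
  next
    case False
    then show ?thesis using assms(2-) *(1)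
      by (auto simp: calls_prog body_series_merge_def wp_simps)
  qed
qed

lemma calls_merge:
  assumes "edges_bounded M es" "a \<le> M" "b \<le> M" "c \<le> M" "d \<le> M" "s \<le> M" "t \<le> M"
  shows "calls prog M f_merge [enc_edge u1 u2 (a, b, T), enc_edge u1 u2 (c, d, U), enc_edges u1 u2 es, Num s, Num t]
    (enc_edge_option u1 u2 (merge s t es (a, b, T) (c, d, U))) (80 * length es + 400)"
proof -
  have M: "2 \<le> M" using assms(1) by (simp add: edges_bounded_def)
  note 1 = calls_series_merge[OF assms(1,2,3,4,5,6,7), of u1 u2 T U, unfolded enc_edge.simps]
  note 2 = calls_series_merge[OF assms(1,4,5,2,3,6,7), of u1 u2 U T, unfolded enc_edge.simps]
  show ?thesis
  proof (cases "a = c \<and> b = d")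
    case True
    then show ?thesis using assms(2-) M by (simp add: calls_prog body_merge_def wp_simps)
  next
    case False
    then have eq: "eqn a c * eqn b d = 0" by auto
    have merge: "merge s t es (a, b, T) (c, d, U) = (case series_merge s t es (a, b, T) (c, d, U) of
        Some e \<Rightarrow> Some e | None \<Rightarrow> series_merge s t es (c, d, U) (a, b, T))"
      using False by auto
    show ?thesis
      unfolding merge using assms(2-) M
      apply (simp add: calls_prog body_merge_def wp_simps eq del: series_merge.simps mult_eq_0_iff nat_0_less_mult_iff)
      apply (rule wpc_if_calls[OF 1])
      apply (cases "series_merge s t es (a, b, T) (c, d, U)")
       apply (simp add: wp_simps del: series_merge.simps)
       apply (rule wpc_if_calls[OF 2])
       apply (simp del: series_merge.simps)
      apply (clarsimp simp add: wp_simps simp del: series_merge.simps)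
      done
  qed
qed


text \<open>As constants, the step counts stay atoms in the linear arithmetic about the recursions that use them.\<close>

definition cost_merge :: "nat \<Rightarrow> nat" where "cost_merge n = 80 * n + 400"
definition cost_merge_into :: "nat \<Rightarrow> nat" where "cost_merge_into n = (cost_merge n + 50) * n + 10"
definition cost_reduce :: "nat \<Rightarrow> nat" where "cost_reduce n = (cost_merge_into n + 50) * n + 10"

lemma calls_merge_into:
  assumes "edges_bounded M es" "a \<le> M" "b \<le> M" "s \<le> M" "t \<le> M" "\<forall>(a, b, T)\<in>set fs. a \<le> M \<and> b \<le> M"
  shows "calls prog M f_merge_into [enc_edge u1 u2 (a, b, T), enc_edges u1 u2 fs, enc_edges u1 u2 es, Num s, Num t]
    (enc_edges u1 u2 (merge_into s t es (a, b, T) fs)) ((cost_merge (length es) + 50) * length fs + 10)"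
  using assms(6)
proof (induction fs)
  case Nil
  then show ?case by (simp add: calls_prog body_merge_into_def wp_simps)
next
  case (Cons f fs)
  obtain c d U where f [simp]: "f = (c, d, U)" by (cases f)
  have "c \<le> M" "d \<le> M" using Cons.prems by auto
  note m = calls_merge[OF assms(1,2,3) this assms(4,5), of u1 u2 T U,
      folded cost_merge_def, unfolded enc_edge.simps]
  have IH: "calls prog M f_merge_into [enc_edge u1 u2 (a, b, T), enc_edges u1 u2 fs, enc_edges u1 u2 es, Num s, Num t]
    (enc_edges u1 u2 (merge_into s t es (a, b, T) fs)) ((cost_merge (length es) + 50) * length fs + 10)"
    using Cons by simp
  show ?case
    apply (simp add: calls_prog body_merge_into_def wp_simps del: merge.simps)
    apply (rule wpc_if_calls[OF m[unfolded enc_edge.simps]])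
    apply (cases "merge s t es (a, b, T) (c, d, U)")
     apply (simp add: wp_simps del: merge.simps)
     apply (rule wpc_if_calls[OF IH[unfolded enc_edge.simps]])
     apply (cases "merge_into s t es (a, b, T) fs"; simp add: wp_simps del: merge.simps)
    apply (clarsimp simp add: wp_simps simp del: merge.simps)
    done
qed

lemma calls_reduce:
  assumes "edges_bounded M es" "s \<le> M" "t \<le> M" "\<forall>(a, b, T)\<in>set fs. a \<le> M \<and> b \<le> M" "length fs \<le> length es"
  shows "calls prog M f_reduce [enc_edges u1 u2 fs, enc_edges u1 u2 es, Num s, Num t]
    (enc_edges u1 u2 (reduce s t es fs)) ((cost_merge_into (length es) + 50) * length fs + 10)"
  using assms(4,5)
proof (induction fs)
  case Nil
  then show ?case by (simp add: calls_prog body_reduce_def wp_simps)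
next
  case (Cons f fs)
  obtain a b T where f [simp]: "f = (a, b, T)" by (cases f)
  have ab: "a \<le> M" "b \<le> M" "\<forall>(a, b, T)\<in>set fs. a \<le> M \<and> b \<le> M" using Cons.prems by auto
  have "(cost_merge (length es) + 50) * length fs + 10 \<le> cost_merge_into (length es)"
    unfolding cost_merge_into_def using Cons.prems by (intro add_mono mult_left_mono) auto
  note m = calls_mono[OF calls_merge_into[OF assms(1) ab(1,2) assms(2,3) ab(3), of u1 u2 T] this]
  have IH: "calls prog M f_reduce [enc_edges u1 u2 fs, enc_edges u1 u2 es, Num s, Num t]
    (enc_edges u1 u2 (reduce s t es fs)) ((cost_merge_into (length es) + 50) * length fs + 10)"
    using Cons by simp
  show ?case
    apply (simp add: calls_prog body_reduce_def wp_simps)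
    apply (rule wpc_if_calls[OF m[unfolded enc_edge.simps]])
    apply (cases "merge_into s t es (a, b, T) fs")
     apply (simp add: wp_simps)
     apply (rule wpc_if_calls[OF IH[unfolded enc_edge.simps]])
     apply (cases "reduce s t es fs"; simp add: wp_simps)
    apply (simp add: wp_simps)
    done
qed

lemma calls_length:
  assumes "length xs < M"
  shows "calls prog M f_length [enc_list xs] (Num (length xs)) (10 * length xs + 10)"
  using assms
proof (induction xs)
  case (Cons x xs)
  then have IH: "calls prog M f_length [enc_list xs] (Num (length xs)) (10 * length xs + 10)" by simp
  show ?case using Cons.prems
    apply (simp add: calls_prog body_length_def wp_simps)
    apply (rule wpc_if_calls[OF IH])
    apply simp
    done
qed (simp add: calls_prog body_length_def wp_simps)

definition arc_edge :: "bmfni \<Rightarrow> nat \<Rightarrow> edge" where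
  "arc_edge I a = (tail (graph I) a, head (graph I) a, Leaf a)"

lemma calls_init:
  assumes "2 ^ m \<le> M" "2 \<le> M" "i \<le> m"
  shows "calls prog M f_init [enc_list (map (enc_arc I) [i..<m]), Num (2 ^ i)]
    (enc_edges (cap1 I) (cap2 I) (map (arc_edge I) [i..<m])) (50 * (m - i) + 10)"
  using assms(3)
proof (induction i rule: inc_induct)
  case base
  then show ?case by (simp add: calls_prog body_init_def wp_simps)
next
  case (step i)
  have "(2::nat) ^ i \<le> 2 ^ m" using step by (intro power_increasing) auto
  then have "2 ^ i \<le> M" using assms(1) by linarith
  moreover have "[i..<m] = i # [Suc i..<m]" using step by (simp add: upt_conv_Cons)
  moreover have "50 * (m - Suc i) + 60 \<le> 50 * (m - i) + 10" using step by simp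
  ultimately show ?case using assms(2)
    apply (simp add: calls_prog body_init_def wp_simps enc_arc_def[of I i] arc_edge_def[of I i])
    apply (rule wpc_if_calls[OF step.IH[unfolded power_Suc]])
    apply simp
    done
qed

lemma calls_bits:
  assumes "w \<le> M" "2 \<le> M"
  shows "calls prog M f_bits [enc_list xs, Num w] (enc_list (map Num (bits (length xs) w))) (30 * length xs + 10)"
  using assms(1)
proof (induction xs arbitrary: w)
  case (Cons x xs)
  have w: "w div 2 \<le> M" "2 * (w div 2) \<le> M" using Cons.prems by auto
  show ?case using Cons.prems w assms(2)
    apply (simp add: calls_prog body_bits_def wp_simps)
    apply (rule wpc_if_calls[OF Cons.IH])
     apply (simp_all add: minus_mult_div_eq_mod)
    done
qed (simp add: calls_prog body_bits_def wp_simps)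

text \<open>All numbers that arise when the candidate is compared with another one or output are at most
\<open>M\<close>.\<close>

definition cand_ok :: "nat \<Rightarrow> nat \<Rightarrow> cand \<Rightarrow> bool" where
  "cand_ok M D = (\<lambda>(c, v1, v2, w). c \<le> M \<and> (D + 1) * v1 \<le> M \<and> (D + 1) * v2 \<le> M \<and> w \<le> M)"

lemma cand_ok_iff: "cand_ok M D (c, v1, v2, w) \<longleftrightarrow>
  c \<le> M \<and> (D + 1) * v1 \<le> M \<and> (D + 1) * v2 \<le> M \<and> w \<le> M"
  by (simp add: cand_ok_def)

lemma cand_ok_le:
  assumes "cand_ok M D (c, v1, v2, w)"
  shows "c \<le> M" "v1 \<le> M" "v2 \<le> M" "D * v1 \<le> M" "D * v2 \<le> M" "v1 + D * v1 \<le> M" "v2 + D * v2 \<le> M" "w \<le> M"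
  using assms by (auto simp: cand_ok_iff)

lemma calls_output:
  assumes "2 \<le> M" "B \<le> M" "\<forall>x\<in>set L. cand_ok M D x"
  shows "calls prog M f_output [Num B, enc_list xs, enc_cands L]
    (enc_list (map (\<lambda>(c, v1, v2, w). enc_list (map Num (bits (length xs) w))) (filter (\<lambda>(c, _). c \<le> B) L)))
    ((30 * length xs + 50) * length L + 10)"
  using assms(3)
proof (induction L)
  case (Cons x L)
  obtain c v1 v2 w where x [simp]: "x = (c, v1, v2, w)" by (cases x)
  have ok: "c \<le> M" "w \<le> M" using Cons.prems cand_ok_le[of M D c v1 v2 w] by auto
  have IH: "calls prog M f_output [Num B, enc_list xs, enc_cands L]
    (enc_list (map (\<lambda>(c, v1, v2, w). enc_list (map Num (bits (length xs) w))) (filter (\<lambda>(c, _). c \<le> B) L)))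
    ((30 * length xs + 50) * length L + 10)" using Cons by simp
  show ?case
  proof (cases "B < c")
    case True
    then show ?thesis using ok assms(1,2)
      apply (simp add: calls_prog body_output_def wp_simps)
      apply (rule wpc_if_calls[OF IH])
      apply simp
      done
  next
    case False
    then show ?thesis using ok assms(1,2)
      apply (simp add: calls_prog body_output_def wp_simps)
      apply (rule wpc_if_calls[OF calls_bits])
        apply (simp_all add: wp_simps)
      apply (rule wpc_if_calls[OF IH])
      apply simp
      done
  qed
qed (simp add: calls_prog body_output_def wp_simps)

lemma calls_insert:
  assumes "D + 1 \<le> M" "cand_ok M D z" "\<forall>x\<in>set L. cand_ok M D x" "2 \<le> M"
  shows "calls prog M f_insert [Num D, enc_cand z, enc_cands L, enc_cands acc]
    (enc_cands (if \<exists>y\<in>set L. dominates D y z then acc else z # acc)) (60 * length L + 10)"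
  using assms(3)
proof (induction L)
  case (Cons x L)
  obtain c v1 v2 w where x [simp]: "x = (c, v1, v2, w)" by (cases x)
  obtain c' v1' v2' w' where z [simp]: "z = (c', v1', v2', w')" by (cases z)
  have ok: "cand_ok M D (c, v1, v2, w)" "cand_ok M D (c', v1', v2', w')" using Cons.prems assms(2) by auto
  note ok' = cand_ok_le[OF ok(1)] cand_ok_le[OF ok(2)]
  have IH: "calls prog M f_insert [Num D, enc_cand z, enc_cands L, enc_cands acc]
    (enc_cands (if \<exists>y\<in>set L. dominates D y z then acc else z # acc)) (60 * length L + 10)"
    using Cons by simp
  show ?case
  proof (cases "dominates D x z")
    case True
    then show ?thesis using ok' assms(1)
      by (simp add: calls_prog body_insert_def wp_simps)
  next
    case False
    then have "c' < c \<or> v1' + D * v1' < D * v1 \<or> v2' + D * v2' < D * v2" by auto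
    moreover have "(if P then 1 else 0) \<le> M" "(if P then 1 else 0) + (if Q then 1 else 0) \<le> M"
      "0 < (if P then 1 else (0::nat)) \<longleftrightarrow> P" for P Q
      using assms(4) by simp_all
    ultimately show ?thesis using ok' assms(1) False
      apply (simp add: calls_prog body_insert_def wp_simps del: dominates.simps split del: if_split)
      apply (rule wpc_if_calls[OF IH[unfolded z enc_cand.simps]])
      apply simp
      done
  qed
qed (simp add: calls_prog body_insert_def wp_simps)


lemma calls_join_par:
  assumes "2 \<le> M" "tag < 2" "cand_ok M D x" "cand_ok M D y"
  shows "calls prog M f_join [Num tag, enc_cand x, enc_cand y] (enc_cand (join_par x y)) 60"
proof -
  obtain c v1 v2 w where x [simp]: "x = (c, v1, v2, w)" by (cases x)
  obtain c' v1' v2' w' where y [simp]: "y = (c', v1', v2', w')" by (cases y)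
  note ok = cand_ok_le[OF assms(3)[unfolded x]] cand_ok_le[OF assms(4)[unfolded y]]
  show ?thesis using ok assms(1,2) by (simp add: calls_prog body_join_def wp_simps Let_def)
qed

lemma calls_join_ser:
  assumes "2 \<le> M" "cand_ok M D x" "cand_ok M D y"
  shows "calls prog M f_join [Num 2, enc_cand x, enc_cand y] (enc_cand (join_ser x y)) 60"
proof -
  obtain c v1 v2 w where x [simp]: "x = (c, v1, v2, w)" by (cases x)
  obtain c' v1' v2' w' where y [simp]: "y = (c', v1', v2', w')" by (cases y)
  note ok = cand_ok_le[OF assms(2)[unfolded x]] cand_ok_le[OF assms(3)[unfolded y]]
  show ?thesis using ok assms(1) by (simp add: calls_prog body_join_def wp_simps Let_def min_def)
qed

text \<open>The invariant \<open>Inv\<close> is a parameter because the bound \<open>l\<close> on the length of the accumulator does not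
come from this function but from the sparsity of candidate lists, proved below.\<close>

lemma calls_row:
  assumes M: "D + 1 \<le> M" "2 \<le> M"
    and join: "\<And>y. y \<in> set R \<Longrightarrow> calls prog M f_join [Num tag, enc_cand x, enc_cand y] (enc_cand (j x y)) 60 \<and> cand_ok M D (j x y)"
    and inv: "\<And>acc y. y \<in> set R \<Longrightarrow> Inv acc \<Longrightarrow> Inv (insert_cand D (j x y) acc)"
    and len: "\<And>acc. Inv acc \<Longrightarrow> length acc \<le> l \<and> (\<forall>z\<in>set acc. cand_ok M D z)"
    and "Inv acc"
  shows "calls prog M f_row [Num tag, enc_cand x, enc_cands R, Num D, enc_cands acc]
    (enc_cands (fold (\<lambda>y. insert_cand D (j x y)) R acc)) ((60 * l + 150) * length R + 10)
    \<and> Inv (fold (\<lambda>y. insert_cand D (j x y)) R acc)"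
  using assms(3-)
proof (induction R arbitrary: acc)
  case (Cons y R)
  let ?acc = "insert_cand D (j x y) acc"
  have acc: "Inv ?acc" "length acc \<le> l" using Cons.prems by auto
  have IH: "calls prog M f_row [Num tag, enc_cand x, enc_cands R, Num D, enc_cands ?acc]
    (enc_cands (fold (\<lambda>y. insert_cand D (j x y)) R ?acc)) ((60 * l + 150) * length R + 10)"
    "Inv (fold (\<lambda>y. insert_cand D (j x y)) R ?acc)"
    using Cons.IH[OF _ _ _ acc(1)] Cons.prems by auto
  have 1: "calls prog M f_join [Num tag, enc_cand x, enc_cand y] (enc_cand (j x y)) 60" using Cons.prems by simp
  have 2: "calls prog M f_insert [Num D, enc_cand (j x y), enc_cands acc, enc_cands acc] (enc_cands ?acc) (60 * length acc + 10)"
    unfolding insert_cand_def using Cons.prems M by (intro calls_insert) auto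
  show ?case using IH(2) acc(2)
    apply (simp add: calls_prog body_row_def wp_simps)
    apply (rule wpc_if_calls[OF 1])
    apply (simp add: wp_simps)
    apply (rule wpc_if_calls[OF 2])
    apply (simp add: wp_simps)
    apply (rule wpc_if_calls[OF IH(1)])
    apply simp
    done
qed (simp add: calls_prog body_row_def wp_simps)

lemma calls_combine:
  assumes M: "D + 1 \<le> M" "2 \<le> M"
    and join: "\<And>x y. x \<in> set L \<Longrightarrow> y \<in> set R \<Longrightarrow> calls prog M f_join [Num tag, enc_cand x, enc_cand y] (enc_cand (j x y)) 60 \<and> cand_ok M D (j x y)"
    and inv: "\<And>acc x y. x \<in> set L \<Longrightarrow> y \<in> set R \<Longrightarrow> Inv acc \<Longrightarrow> Inv (insert_cand D (j x y) acc)"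
    and len: "\<And>acc. Inv acc \<Longrightarrow> length acc \<le> l \<and> (\<forall>z\<in>set acc. cand_ok M D z)"
    and "Inv acc"
  shows "calls prog M f_combine [Num tag, enc_cands L, enc_cands R, Num D, enc_cands acc]
    (enc_cands (insert_rows D j R L acc))
    (((60 * l + 150) * length R + 60) * length L + 10) \<and> Inv (insert_rows D j R L acc)"
  using assms(3-)
proof (induction L arbitrary: acc)
  case (Cons x L)
  let ?acc = "fold (\<lambda>y. insert_cand D (j x y)) R acc"
  have row: "calls prog M f_row [Num tag, enc_cand x, enc_cands R, Num D, enc_cands acc]
      (enc_cands ?acc) ((60 * l + 150) * length R + 10)" "Inv ?acc"
    using calls_row[OF M, of R tag x j Inv l acc] Cons.prems by auto
  have IH: "calls prog M f_combine [Num tag, enc_cands L, enc_cands R, Num D, enc_cands ?acc]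
      (enc_cands (insert_rows D j R L ?acc)) (((60 * l + 150) * length R + 60) * length L + 10)"
    "Inv (insert_rows D j R L ?acc)"
    using Cons.IH[OF _ _ _ row(2)] Cons.prems by auto
  have eq: "insert_rows D j R (x # L) acc = insert_rows D j R L ?acc" by (simp add: insert_rows_def)
  show ?case unfolding eq using IH(2)
    apply (simp add: calls_prog body_combine_def wp_simps)
    apply (rule wpc_if_calls[OF row(1)])
    apply (simp add: wp_simps)
    apply (rule wpc_if_calls[OF IH(1)])
    apply simp
    done
qed (simp add: calls_prog body_combine_def wp_simps insert_rows_def)

section \<open>Approximation quality and length of candidate lists\<close>

fun leaves :: "tree \<Rightarrow> nat set" where
  "leaves (Leaf a) = {a}"
| "leaves (Par T U) = leaves T \<union> leaves U"
| "leaves (Ser T U) = leaves T \<union> leaves U"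

fun leaf_disjoint :: "tree \<Rightarrow> bool" where
  "leaf_disjoint (Leaf a) \<longleftrightarrow> True"
| "leaf_disjoint (Par T U) \<longleftrightarrow> leaf_disjoint T \<and> leaf_disjoint U \<and> leaves T \<inter> leaves U = {}"
| "leaf_disjoint (Ser T U) \<longleftrightarrow> leaf_disjoint T \<and> leaf_disjoint U \<and> leaves T \<inter> leaves U = {}"

fun compositions :: "tree \<Rightarrow> nat" where
  "compositions (Leaf a) = 0"
| "compositions (Par T U) = Suc (compositions T + compositions U)"
| "compositions (Ser T U) = Suc (compositions T + compositions U)"

text \<open>The maximum flow value through the graph that a tree describes after removal of the arcs in \<open>S\<close>.\<close>

fun tval :: "(nat \<Rightarrow> nat) \<Rightarrow> tree \<Rightarrow> nat set \<Rightarrow> nat" where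
  "tval u (Leaf a) S = (if a \<in> S then 0 else u a)"
| "tval u (Par T U) S = tval u T S + tval u U S"
| "tval u (Ser T U) S = min (tval u T S) (tval u U S)"

lemma finite_leaves [simp]: "finite (leaves T)"
  by (induction T) auto

lemma card_leaves: "leaf_disjoint T \<Longrightarrow> card (leaves T) = Suc (compositions T)"
  by (induction T) (auto simp: card_Un_disjoint)

lemma tval_cong: "S \<inter> leaves T = S' \<inter> leaves T \<Longrightarrow> tval u T S = tval u T S'"
proof (induction T)
  case (Leaf a)
  then have "a \<in> S \<longleftrightarrow> a \<in> S'" by auto
  then show ?case by simp
next
  case (Par T U)
  then have "S \<inter> leaves T = S' \<inter> leaves T" "S \<inter> leaves U = S' \<inter> leaves U" by auto
  then show ?case using Par.IH by simp
next
  case (Ser T U)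
  then have "S \<inter> leaves T = S' \<inter> leaves T" "S \<inter> leaves U = S' \<inter> leaves U" by auto
  then show ?case using Ser.IH by simp
qed

lemma tval_le:
  assumes "leaf_disjoint T" "\<And>a. a \<in> leaves T \<Longrightarrow> u a \<le> W"
  shows "tval u T S \<le> card (leaves T) * W"
  using assms
proof (induction T)
  case (Par T U)
  then have "tval u T S \<le> card (leaves T) * W" "tval u U S \<le> card (leaves U) * W" by auto
  then show ?case using Par.prems by (simp add: card_Un_disjoint add_mult_distrib)
next
  case (Ser T U)
  then have "tval u T S \<le> card (leaves T) * W" by auto
  then show ?case using Ser.prems by (simp add: card_Un_disjoint add_mult_distrib min.coboundedI1)
qed auto

definition cand_of :: "(nat \<Rightarrow> nat) \<Rightarrow> (nat \<Rightarrow> nat) \<Rightarrow> tree \<Rightarrow> nat set \<Rightarrow> cand" where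
  "cand_of u1 u2 T S = (card S, tval u1 T S, tval u2 T S, set_encode S)"

lemma cand_of_join:
  assumes "leaves T \<inter> leaves U = {}" "S \<subseteq> leaves T" "S' \<subseteq> leaves U"
  shows "join_par (cand_of u1 u2 T S) (cand_of u1 u2 U S') = cand_of u1 u2 (Par T U) (S \<union> S')"
    "join_ser (cand_of u1 u2 T S) (cand_of u1 u2 U S') = cand_of u1 u2 (Ser T U) (S \<union> S')"
proof -
  have fin: "finite S" "finite S'" using assms finite_subset finite_leaves by metis+
  have disj: "S \<inter> S' = {}" using assms by auto
  have "tval u T S = tval u T (S \<union> S')" "tval u U S' = tval u U (S \<union> S')" for u
    using assms by (auto intro!: tval_cong)
  moreover have "set_encode (S \<union> S') = set_encode S + set_encode S'"
    using fin disj by (simp add: set_encode_def sum.union_disjoint)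
  moreover have "card (S \<union> S') = card S + card S'" using fin disj by (rule card_Un_disjoint)
  ultimately show "join_par (cand_of u1 u2 T S) (cand_of u1 u2 U S') = cand_of u1 u2 (Par T U) (S \<union> S')"
    "join_ser (cand_of u1 u2 T S) (cand_of u1 u2 U S') = cand_of u1 u2 (Ser T U) (S \<union> S')"
    by (simp_all add: cand_of_def)
qed

text \<open>Approximation within the factor \<open>(1 + 1 / D) ^ n\<close> in both flow values, at no higher cost. Sums and
minima preserve the relation with the same \<open>n\<close>, so a composition adds only the error of inserting its
candidates into the result.\<close>

fun approx :: "nat \<Rightarrow> nat \<Rightarrow> cand \<Rightarrow> cand \<Rightarrow> bool" where
  "approx D n (c, v1, v2, w) (c', v1', v2', w') \<longleftrightarrow>
     c \<le> c' \<and> D ^ n * v1 \<le> (D + 1) ^ n * v1' \<and> D ^ n * v2 \<le> (D + 1) ^ n * v2'"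

lemma dominates_iff_approx: "dominates D x y \<longleftrightarrow> approx D 1 x y"
  by (cases x; cases y) simp

lemma mult_power_trans:
  fixes a b c D :: nat
  assumes "D ^ n * a \<le> (D + 1) ^ n * b" "D ^ k * b \<le> (D + 1) ^ k * c"
  shows "D ^ (n + k) * a \<le> (D + 1) ^ (n + k) * c"
proof -
  have "D ^ (n + k) * a = D ^ k * (D ^ n * a)" by (simp add: power_add)
  also have "\<dots> \<le> D ^ k * ((D + 1) ^ n * b)" using assms(1) by (rule mult_left_mono) simp
  also have "\<dots> = (D + 1) ^ n * (D ^ k * b)" by simp
  also have "\<dots> \<le> (D + 1) ^ n * ((D + 1) ^ k * c)" using assms(2) by (rule mult_left_mono) simp
  finally show ?thesis by (simp add: power_add)
qed

lemma approx_trans: "approx D n x y \<Longrightarrow> approx D k y z \<Longrightarrow> approx D (n + k) x z"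
  by (cases x; cases y; cases z) (auto intro: mult_power_trans[simplified])

lemma approx_refl: "approx D n x x"
  by (cases x) (auto intro!: mult_right_mono power_mono)

lemma approx_mono: "approx D n x y \<Longrightarrow> n \<le> k \<Longrightarrow> approx D k x y"
  using approx_trans[OF _ approx_refl, of D n x y "k - n"] by simp

lemma approx_join:
  assumes "approx D n x x'" "approx D n y y'"
  shows "approx D n (join_par x y) (join_par x' y')" "approx D n (join_ser x y) (join_ser x' y')"
proof -
  obtain c v1 v2 w c' v1' v2' w' where x: "x = (c, v1, v2, w)" "x' = (c', v1', v2', w')"
    by (cases x; cases x') auto
  obtain d r1 r2 z d' r1' r2' z' where y: "y = (d, r1, r2, z)" "y' = (d', r1', r2', z')"
    by (cases y; cases y') auto
  show "approx D n (join_par x y) (join_par x' y')"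
    using assms by (simp add: x y distrib_left add_mono)
  show "approx D n (join_ser x y) (join_ser x' y')"
    using assms by (auto simp: x y nat_mult_min_right intro: min.coboundedI1 min.coboundedI2)
qed

lemma insert_cand_superset: "set L \<subseteq> set (insert_cand D z L)"
  by (auto simp: insert_cand_def)

lemma insert_cand_approx: "\<exists>y\<in>set (insert_cand D z L). approx D 1 y z"
  using approx_refl[of D 1 z] by (auto simp: insert_cand_def dominates_iff_approx simp del: One_nat_def)

lemma row_superset: "set acc \<subseteq> set (fold (\<lambda>y. insert_cand D (j x y)) R acc)"
proof (induction R arbitrary: acc)
  case (Cons y R)
  show ?case using Cons[of "insert_cand D (j x y) acc"] insert_cand_superset[of acc D "j x y"] by simp
qed simp

lemma insert_rows_superset: "set acc \<subseteq> set (insert_rows D j R L acc)"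
proof (induction L arbitrary: acc)
  case (Cons x L)
  show ?case using Cons[of "fold (\<lambda>y. insert_cand D (j x y)) R acc"] row_superset[of acc D j x R]
    by (simp add: insert_rows_def)
qed (simp add: insert_rows_def)

lemma row_approx:
  "y \<in> set R \<Longrightarrow> \<exists>r\<in>set (fold (\<lambda>y. insert_cand D (j x y)) R acc). approx D 1 r (j x y)"
proof (induction R arbitrary: acc)
  case (Cons z R)
  show ?case
  proof (cases "y = z")
    case True
    obtain r where "r \<in> set (insert_cand D (j x y) acc)" "approx D 1 r (j x y)"
      using insert_cand_approx by blast
    then show ?thesis
      using True row_superset[of "insert_cand D (j x y) acc" D j x R] by (auto simp del: One_nat_def)
  next
    case False
    then show ?thesis using Cons by (auto simp del: One_nat_def)
  qed
qed simp

lemma insert_rows_approx: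
  "x \<in> set L \<Longrightarrow> y \<in> set R \<Longrightarrow> \<exists>r\<in>set (insert_rows D j R L acc). approx D 1 r (j x y)"
proof (induction L arbitrary: acc)
  case (Cons z L)
  have eq: "insert_rows D j R (z # L) acc = insert_rows D j R L (fold (\<lambda>y. insert_cand D (j z y)) R acc)"
    by (simp add: insert_rows_def)
  show ?case
  proof (cases "x = z")
    case True
    then obtain r where "r \<in> set (fold (\<lambda>y. insert_cand D (j z y)) R acc)" "approx D 1 r (j x y)"
      using row_approx[OF Cons.prems(2), of D j x acc] by blast
    then show ?thesis
      unfolding eq using insert_rows_superset by blast
  next
    case False
    then show ?thesis unfolding eq using Cons by (auto simp del: One_nat_def)
  qed
qed simp

text \<open>The exponent counts the compositions because each contributes one insertion; since the errors of
the subtrees concern disjoint parts of the tree, their sum is more than enough for both.\<close>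

lemma cands_complete:
  assumes "leaf_disjoint T" "S \<subseteq> leaves T"
  shows "\<exists>x\<in>set (cands u1 u2 D T). approx D (compositions T) x (cand_of u1 u2 T S)"
  using assms
proof (induction T arbitrary: S)
  case (Leaf a)
  then have "S = {} \<or> S = {a}" by auto
  then show ?case by (auto simp: cand_of_def)
next
  case (Par T U)
  let ?S = "S \<inter> leaves T" and ?S' = "S \<inter> leaves U"
  obtain x y where x: "x \<in> set (cands u1 u2 D T)" "approx D (compositions T) x (cand_of u1 u2 T ?S)"
    and y: "y \<in> set (cands u1 u2 D U)" "approx D (compositions U) y (cand_of u1 u2 U ?S')"
    using Par.IH[of ?S] Par.IH(2)[of ?S'] Par.prems by auto
  have "S = ?S \<union> ?S'" using Par.prems by auto
  then have S: "cand_of u1 u2 (Par T U) S = join_par (cand_of u1 u2 T ?S) (cand_of u1 u2 U ?S')"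
    using cand_of_join(1)[of T U ?S ?S'] Par.prems by simp
  obtain r where r: "r \<in> set (cands u1 u2 D (Par T U))" "approx D 1 r (join_par x y)"
    using insert_rows_approx[OF x(1) y(1)] unfolding cands.simps combine_def by blast
  have "approx D (compositions T + compositions U) (join_par x y) (cand_of u1 u2 (Par T U) S)"
    unfolding S by (intro approx_join approx_mono[OF x(2)] approx_mono[OF y(2)]) auto
  from approx_trans[OF r(2) this] r(1) show ?case by auto
next
  case (Ser T U)
  let ?S = "S \<inter> leaves T" and ?S' = "S \<inter> leaves U"
  obtain x y where x: "x \<in> set (cands u1 u2 D T)" "approx D (compositions T) x (cand_of u1 u2 T ?S)"
    and y: "y \<in> set (cands u1 u2 D U)" "approx D (compositions U) y (cand_of u1 u2 U ?S')"
    using Ser.IH[of ?S] Ser.IH(2)[of ?S'] Ser.prems by auto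
  have "S = ?S \<union> ?S'" using Ser.prems by auto
  then have S: "cand_of u1 u2 (Ser T U) S = join_ser (cand_of u1 u2 T ?S) (cand_of u1 u2 U ?S')"
    using cand_of_join(2)[of T U ?S ?S'] Ser.prems by simp
  obtain r where r: "r \<in> set (cands u1 u2 D (Ser T U))" "approx D 1 r (join_ser x y)"
    using insert_rows_approx[OF x(1) y(1)] unfolding cands.simps combine_def by blast
  have "approx D (compositions T + compositions U) (join_ser x y) (cand_of u1 u2 (Ser T U) S)"
    unfolding S by (intro approx_join approx_mono[OF x(2)] approx_mono[OF y(2)]) auto
  from approx_trans[OF r(2) this] r(1) show ?case by auto
qed

text \<open>The head of a candidate list is its newest element.\<close>

definition spread :: "nat \<Rightarrow> cand list \<Rightarrow> bool" where
  "spread D = sorted_wrt (\<lambda>x y. \<not> dominates D y x)"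

lemma spread_insert_cand: "spread D L \<Longrightarrow> spread D (insert_cand D z L)"
  by (auto simp: spread_def insert_cand_def)

text \<open>\<open>bucket D v = k\<close> means that \<open>v\<close> lies in the interval from \<open>q ^ (k - 1)\<close> to \<open>q ^ k\<close> (the latter excluded)
for \<open>q = 1 + 1 / D\<close>, and \<open>bucket D 0 = 0\<close>. Values in one bucket differ by less than a factor \<open>q\<close>.\<close>

definition bucket :: "nat \<Rightarrow> nat \<Rightarrow> nat" where
  "bucket D v = (LEAST k. v * D ^ k < (D + 1) ^ k)"

text \<open>Bernoulli's inequality gives \<open>q ^ (D + 1) \<ge> 2\<close> for \<open>q = 1 + 1 / D\<close>, so a number of \<open>b\<close> bits is
below \<open>q ^ (b * (D + 1))\<close>. The proof keeps the two leading terms of the binomial expansion.\<close>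

lemma power_two_le_bucket: "2 ^ b * D ^ (b * (D + 1)) \<le> (D + 1) ^ (b * (D + 1 :: nat))"
proof -
  have "D ^ Suc D + Suc D * D ^ D \<le> (D + 1) ^ Suc D"
  proof -
    have "(\<Sum>k\<in>{D, Suc D}. (Suc D choose k) * D ^ k * 1 ^ (Suc D - k)) \<le>
        (\<Sum>k\<le>Suc D. (Suc D choose k) * D ^ k * 1 ^ (Suc D - k))"
      by (intro sum_mono2) auto
    then show ?thesis by (subst binomial_ring) simp
  qed
  then have "2 * D ^ (D + 1) \<le> (D + 1) ^ (D + 1)" by simp
  then have "(2 * D ^ (D + 1)) ^ b \<le> ((D + 1) ^ (D + 1)) ^ b" by (rule power_mono) simp
  moreover have "(2 * D ^ (D + 1)) ^ b = 2 ^ b * D ^ (b * (D + 1))"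
    by (simp only: power_mult_distrib power_mult[symmetric] mult.commute)
  moreover have "((D + 1) ^ (D + 1)) ^ b = (D + 1) ^ (b * (D + 1))"
    by (simp only: power_mult[symmetric] mult.commute)
  ultimately show ?thesis by (simp only:)
qed

lemma bucket_exists:
  assumes "v < 2 ^ b" "D > 0"
  shows "v * D ^ (b * (D + 1)) < (D + 1) ^ (b * (D + 1))"
proof -
  have "v * D ^ (b * (D + 1)) < 2 ^ b * D ^ (b * (D + 1))" using assms by simp
  then show ?thesis using power_two_le_bucket[of b D] by linarith
qed

lemma bucket_le: "v < 2 ^ b \<Longrightarrow> D > 0 \<Longrightarrow> bucket D v \<le> b * (D + 1)"
  unfolding bucket_def by (rule Least_le, rule bucket_exists)

lemma bucket_eq_imp:
  assumes "bucket D v = bucket D v'" "D > 0"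
  shows "D * v \<le> (D + 1) * v'"
proof -
  let ?k = "bucket D v"
  have "v < 2 ^ v" by simp
  from LeastI[of "\<lambda>k. v * D ^ k < (D + 1) ^ k", OF bucket_exists[OF this assms(2)]]
  have v: "v * D ^ ?k < (D + 1) ^ ?k" by (simp add: bucket_def)
  show ?thesis
  proof (cases ?k)
    case 0
    then show ?thesis using v by simp
  next
    case (Suc k)
    then have "\<not> v' * D ^ k < (D + 1) ^ k"
      using not_less_Least[of k "\<lambda>k. v' * D ^ k < (D + 1) ^ k"] assms(1) by (simp add: bucket_def)
    then have "(D + 1) * (D + 1) ^ k \<le> (D + 1) * (v' * D ^ k)" by (intro mult_left_mono) simp_all
    then have "(D + 1) ^ ?k \<le> (D + 1) * (v' * D ^ k)" using Suc by simp
    then have "(D * v) * D ^ k \<le> ((D + 1) * v') * D ^ k" using v Suc by (simp add: algebra_simps)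
    then show ?thesis using assms(2) by simp
  qed
qed

text \<open>Two candidates that agree in their first component and in both buckets dominate each other, which
\<open>spread\<close> excludes. With unit interdiction costs the first component is at most the number of arcs, which
makes the bound polynomial.\<close>

lemma length_spread_le:
  assumes "spread D L" "D > 0" "\<And>c v1 v2 w. (c, v1, v2, w) \<in> set L \<Longrightarrow> c \<le> m \<and> v1 < 2 ^ b \<and> v2 < 2 ^ b"
  shows "length L \<le> (m + 1) * (b * (D + 1) + 1)\<^sup>2"
proof -
  let ?\<beta> = "\<lambda>(c, v1, v2, w). (c, bucket D v1, bucket D v2)"
  have "distinct (map ?\<beta> L)"
    using assms(1) unfolding spread_def
  proof (induction L)
    case (Cons x L)
    have "?\<beta> x \<noteq> ?\<beta> y" if "y \<in> set L" for y
    proof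
      assume eq: "?\<beta> x = ?\<beta> y"
      have "dominates D y x"
        using eq assms(2) by (cases x; cases y) (auto intro!: bucket_eq_imp[unfolded Suc_eq_plus1[symmetric]] simp del: mult_Suc)
      then show False using Cons.prems that by auto
    qed
    then show ?case using Cons by (auto simp del: split_paired_All)
  qed simp
  then have "length L = card (?\<beta> ` set L)"
    using distinct_card[of "map ?\<beta> L"] by simp
  also have "\<dots> \<le> card ({..m} \<times> {..b * (D + 1)} \<times> {..b * (D + 1)})"
  proof (rule card_mono)
    show "?\<beta> ` set L \<subseteq> {..m} \<times> {..b * (D + 1)} \<times> {..b * (D + 1)}"
    proof clarsimp
      fix c v1 v2 w assume "(c, v1, v2, w) \<in> set L"
      from assms(3)[OF this] show "c \<le> m \<and> bucket D v1 \<le> b + b * D \<and> bucket D v2 \<le> b + b * D"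
        using bucket_le[of v1 b D] bucket_le[of v2 b D] assms(2) by simp
    qed
  qed simp
  also have "\<dots> = (m + 1) * (b * (D + 1) + 1)\<^sup>2"
    by (simp add: power2_eq_square)
  finally show ?thesis .
qed


lemma cand_of_bounds:
  assumes "leaf_disjoint T" "leaves T \<subseteq> {..<m}" "\<And>a. a < m \<Longrightarrow> u1 a \<le> W \<and> u2 a \<le> W"
    "(c, v1, v2, w) \<in> cand_of u1 u2 T ` Pow (leaves T)"
  shows "c \<le> m" "v1 \<le> m * W" "v2 \<le> m * W" "w \<le> 2 ^ m"
proof -
  from assms(4) obtain S where S: "S \<subseteq> leaves T" "c = card S" "v1 = tval u1 T S" "v2 = tval u2 T S" "w = set_encode S"
    by (auto simp: cand_of_def)
  have "S \<subseteq> {..<m}" using S(1) assms(2) by auto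
  from card_mono[OF _ this] show "c \<le> m" using S(2) by simp
  have "card (leaves T) \<le> m" using card_mono[OF _ assms(2)] by simp
  then have le: "card (leaves T) * W \<le> m * W" by simp
  show "v1 \<le> m * W" unfolding S(3)
    by (rule order_trans[OF tval_le le]) (use assms in auto)
  show "v2 \<le> m * W" unfolding S(4)
    by (rule order_trans[OF tval_le le]) (use assms in auto)
  have "w \<le> (\<Sum>i<m. 2 ^ i)" unfolding S(5) set_encode_def
    using \<open>S \<subseteq> {..<m}\<close> by (intro sum_mono2) auto
  also have "\<dots> \<le> 2 ^ m" by (induction m) auto
  finally show "w \<le> 2 ^ m" .
qed

definition cost_node :: "nat \<Rightarrow> nat" where
  "cost_node l = ((60 * l + 150) * l + 60) * l + 100"

text \<open>Correctness of the values and the length bound are proved together with the running time since the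
accumulators must be short for the insertions to be fast.\<close>

lemma calls_cands:
  fixes m D b :: nat
  defines "l \<equiv> (m + 1) * (b * (D + 1) + 1)\<^sup>2"
  assumes "leaf_disjoint T" "leaves T \<subseteq> {..<m}"
    and D: "D > 0" and W: "\<And>a. a < m \<Longrightarrow> u1 a \<le> W \<and> u2 a \<le> W" "m * W < 2 ^ b"
    and M: "D + 1 \<le> M" "2 \<le> M" "m \<le> M" "(D + 1) * (m * W) \<le> M" "2 ^ m \<le> M"
  shows "calls prog M f_cands [Num D, enc_tree u1 u2 T] (enc_cands (cands u1 u2 D T)) ((2 * compositions T + 1) * cost_node l)
    \<and> set (cands u1 u2 D T) \<subseteq> cand_of u1 u2 T ` Pow (leaves T) \<and> length (cands u1 u2 D T) \<le> l"
proof -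
  have sound_ok: "cand_ok M D x" if "leaf_disjoint T" "leaves T \<subseteq> {..<m}" "x \<in> cand_of u1 u2 T ` Pow (leaves T)" for T x
  proof -
    obtain c v1 v2 w where x: "x = (c, v1, v2, w)" by (cases x)
    note bounds = cand_of_bounds[OF that(1,2) W(1) that(3)[unfolded x]]
    have "(D + 1) * v1 \<le> (D + 1) * (m * W)" "(D + 1) * v2 \<le> (D + 1) * (m * W)"
      using bounds by (intro mult_left_mono; simp)+
    then show ?thesis using bounds M unfolding x cand_ok_iff by linarith
  qed
  \<comment> \<open>what every accumulator satisfies while the candidates of \<open>T\<close> are computed\<close>
  define Inv where "Inv T acc \<longleftrightarrow> spread D acc \<and> set acc \<subseteq> cand_of u1 u2 T ` Pow (leaves T)" for T acc
  have len: "length acc \<le> l \<and> (\<forall>z\<in>set acc. cand_ok M D z)"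
    if "leaf_disjoint T" "leaves T \<subseteq> {..<m}" "Inv T acc" for T acc
  proof
    show "\<forall>z\<in>set acc. cand_ok M D z" using that sound_ok unfolding Inv_def by blast
    show "length acc \<le> l"
      unfolding l_def
    proof (rule length_spread_le)
      fix c v1 v2 w assume "(c, v1, v2, w) \<in> set acc"
      then have "(c, v1, v2, w) \<in> cand_of u1 u2 T ` Pow (leaves T)" using that(3) unfolding Inv_def by blast
      note bounds = cand_of_bounds[OF that(1,2) W(1) this]
      show "c \<le> m \<and> v1 < 2 ^ b \<and> v2 < 2 ^ b" using bounds W(2) by linarith
    qed (use that D in \<open>auto simp: Inv_def\<close>)
  qed
  \<comment> \<open>both kinds of composition at once; they differ only in the tag and in \<open>j\<close>\<close>
  have node: "calls prog M f_cands [Num D, Node (Num tag) (Node (enc_tree u1 u2 T) (enc_tree u1 u2 U))]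
      (enc_cands (combine D j (cands u1 u2 D T) (cands u1 u2 D U)))
      ((2 * Suc (compositions T + compositions U) + 1) * cost_node l) \<and>
    set (combine D j (cands u1 u2 D T) (cands u1 u2 D U)) \<subseteq> cand_of u1 u2 V ` Pow (leaves V) \<and>
    length (combine D j (cands u1 u2 D T) (cands u1 u2 D U)) \<le> l"
    if T: "calls prog M f_cands [Num D, enc_tree u1 u2 T] (enc_cands (cands u1 u2 D T)) ((2 * compositions T + 1) * cost_node l)"
       "set (cands u1 u2 D T) \<subseteq> cand_of u1 u2 T ` Pow (leaves T)" "length (cands u1 u2 D T) \<le> l"
      and U: "calls prog M f_cands [Num D, enc_tree u1 u2 U] (enc_cands (cands u1 u2 D U)) ((2 * compositions U + 1) * cost_node l)"
       "set (cands u1 u2 D U) \<subseteq> cand_of u1 u2 U ` Pow (leaves U)" "length (cands u1 u2 D U) \<le> l"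
      and V: "leaf_disjoint V" "leaves V \<subseteq> {..<m}" "leaf_disjoint T" "leaf_disjoint U" "leaves V = leaves T \<union> leaves U"
      and "tag > 0"
      and j: "\<And>S S'. S \<subseteq> leaves T \<Longrightarrow> S' \<subseteq> leaves U \<Longrightarrow>
        j (cand_of u1 u2 T S) (cand_of u1 u2 U S') = cand_of u1 u2 V (S \<union> S')"
      and tag: "\<And>x y. cand_ok M D x \<Longrightarrow> cand_ok M D y \<Longrightarrow>
        calls prog M f_join [Num tag, enc_cand x, enc_cand y] (enc_cand (j x y)) 60"
    for T U V j tag
  proof -
    have join: "j x y \<in> cand_of u1 u2 V ` Pow (leaves V)"
      if "x \<in> set (cands u1 u2 D T)" "y \<in> set (cands u1 u2 D U)" for x y
    proof -
      from subsetD[OF T(2) that(1)] subsetD[OF U(2) that(2)]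
      obtain S S' where "S \<subseteq> leaves T" "S' \<subseteq> leaves U" "x = cand_of u1 u2 T S" "y = cand_of u1 u2 U S'" by auto
      then have "j x y = cand_of u1 u2 V (S \<union> S')" "S \<union> S' \<subseteq> leaves V" using j V(5) by auto
      then show ?thesis by blast
    qed
    have ok: "cand_ok M D x" "cand_ok M D y" if "x \<in> set (cands u1 u2 D T)" "y \<in> set (cands u1 u2 D U)" for x y
    proof -
      show "cand_ok M D x" using sound_ok[of T x] that T(2) V by auto
      show "cand_ok M D y" using sound_ok[of U y] that U(2) V by auto
    qed
    have "calls prog M f_combine [Num tag, enc_cands (cands u1 u2 D T), enc_cands (cands u1 u2 D U), Num D, enc_cands []]
      (enc_cands (combine D j (cands u1 u2 D T) (cands u1 u2 D U)))
      (((60 * l + 150) * length (cands u1 u2 D U) + 60) * length (cands u1 u2 D T) + 10) \<and>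
      Inv V (combine D j (cands u1 u2 D T) (cands u1 u2 D U))"
      unfolding combine_def
    proof (rule calls_combine[OF M(1,2)])
      show "length acc \<le> l \<and> (\<forall>z\<in>set acc. cand_ok M D z)" if "Inv V acc" for acc
        using len[OF V(1,2) that] .
      show "Inv V (insert_cand D (j x y) acc)"
        if "x \<in> set (cands u1 u2 D T)" "y \<in> set (cands u1 u2 D U)" "Inv V acc" for acc x y
        using that(3) join[OF that(1,2)] spread_insert_cand[of D acc "j x y"]
        by (auto simp: Inv_def insert_cand_def)
      show "calls prog M f_join [Num tag, enc_cand x, enc_cand y] (enc_cand (j x y)) 60 \<and> cand_ok M D (j x y)"
        if "x \<in> set (cands u1 u2 D T)" "y \<in> set (cands u1 u2 D U)" for x y
        using tag[OF ok[OF that]] sound_ok[OF V(1,2) join[OF that]] by blast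
    qed (simp add: Inv_def spread_def)
    then have comb: "calls prog M f_combine [Num tag, enc_cands (cands u1 u2 D T), enc_cands (cands u1 u2 D U), Num D, Num 0]
      (enc_cands (combine D j (cands u1 u2 D T) (cands u1 u2 D U)))
      (((60 * l + 150) * length (cands u1 u2 D U) + 60) * length (cands u1 u2 D T) + 10)"
      and inv: "Inv V (combine D j (cands u1 u2 D T) (cands u1 u2 D U))" by simp_all
    have "((60 * l + 150) * length (cands u1 u2 D U) + 60) * length (cands u1 u2 D T) + 10
        \<le> ((60 * l + 150) * l + 60) * l + 10"
      using T(3) U(3) by (intro add_mono mult_mono) auto
    then have "((60 * l + 150) * length (cands u1 u2 D U) + 60) * length (cands u1 u2 D T) + 10 \<le> cost_node l - 90"
      by (simp add: cost_node_def)
    note comb' = calls_mono[OF comb this]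
    have "90 \<le> cost_node l" by (simp add: cost_node_def)
    then have "calls prog M f_cands [Num D, Node (Num tag) (Node (enc_tree u1 u2 T) (enc_tree u1 u2 U))]
      (enc_cands (combine D j (cands u1 u2 D T) (cands u1 u2 D U)))
      ((2 * Suc (compositions T + compositions U) + 1) * cost_node l)"
      using \<open>tag > 0\<close>
      apply (simp add: calls_prog body_cands_def wp_simps)
      apply (rule wpc_if_calls[OF T(1)])
      apply (simp add: wp_simps)
      apply (rule wpc_if_calls[OF U(1)])
      apply (simp add: wp_simps)
      apply (rule wpc_if_calls[OF comb'])
      apply (simp add: algebra_simps)
      done
    then show ?thesis using inv len[OF V(1,2) inv] by (simp add: Inv_def)
  qed
  show ?thesis
    using assms(2,3)
  proof (induction T)
    case (Leaf a)
    have "2 \<le> l"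
    proof -
      have "2 * 1 \<le> (m + 1) * (b * (D + 1) + 1)\<^sup>2" using Leaf by (intro mult_le_mono) auto
      then show ?thesis by (simp add: l_def)
    qed
    moreover have "cands u1 u2 D (Leaf a) = [cand_of u1 u2 (Leaf a) {}, cand_of u1 u2 (Leaf a) {a}]"
      by (simp add: cand_of_def)
    moreover have "calls prog M f_cands [Num D, enc_tree u1 u2 (Leaf a)] (enc_cands (cands u1 u2 D (Leaf a)))
        ((2 * compositions (Leaf a) + 1) * cost_node l)"
      by (simp add: calls_prog body_cands_def wp_simps cost_node_def)
    ultimately show ?case by (simp del: cands.simps)
  next
    case (Par T U)
    then show ?case
      unfolding enc_tree.simps cands.simps compositions.simps
      by (intro node cand_of_join(1) calls_join_par M(2)) auto
  next
    case (Ser T U)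
    then show ?case
      unfolding enc_tree.simps cands.simps compositions.simps
      by (intro node cand_of_join(2) calls_join_ser M(2)) auto
  qed
qed

section \<open>Decomposition of the graph\<close>

definition edge_ends :: "edge multiset \<Rightarrow> (nat \<times> nat) multiset" where
  "edge_ends = image_mset (\<lambda>(a, b, T). (a, b))"

lemma edge_ends_simps [simp]:
  "edge_ends {#} = {#}" "edge_ends (add_mset (a, b, T) M) = add_mset (a, b) (edge_ends M)"
  "size (edge_ends M) = size M"
  by (simp_all add: edge_ends_def)

lemma edge_ends_eq_add_mset:
  assumes "edge_ends M = add_mset (a, b) N"
  obtains T M' where "M = add_mset (a, b, T) M'" "edge_ends M' = N"
  using msed_map_invR[OF assms[unfolded edge_ends_def]] by (auto simp: edge_ends_def)

text \<open>One step of the decomposition. Everything that has to be preserved is proved for this relation;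
the functions \<open>merge\<close>, \<open>merge_into\<close> and \<open>reduce\<close> are only shown to perform such a step whenever one exists.\<close>

inductive reduces :: "nat \<Rightarrow> nat \<Rightarrow> edge multiset \<Rightarrow> edge multiset \<Rightarrow> bool" for s t where
  parallel: "reduces s t (add_mset (a, b, T) (add_mset (a, b, U) M)) (add_mset (a, b, Par T U) M)"
| series: "\<lbrakk>v \<noteq> s; v \<noteq> t; a \<noteq> v; b \<noteq> v; v \<notin> ends (edge_ends M)\<rbrakk> \<Longrightarrow>
    reduces s t (add_mset (a, v, T) (add_mset (v, b, U) M)) (add_mset (a, b, Ser T U) M)"

lemma reduces_sp:
  assumes "reduces s t M N" "sp (edge_ends M) s t"
  shows "sp (edge_ends N) s t"
  using assms
proof cases
  case (parallel a b T U M')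
  then show ?thesis using sp_delete_parallel_edge[OF assms(2), of "(a, b)"] by simp
next
  case (series v a b M' T U)
  then show ?thesis using sp_contract_series_vertex[OF assms(2), of v a b] by simp
qed

lemma reduces_size: "reduces s t M N \<Longrightarrow> size M = Suc (size N)"
  by (induction rule: reduces.induct) simp_all

lemma reduces_ends: "reduces s t M N \<Longrightarrow> ends (edge_ends N) \<subseteq> ends (edge_ends M)"
  by (induction rule: reduces.induct) auto

text \<open>Multisets express that the leaves of all trees in the graph are preserved and that no arc is used
twice.\<close>

fun leaf_mset :: "tree \<Rightarrow> nat multiset" where
  "leaf_mset (Leaf a) = {#a#}"
| "leaf_mset (Par T U) = leaf_mset T + leaf_mset U"
| "leaf_mset (Ser T U) = leaf_mset T + leaf_mset U"

lemma set_leaf_mset [simp]: "set_mset (leaf_mset T) = leaves T"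
  by (induction T) auto

lemma leaf_disjoint_if_leaf_mset:
  assumes "\<And>a. count (leaf_mset T) a \<le> 1"
  shows "leaf_disjoint T"
proof -
  have disj: "leaves T \<inter> leaves U = {}" if "\<And>a. count (leaf_mset T + leaf_mset U) a \<le> 1" for T U
  proof (rule ccontr)
    assume "leaves T \<inter> leaves U \<noteq> {}"
    then obtain a where "a \<in># leaf_mset T" "a \<in># leaf_mset U" by auto
    then have "count (leaf_mset T) a > 0" "count (leaf_mset U) a > 0" by simp_all
    then show False using that[of a] unfolding count_union by linarith
  qed
  have sub: "count (leaf_mset T) a \<le> 1 \<and> count (leaf_mset U) a \<le> 1"
    if "\<And>a. count (leaf_mset T + leaf_mset U) a \<le> 1" for T U a
    using that[of a] by simp
  show ?thesis
    using assms
  proof (induction T)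
    case (Par T U)
    then show ?case using disj[of T U] sub[of T U] by auto
  next
    case (Ser T U)
    then show ?case using disj[of T U] sub[of T U] by auto
  qed simp
qed

definition all_leaves :: "edge multiset \<Rightarrow> nat multiset" where
  "all_leaves M = (\<Sum>(a, b, T)\<in>#M. leaf_mset T)"

lemma reduces_all_leaves: "reduces s t M N \<Longrightarrow> all_leaves N = all_leaves M"
  by (induction rule: reduces.induct) (simp_all add: all_leaves_def ac_simps)

definition capacities :: "(nat \<Rightarrow> nat) \<Rightarrow> nat set \<Rightarrow> edge multiset \<Rightarrow> nat cap_edge multiset" where
  "capacities u S = image_mset (\<lambda>(a, b, T). (a, b, real (tval u T S)))"

lemma edge_ends_capacities: "image_mset (\<lambda>(a, b, w). (a, b)) (capacities u S M) = edge_ends M"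
  unfolding capacities_def edge_ends_def image_mset.compositionality
  by (intro image_mset_cong) auto

lemma reduces_flow_values:
  assumes "reduces s t M N"
  shows "flow_values s t (capacities u S M) = flow_values s t (capacities u S N)"
  using assms
proof cases
  case (parallel a b T U M')
  then show ?thesis
    using flow_values_parallel[of "real (tval u T S)" "real (tval u U S)" s t a b "capacities u S M'"]
    by (simp add: capacities_def)
next
  case (series v a b M' T U)
  then have "v \<notin> ends (image_mset (\<lambda>(a, b, w). (a, b)) (capacities u S M'))"
    by (simp add: edge_ends_capacities)
  from flow_values_series[OF series(3-6) this, of "real (tval u T S)" "real (tval u U S)"] series(1,2)
  show ?thesis by (simp add: capacities_def of_nat_min)
qed

lemma deg_mset: "deg v es = (\<Sum>(a, b, T)\<in>#mset es. of_bool (a = v) + of_bool (b = v))"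
  by (simp add: deg_def flip: sum_mset_sum_list)

lemma deg_eq_2_iff:
  assumes "mset es = add_mset (a, v, T) (add_mset (v, b, U) M)"
  shows "deg v es = 2 \<longleftrightarrow> a \<noteq> v \<and> b \<noteq> v \<and> v \<notin> ends (edge_ends M)"
proof -
  let ?d = "\<Sum>(a, b, T)\<in>#M. of_bool (a = v) + of_bool (b = v) :: nat"
  have "deg v es = of_bool (a = v) + of_bool (b = v) + 2 + ?d" by (simp add: deg_mset assms)
  moreover have "?d = 0 \<longleftrightarrow> v \<notin> ends (edge_ends M)"
    by (fastforce simp: ends_def edge_ends_def split: prod.splits)
  ultimately show ?thesis by (auto simp: of_bool_def)
qed

lemma series_merge_reduces:
  assumes "series_merge s t es e f = Some g" "mset es = add_mset e (add_mset f M)"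
  shows "reduces s t (mset es) (add_mset g M)"
proof -
  obtain a b T c d U where ef: "e = (a, b, T)" "f = (c, d, U)" by (cases e; cases f)
  have "b = c" "b \<noteq> s" "b \<noteq> t" "deg b es = 2" "g = (a, d, Ser T U)"
    using assms(1) by (auto simp: ef split: if_splits)
  then show ?thesis using assms(2) deg_eq_2_iff[of es a b T d U M] unfolding ef
    by (auto intro: reduces.series)
qed

lemma merge_reduces:
  assumes "merge s t es e f = Some g" "mset es = add_mset e (add_mset f M)"
  shows "reduces s t (mset es) (add_mset g M)"
proof -
  obtain a b T c d U where ef: "e = (a, b, T)" "f = (c, d, U)" by (cases e; cases f)
  have es: "mset es = add_mset f (add_mset e M)" using assms(2) by simp
  show ?thesis
  proof (cases "a = c \<and> b = d")
    case True
    then show ?thesis using assms by (auto simp: ef intro: reduces.parallel)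
  next
    case False
    then have "series_merge s t es e f = Some g \<or> series_merge s t es f e = Some g"
      using assms(1) unfolding ef by (auto split: option.splits simp del: series_merge.simps)
    then show ?thesis using series_merge_reduces[OF _ assms(2)] series_merge_reduces[OF _ es] by blast
  qed
qed

lemma merge_into_Nil: "merge_into s t es e fs = [] \<Longrightarrow> f \<in> set fs \<Longrightarrow> merge s t es e f = None"
  by (induction fs) (auto split: option.splits list.splits)

lemma merge_into_not_Nil:
  "merge_into s t es e fs \<noteq> [] \<Longrightarrow> \<exists>f g M. merge s t es e f = Some g \<and>
     mset fs = add_mset f M \<and> mset (merge_into s t es e fs) = add_mset g M"
proof (induction fs)
  case (Cons f fs)
  show ?case
  proof (cases "merge s t es e f")
    case None
    then have ne: "merge_into s t es e fs \<noteq> []" using Cons.prems by (auto split: list.splits)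
    then have eq: "merge_into s t es e (f # fs) = f # merge_into s t es e fs"
      using None by (auto split: list.splits)
    from Cons.IH[OF ne] obtain f' g M where "merge s t es e f' = Some g" "mset fs = add_mset f' M"
      "mset (merge_into s t es e fs) = add_mset g M" by blast
    then show ?thesis unfolding eq by (intro exI[of _ f'] exI[of _ g] exI[of _ "add_mset f M"]) simp
  next
    case (Some g)
    then show ?thesis by (intro exI[of _ f] exI[of _ g] exI[of _ "mset fs"]) simp
  qed
qed simp

lemma reduce_Nil:
  "reduce s t es fs = [] \<Longrightarrow> fs = xs @ e # ys @ f # zs \<Longrightarrow> merge s t es e f = None"
proof (induction fs arbitrary: xs)
  case (Cons a fs)
  have nil: "merge_into s t es a fs = []" "reduce s t es fs = []"
    using Cons.prems(1) by (auto split: list.splits)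
  show ?case
  proof (cases xs)
    case Nil
    then show ?thesis using merge_into_Nil[OF nil(1)] Cons.prems(2) by auto
  next
    case (Cons x xs')
    then show ?thesis using Cons.IH[OF nil(2), of xs'] Cons.prems(2) by auto
  qed
qed simp

lemma reduce_not_Nil:
  "reduce s t es fs \<noteq> [] \<Longrightarrow> \<exists>e f g M. merge s t es e f = Some g \<and>
     mset fs = add_mset e (add_mset f M) \<and> mset (reduce s t es fs) = add_mset g M"
proof (induction fs)
  case (Cons e fs)
  show ?case
  proof (cases "merge_into s t es e fs = []")
    case True
    then have ne: "reduce s t es fs \<noteq> []" using Cons.prems by (auto split: list.splits)
    then have eq: "reduce s t es (e # fs) = e # reduce s t es fs"
      using True by (auto split: list.splits)
    from Cons.IH[OF ne] obtain e' f g M where "merge s t es e' f = Some g"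
      "mset fs = add_mset e' (add_mset f M)" "mset (reduce s t es fs) = add_mset g M" by blast
    then show ?thesis unfolding eq
      by (intro exI[of _ e'] exI[of _ f] exI[of _ g] exI[of _ "add_mset e M"]) simp
  next
    case False
    then have eq: "reduce s t es (e # fs) = merge_into s t es e fs" by (auto split: list.splits)
    from merge_into_not_Nil[OF False] obtain f g M where "merge s t es e f = Some g"
      "mset fs = add_mset f M" "mset (merge_into s t es e fs) = add_mset g M" by blast
    then show ?thesis unfolding eq
      by (intro exI[of _ e] exI[of _ f] exI[of _ g] exI[of _ M]) simp
  qed
qed simp

lemma merge_not_None_parallel: "merge s t es (a, b, T) (a, b, U) \<noteq> None"
  by simp

lemma merge_not_None_series:
  assumes "mset es = add_mset (a, v, T) (add_mset (v, b, U) M)" "v \<noteq> s" "v \<noteq> t" "a \<noteq> v" "b \<noteq> v"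
    "v \<notin> ends (edge_ends M)"
  shows "merge s t es (a, v, T) (v, b, U) \<noteq> None" "merge s t es (v, b, U) (a, v, T) \<noteq> None"
proof -
  have "deg v es = 2" using assms deg_eq_2_iff[OF assms(1)] by blast
  then have "series_merge s t es (a, v, T) (v, b, U) = Some (a, b, Ser T U)"
    using assms(2,3) by simp
  then show "merge s t es (a, v, T) (v, b, U) \<noteq> None" "merge s t es (v, b, U) (a, v, T) \<noteq> None"
    using assms(4,5) by (simp_all del: series_merge.simps split: option.split)
qed

lemma split_two:
  assumes "mset es = add_mset e (add_mset f M)"
  shows "\<exists>xs ys zs. es = xs @ e # ys @ f # zs \<or> es = xs @ f # ys @ e # zs"
proof -
  have "e \<in> set es" using assms by (metis set_mset_mset union_single_eq_member)
  then obtain xs ys where es: "es = xs @ e # ys" by (meson split_list)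
  then have "mset xs + mset ys = add_mset f M" using assms by simp
  then have "f \<in> set xs \<or> f \<in> set ys" by (metis set_mset_mset union_iff union_single_eq_member)
  then show ?thesis
  proof
    assume "f \<in> set xs"
    then obtain us vs where "xs = us @ f # vs" by (meson split_list)
    then show ?thesis using es by auto
  next
    assume "f \<in> set ys"
    then obtain us vs where "ys = us @ f # vs" by (meson split_list)
    then show ?thesis using es by auto
  qed
qed

lemma reduce_not_Nil_if_merge:
  assumes "mset es = add_mset e (add_mset f M)" "merge s t es e f \<noteq> None" "merge s t es f e \<noteq> None"
  shows "reduce s t es es \<noteq> []"
proof
  assume nil: "reduce s t es es = []"
  obtain xs ys zs where "es = xs @ e # ys @ f # zs \<or> es = xs @ f # ys @ e # zs"
    using split_two[OF assms(1)] by blast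
  then show False
    using reduce_Nil[OF nil, of xs e ys f zs] reduce_Nil[OF nil, of xs f ys e zs] assms(2,3) by metis
qed

text \<open>On a series-parallel graph with at least two arcs the search finds a pair of arcs to merge:
\<open>sp_reducible\<close> yields such a pair, and \<open>merge\<close> recognizes it in whichever order the list contains it.\<close>

lemma reduce_reduces:
  assumes "sp (edge_ends (mset es)) s t" "length es \<ge> 2"
  shows "reduces s t (mset es) (mset (reduce s t es es))"
proof -
  have "reduce s t es es \<noteq> []"
  proof -
    consider p where "count (edge_ends (mset es)) p \<ge> 2"
      | a v b where "v \<noteq> s" "v \<noteq> t" "series_vertex (edge_ends (mset es)) a v b"
      using sp_reducible[OF assms(1)] assms(2) by auto
    then show ?thesis
    proof cases
      case 1
      obtain a b where p: "p = (a, b)" by fastforce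
      have "add_mset p {#p#} \<subseteq># edge_ends (mset es)"
        using 1 by (auto simp: subseteq_mset_def)
      then obtain N where "edge_ends (mset es) = add_mset p {#p#} + N"
        by (auto simp only: mset_subset_eq_exists_conv)
      then have "edge_ends (mset es) = add_mset p (add_mset p N)" by simp
      then obtain T U M where "mset es = add_mset (a, b, T) (add_mset (a, b, U) M)"
        unfolding p by (metis edge_ends_eq_add_mset)
      then show ?thesis
        by (rule reduce_not_Nil_if_merge) (rule merge_not_None_parallel)+
    next
      case (2 a v b)
      have loops: "a \<noteq> v" "b \<noteq> v"
        using 2(3) sp_basic(6)[OF assms(1)] by (auto simp: series_vertex_def)
      then have "add_mset (a, v) {#(v, b)#} \<subseteq># edge_ends (mset es)"
        using 2(3) by (auto simp: series_vertex_def insert_subset_eq_iff in_diff_count)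
      then obtain N where "edge_ends (mset es) = add_mset (a, v) {#(v, b)#} + N"
        by (auto simp only: mset_subset_eq_exists_conv)
      then have N: "edge_ends (mset es) = add_mset (a, v) (add_mset (v, b) N)" by simp
      then obtain T U M where M: "mset es = add_mset (a, v, T) (add_mset (v, b, U) M)" "edge_ends M = N"
        by (metis edge_ends_eq_add_mset)
      have "v \<notin> ends N" using 2(3) N by (simp add: series_vertex_def)
      then show ?thesis
        using reduce_not_Nil_if_merge[OF M(1)] merge_not_None_series[OF M(1) 2(1,2) loops] M(2) by blast
    qed
  qed
  from reduce_not_Nil[OF this] obtain e f g M where "merge s t es e f = Some g"
    "mset es = add_mset e (add_mset f M)" "mset (reduce s t es es) = add_mset g M" by blast
  then show ?thesis using merge_reduces by metis
qed

lemma edges_bounded_iff: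
  "edges_bounded M es \<longleftrightarrow> 2 * length es + 2 \<le> M \<and> ends (edge_ends (mset es)) \<subseteq> {..M}"
  by (fastforce simp: edges_bounded_def ends_def edge_ends_def split: prod.splits)

text \<open>At the end a single arc from \<open>s\<close> to \<open>t\<close> is left, through which exactly the flow values from 0 to its
capacity are possible.\<close>

lemma calls_solve:
  assumes "sp (edge_ends (mset es)) s t" "edges_bounded M es" "s \<le> M" "t \<le> M" "length es \<le> n"
  shows "\<exists>T. calls prog M f_solve [enc_edges u1 u2 es, Num s, Num t] (enc_tree u1 u2 T) ((cost_reduce n + 50) * length es + 50)
    \<and> all_leaves (mset es) = leaf_mset T
    \<and> (\<forall>u S. flow_values s t (capacities u S (mset es)) = {0..real (tval u T S)})"
  using assms
proof (induction "length es" arbitrary: es rule: less_induct)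
  case less
  have "es \<noteq> []" using sp_basic(7)[OF less.prems(1)] by auto
  then obtain e es' where es: "es = e # es'" by (cases es) auto
  obtain a b T where e: "e = (a, b, T)" by (cases e) auto
  show ?case
  proof (cases "es' = []")
    case True
    then have ab: "a = s" "b = t" "s \<noteq> t" using less.prems(1) by (auto simp: es e sp_single)
    have "calls prog M f_solve [enc_edges u1 u2 es, Num s, Num t] (enc_tree u1 u2 T) ((cost_reduce n + 50) * length es + 50)"
      by (simp add: es e True calls_prog body_solve_def wp_simps)
    moreover have "all_leaves (mset es) = leaf_mset T" by (simp add: es e True all_leaves_def)
    moreover have "flow_values s t (capacities u S (mset es)) = {0..real (tval u T S)}" for u S
      using flow_values_single[OF ab(3)] by (simp add: es e True capacities_def ab)
    ultimately show ?thesis by blast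
  next
    case False
    then have len: "length es \<ge> 2" by (cases es') (auto simp: es)
    let ?r = "reduce s t es es"
    note red = reduce_reduces[OF less.prems(1) len]
    have size: "length es = Suc (length ?r)" using reduces_size[OF red] by simp
    have bound: "edges_bounded M ?r"
      using less.prems(2) reduces_ends[OF red] size by (auto simp: edges_bounded_iff)
    obtain U where U: "calls prog M f_solve [enc_edges u1 u2 ?r, Num s, Num t] (enc_tree u1 u2 U) ((cost_reduce n + 50) * length ?r + 50)"
      "all_leaves (mset ?r) = leaf_mset U"
      "\<And>u S. flow_values s t (capacities u S (mset ?r)) = {0..real (tval u U S)}"
      using less.hyps[of ?r] reduces_sp[OF red less.prems(1)] bound less.prems size by auto
    have 1: "calls prog M f_reduce [enc_edges u1 u2 es, enc_edges u1 u2 es, Num s, Num t] (enc_edges u1 u2 ?r) (cost_reduce n)"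
    proof (rule calls_mono[OF calls_reduce])
      show "(cost_merge_into (length es) + 50) * length es + 10 \<le> cost_reduce n"
        unfolding cost_reduce_def cost_merge_into_def cost_merge_def
        using less.prems(5) by (intro add_mono mult_mono) auto
    qed (use less.prems(2-4) in \<open>auto simp: edges_bounded_def\<close>)
    obtain f fs where f: "es' = f # fs" using False by (cases es') auto
    have enc: "enc_edges u1 u2 es = Node (enc_edge u1 u2 e) (Node (enc_edge u1 u2 f) (enc_edges u1 u2 fs))"
      by (simp add: es f)
    have "calls prog M f_solve [enc_edges u1 u2 es, Num s, Num t] (enc_tree u1 u2 U) ((cost_reduce n + 50) * length es + 50)"
      unfolding enc
      apply (simp add: calls_prog body_solve_def wp_simps)
      apply (rule wpc_if_calls[OF 1[unfolded enc]])
      apply (simp add: wp_simps)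
      apply (rule wpc_if_calls[OF U(1)])
      apply (simp add: size)
      done
    then show ?thesis
      using U reduces_all_leaves[OF red] reduces_flow_values[OF red] by metis
  qed
qed

section \<open>Polynomial bounds and the approximation scheme\<close>

lemma eval_if_calls:
  assumes "calls P M f vs v n"
  shows "\<exists>k. eval P vs (P ! f) v k \<and> k \<le> n * (1 + 2 * bitlength M)"
proof -
  obtain n' where "ev P M vs (P ! f) v n'" "n' \<le> n"
    using assms by (auto simp: calls_def wpc_def wp_def)
  moreover have "n' * (1 + 2 * bitlength M) \<le> n * (1 + 2 * bitlength M)"
    using \<open>n' \<le> n\<close> by (rule mult_right_mono) simp
  ultimately show ?thesis using eval_if_ev(1) order_trans by blast
qed

text \<open>The first argument stands for the size of the instance and the second for \<open>N\<close>, which exceeds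
\<open>y = 1 / \<epsilon>\<close> by at most 1. The closure properties prove a bound for any expression built
by addition and multiplication, whatever its degree.\<close>

definition poly_bounded :: "(nat \<Rightarrow> nat \<Rightarrow> nat) \<Rightarrow> bool" where
  "poly_bounded f \<longleftrightarrow> (\<exists>p. \<forall>x n y. 0 \<le> y \<longrightarrow> real n \<le> y + 1 \<longrightarrow> real (f x n) \<le> poly2 p (real x) y)"

lemma poly2_hom:
  "poly2 (p + q) x y = poly2 p x y + poly2 q x y"
  "poly2 (p * q) x y = poly2 p x y * poly2 q x y"
  "poly2 [:[:c:]:] x y = c" "poly2 [:[:0, 1:]:] x y = x" "poly2 [:1, 1:] x y = y + 1"
  by (simp_all add: poly2_def)

lemma poly_bounded_const: "poly_bounded (\<lambda>_ _. c)"
  unfolding poly_bounded_def by (intro exI[of _ "[:[:real c:]:]"]) (simp add: poly2_hom)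

lemma poly_bounded_size: "poly_bounded (\<lambda>x _. x)"
  unfolding poly_bounded_def by (intro exI[of _ "[:[:0, 1:]:]"]) (simp add: poly2_hom)

lemma poly_bounded_accuracy: "poly_bounded (\<lambda>_ n. n)"
  unfolding poly_bounded_def by (intro exI[of _ "[:1, 1:]"]) (simp add: poly2_hom)

lemma poly_bounded_add:
  assumes "poly_bounded f" "poly_bounded g"
  shows "poly_bounded (\<lambda>x n. f x n + g x n)"
proof -
  obtain p q where
    p: "\<And>x n y. 0 \<le> y \<Longrightarrow> real n \<le> y + 1 \<Longrightarrow> real (f x n) \<le> poly2 p (real x) y" and
    q: "\<And>x n y. 0 \<le> y \<Longrightarrow> real n \<le> y + 1 \<Longrightarrow> real (g x n) \<le> poly2 q (real x) y"
    using assms unfolding poly_bounded_def by blast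
  have "real (f x n + g x n) \<le> poly2 (p + q) (real x) y" if "0 \<le> y" "real n \<le> y + 1" for x n y
    unfolding poly2_hom of_nat_add using that by (intro add_mono p q)
  then show ?thesis unfolding poly_bounded_def by blast
qed

lemma poly_bounded_mult:
  assumes "poly_bounded f" "poly_bounded g"
  shows "poly_bounded (\<lambda>x n. f x n * g x n)"
proof -
  obtain p q where
    p: "\<And>x n y. 0 \<le> y \<Longrightarrow> real n \<le> y + 1 \<Longrightarrow> real (f x n) \<le> poly2 p (real x) y" and
    q: "\<And>x n y. 0 \<le> y \<Longrightarrow> real n \<le> y + 1 \<Longrightarrow> real (g x n) \<le> poly2 q (real x) y"
    using assms unfolding poly_bounded_def by blast
  have "real (f x n * g x n) \<le> poly2 (p * q) (real x) y" if "0 \<le> y" "real n \<le> y + 1" for x n y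
    unfolding poly2_hom of_nat_mult
    using p[OF that, of x] q[OF that, of x] by (intro mult_mono) auto
  then show ?thesis unfolding poly_bounded_def by blast
qed

lemmas poly_bounded_intros =
  poly_bounded_const poly_bounded_size poly_bounded_accuracy poly_bounded_add poly_bounded_mult

lemma data_size_in_list: "x \<in> set xs \<Longrightarrow> data_size x < data_size (enc_list xs)"
  by (induction xs) auto

lemma length_less_data_size: "length xs < data_size (enc_list xs)"
  by (induction xs) auto

lemma less_power_bitlength: "x < 2 ^ bitlength x"
  using floorlog_bounds[of x 2] by (cases "x = 0") (auto simp: bitlength_def)

lemma Num_in_list_less: "Num x \<in> set xs \<Longrightarrow> data_size (enc_list xs) \<le> X \<Longrightarrow> x < 2 ^ X"
  using data_size_in_list[of "Num x" xs] less_power_bitlength[of x]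
    power_increasing[of "bitlength x" X "2::nat"] by (auto intro: less_le_trans)

text \<open>Every number in the instance is a leaf of its encoding, hence at most as long as the encoding.\<close>

lemma instance_bounds:
  fixes I :: bmfni
  defines "X \<equiv> data_size (enc_instance I)"
  shows "num_arcs I < X" "source I < 2 ^ X" "sink I < 2 ^ X" "budget I < 2 ^ X"
    "\<And>a. a < num_arcs I \<Longrightarrow> tail (graph I) a < 2 ^ X \<and> head (graph I) a < 2 ^ X \<and> cap1 I a < 2 ^ X \<and> cap2 I a < 2 ^ X"
proof -
  let ?A = "map (enc_arc I) [0..<num_arcs I]"
  have X: "data_size (enc_instance I) \<le> X" by (simp add: X_def)
  note inst = X[unfolded enc_instance_def]
  show "source I < 2 ^ X" "sink I < 2 ^ X" "budget I < 2 ^ X"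
    by (rule Num_in_list_less[OF _ inst]; simp)+
  have A: "data_size (enc_list ?A) < X"
    unfolding X_def enc_instance_def by (rule data_size_in_list) simp
  show "num_arcs I < X" using length_less_data_size[of ?A] A by simp
  fix a assume "a < num_arcs I"
  then have "enc_arc I a \<in> set ?A" by simp
  from data_size_in_list[OF this] A have "data_size (enc_arc I a) \<le> X" by simp
  note arc = this[unfolded enc_arc_def]
  show "tail (graph I) a < 2 ^ X \<and> head (graph I) a < 2 ^ X \<and> cap1 I a < 2 ^ X \<and> cap2 I a < 2 ^ X"
    by (intro conjI; rule Num_in_list_less[OF _ arc]; simp)
qed

definition precision :: "nat \<Rightarrow> nat \<Rightarrow> nat" where
  "precision x n = 2 * (x * n)"

definition list_bound :: "nat \<Rightarrow> nat \<Rightarrow> nat \<Rightarrow> nat" where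
  "list_bound m b D = (m + 1) * (b * (D + 1) + 1)\<^sup>2"

definition cost_driver :: "nat \<Rightarrow> nat \<Rightarrow> nat" where
  "cost_driver m l = (10 * m + 10) + (50 * m + 10) + ((cost_reduce m + 50) * m + 50) +
     (2 * m + 1) * cost_node l + ((30 * m + 50) * l + 10) + 100"

text \<open>Numbers in the instance are below \<open>2 ^ X\<close>, flow values below \<open>2 ^ (2 * X)\<close>, and comparisons multiply
flow values by at most \<open>D + 1\<close>; the factor 4 absorbs small additive terms.\<close>

definition number_bound :: "nat \<Rightarrow> nat \<Rightarrow> nat" where
  "number_bound X D = (D + 1) * 2 ^ (2 * X + 2)"

text \<open>The tree \<open>T\<close> found by the run is exported together with what makes it a decomposition of the graph,
since the output is described in terms of it.\<close>

lemma calls_driver: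
  fixes I :: bmfni and N :: nat
  defines "m \<equiv> num_arcs I" and "X \<equiv> data_size (enc_instance I)"
  defines "D \<equiv> precision m N"
  assumes I: "bmfni_instance I" "two_terminal_sp (graph I) (source I) (sink I)" and N: "N > 0"
  shows "\<exists>T. leaf_disjoint T \<and> leaves T = {..<m} \<and> D > 0 \<and>
    set (cands (cap1 I) (cap2 I) D T) \<subseteq> cand_of (cap1 I) (cap2 I) T ` Pow {..<m} \<and>
    (\<forall>u S. flow_values (source I) (sink I) (capacities u S (image_mset (arc_edge I) (mset_set {..<m}))) =
      {0..real (tval u T S)}) \<and>
    calls prog (number_bound X D) f_driver [enc_instance I, Num N]
      (enc_list (map (\<lambda>(c, v1, v2, w). enc_list (map Num (bits m w)))
        (filter (\<lambda>(c, _). c \<le> budget I) (cands (cap1 I) (cap2 I) D T))))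
      (cost_driver m (list_bound m (2 * X) D))"
proof -
  define M where "M = number_bound X D"
  define es where "es = map (arc_edge I) [0..<m]"
  have arcs: "arcs (graph I) = {..<m}" using I(1) by (simp add: bmfni_instance_def m_def)
  have mset_es: "mset es = image_mset (arc_edge I) (mset_set {..<m})"
    by (simp add: es_def lessThan_atLeast0)
  have ends: "edge_ends (mset es) = graph_ends (graph I)"
    unfolding mset_es edge_ends_def graph_ends_def arcs image_mset.compositionality
    by (intro image_mset_cong) (simp add: arc_edge_def)
  have sp: "sp (edge_ends (mset es)) (source I) (sink I)"
    using two_terminal_sp_graph_ends[OF I(2)] unfolding ends by blast
  have "m > 0"
  proof (rule ccontr)
    assume "\<not> m > 0"
    then have "edge_ends (mset es) = {#}" by (simp add: es_def)
    then show False using sp_basic(7)[OF sp] by simp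
  qed
  then have D: "D > 0" using N by (simp add: D_def precision_def)
  have X: "2 ^ X * 2 ^ X * 4 = (2::nat) ^ (2 * X + 2)" by (simp add: power_add mult_2)
  have bounds: "m < X" "source I < 2 ^ X" "sink I < 2 ^ X" "budget I < 2 ^ X"
    "\<And>a. a < m \<Longrightarrow> tail (graph I) a < 2 ^ X \<and> head (graph I) a < 2 ^ X \<and> cap1 I a < 2 ^ X \<and> cap2 I a < 2 ^ X"
    using instance_bounds[where I = I] unfolding m_def X_def by blast+
  have "X < 2 ^ X" by simp
  have "m < 2 ^ X" using bounds(1) \<open>X < 2 ^ X\<close> by linarith
  have M1: "(D + 1) * k \<le> M" if "k \<le> 2 ^ X * 2 ^ X * 4" for k
    unfolding M_def number_bound_def using that X by (intro mult_left_mono) auto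
  have M2: "k \<le> M" if "k \<le> 2 ^ X * 2 ^ X * 4" for k
    using M1[OF that] by simp
  have "1 \<le> (2::nat) ^ X" by simp
  then have sq: "2 ^ X \<le> 2 ^ X * (2::nat) ^ X" by simp
  have M: "D + 1 \<le> M" "2 \<le> M" "m \<le> M" "(D + 1) * (m * 2 ^ X) \<le> M" "2 ^ m \<le> M" "2 ^ X \<le> M" "2 * m + 2 \<le> M" "m < M"
  proof -
    show "D + 1 \<le> M" using M1[of 1] by simp
    show "(D + 1) * (m * 2 ^ X) \<le> M"
      using \<open>m < 2 ^ X\<close> mult_right_mono[of m "2 ^ X" "2 ^ X"] by (intro M1) linarith
    have "(2::nat) ^ m \<le> 2 ^ X" using bounds(1) by (intro power_increasing) auto
    then show "2 ^ m \<le> M" using sq by (intro M2) linarith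
    show "2 \<le> M" "m \<le> M" "2 ^ X \<le> M" "2 * m + 2 \<le> M"
      using sq \<open>m < 2 ^ X\<close> \<open>1 \<le> 2 ^ X\<close> by (intro M2; linarith)+
    show "m < M" using \<open>2 * m + 2 \<le> M\<close> by simp
  qed
  have "m * N \<le> D" by (simp add: D_def precision_def)
  moreover have "N \<le> m * N" using \<open>m > 0\<close> by simp
  ultimately have NM: "N \<le> M" "m * N \<le> M" using M(1) by linarith+
  have es_bounded: "edges_bounded M es"
  proof -
    have "\<forall>a<m. tail (graph I) a \<le> M \<and> head (graph I) a \<le> M"
      using bounds(5) M(6) by (meson less_imp_le order_trans)
    then show ?thesis using M(7) by (auto simp: edges_bounded_def es_def arc_edge_def)
  qed
  have st: "source I \<le> M" "sink I \<le> M" "budget I \<le> M" using bounds M(6) by linarith+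
  obtain T where T: "calls prog M f_solve [enc_edges (cap1 I) (cap2 I) es, Num (source I), Num (sink I)]
      (enc_tree (cap1 I) (cap2 I) T) ((cost_reduce m + 50) * length es + 50)"
    "all_leaves (mset es) = leaf_mset T"
    "\<And>u S. flow_values (source I) (sink I) (capacities u S (mset es)) = {0..real (tval u T S)}"
    using calls_solve[OF sp es_bounded st(1,2), of m "cap1 I" "cap2 I"] by (auto simp: es_def)
  have "all_leaves (mset es) = mset_set {..<m}"
    unfolding mset_es all_leaves_def image_mset.compositionality
    by (simp add: comp_def arc_edge_def)
  then have leaf_mset: "leaf_mset T = mset_set {..<m}" using T(2) by simp
  then have leaves: "leaves T = {..<m}" using set_leaf_mset[of T] by simp
  have disj: "leaf_disjoint T"
    by (rule leaf_disjoint_if_leaf_mset) (simp add: leaf_mset count_mset_set')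
  have comp: "compositions T \<le> m" using card_leaves[OF disj] leaves by simp
  define l where "l = list_bound m (2 * X) D"
  have W: "m * 2 ^ X < 2 ^ (2 * X)" using \<open>m < 2 ^ X\<close> by (simp add: mult_2 power_add)
  have caps: "cap1 I a \<le> 2 ^ X \<and> cap2 I a \<le> 2 ^ X" if "a < m" for a
    using bounds(5)[OF that] by simp
  note cands = calls_cands[where ?u1.0 = "cap1 I" and ?u2.0 = "cap2 I", OF disj _ D caps W M(1-5), folded list_bound_def l_def, unfolded leaves, OF order_refl]
  let ?L = "cands (cap1 I) (cap2 I) D T"
  have c10: "calls prog M f_cands [Num D, enc_tree (cap1 I) (cap2 I) T] (enc_cands ?L) ((2 * m + 1) * cost_node l)"
    using comp by (intro calls_mono[OF conjunct1[OF cands]] mult_right_mono) auto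
  have sound: "set ?L \<subseteq> cand_of (cap1 I) (cap2 I) T ` Pow {..<m}" and len: "length ?L \<le> l"
    using cands by blast+
  have ok: "\<forall>x\<in>set ?L. cand_ok M D x"
  proof clarify
    fix c v1 v2 w assume "(c, v1, v2, w) \<in> set ?L"
    then have "(c, v1, v2, w) \<in> cand_of (cap1 I) (cap2 I) T ` Pow (leaves T)"
      using sound leaves by auto
    note b = cand_of_bounds[OF disj _ caps this, unfolded leaves, OF order_refl]
    have "(D + 1) * v1 \<le> (D + 1) * (m * 2 ^ X)" "(D + 1) * v2 \<le> (D + 1) * (m * 2 ^ X)"
      using b by (intro mult_left_mono; simp)+
    then show "cand_ok M D (c, v1, v2, w)" using b M unfolding cand_ok_iff by linarith
  qed
  let ?A = "map (enc_arc I) [0..<m]"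
  have c15: "calls prog M f_output [Num (budget I), enc_list ?A, enc_cands ?L]
    (enc_list (map (\<lambda>(c, v1, v2, w). enc_list (map Num (bits m w))) (filter (\<lambda>(c, _). c \<le> budget I) ?L)))
    ((30 * m + 50) * l + 10)"
  proof -
    have "(30 * m + 50) * length ?L + 10 \<le> (30 * m + 50) * l + 10"
      using len by (intro add_mono mult_left_mono) auto
    then show ?thesis using calls_mono[OF calls_output[OF M(2) st(3) ok, of ?A]] by simp
  qed
  have c2: "calls prog M f_length [enc_list ?A] (Num m) (10 * m + 10)"
    using calls_length[of ?A M] M(8) by simp
  have c3: "calls prog M f_init [enc_list ?A, Num 1] (enc_edges (cap1 I) (cap2 I) es) (50 * m + 10)"
    using calls_init[OF M(5,2), where i = 0 and I = I] by (simp add: es_def)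
  have c9: "calls prog M f_solve [enc_edges (cap1 I) (cap2 I) es, Num (source I), Num (sink I)]
      (enc_tree (cap1 I) (cap2 I) T) ((cost_reduce m + 50) * m + 50)"
    using T(1) by (simp add: es_def)
  have "calls prog M f_driver [enc_instance I, Num N]
      (enc_list (map (\<lambda>(c, v1, v2, w). enc_list (map Num (bits m w)))
        (filter (\<lambda>(c, _). c \<le> budget I) ?L))) (cost_driver m l)"
    using M NM
    apply (simp add: calls_prog body_driver_def wp_simps enc_instance_def flip: m_def)
    apply (rule wpc_if_calls[OF c2])
    apply (simp add: wp_simps)
    apply (rule wpc_if_calls[OF c3[unfolded One_nat_def]])
    apply (simp add: wp_simps)
    apply (rule wpc_if_calls[OF c9])
    apply (simp add: wp_simps)
    apply (rule wpc_if_calls[OF c10[unfolded D_def precision_def]])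
    apply (simp add: wp_simps)
    apply (rule wpc_if_calls[OF c15[unfolded D_def precision_def]])
    apply (simp add: cost_driver_def D_def precision_def)
    done
  then show ?thesis using disj leaves D sound T(3) unfolding M_def l_def mset_es by blast
qed


lemma poly_bounded_cost:
  "poly_bounded (\<lambda>X N. cost_driver X (list_bound X (2 * X) (precision X N)) * (2 * (precision X N + 2 * X + 4) + 1))"
  unfolding cost_driver_def list_bound_def precision_def cost_reduce_def cost_merge_into_def cost_merge_def
    cost_node_def power2_eq_square
  by (intro poly_bounded_intros)

lemma cost_mono:
  assumes "m \<le> X"
  shows "cost_driver m (list_bound m (2 * X) (precision m N)) * (2 * (precision m N + 2 * X + 4) + 1)
    \<le> cost_driver X (list_bound X (2 * X) (precision X N)) * (2 * (precision X N + 2 * X + 4) + 1)"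
proof -
  have D: "precision m N \<le> precision X N" using assms by (simp add: precision_def)
  then have l: "list_bound m (2 * X) (precision m N) \<le> list_bound X (2 * X) (precision X N)"
    unfolding list_bound_def using assms by (intro mult_mono power_mono add_mono) auto
  have "cost_driver m (list_bound m (2 * X) (precision m N)) \<le> cost_driver X (list_bound X (2 * X) (precision X N))"
    unfolding cost_driver_def cost_reduce_def cost_merge_into_def cost_merge_def cost_node_def
    using assms l by (intro mult_mono add_mono) auto
  then show ?thesis using D by (intro mult_mono) auto
qed

lemma bitlength_number_bound: "bitlength (number_bound X D) \<le> D + 2 * X + 4"
proof -
  have "D + 1 < 2 ^ (D + 1)" by (rule less_exp)
  then have "number_bound X D < 2 ^ (D + 1) * 2 ^ (2 * X + 2)"
    unfolding number_bound_def by (rule mult_strict_right_mono) simp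
  also have "\<dots> = 2 ^ (D + 2 * X + 3)" by (simp add: power_add)
  also have "\<dots> \<le> 2 ^ (D + 2 * X + 4)" by (rule power_increasing) auto
  finally show ?thesis unfolding bitlength_def by (intro floorlog_leI) auto
qed

text \<open>The induction step loses \<open>(2 * k * x) * x\<close>, which is at most \<open>x\<close> by the assumption on \<open>k * x\<close>.\<close>

lemma power_one_plus_le:
  fixes x :: real
  assumes "0 \<le> x" "2 * real k * x \<le> 1"
  shows "(1 + x) ^ k \<le> 1 + 2 * real k * x"
  using assms(2)
proof (induction k)
  case (Suc k)
  have le: "2 * real k * x \<le> 1" using Suc.prems assms(1) by (simp add: algebra_simps)
  have "(1 + x) ^ Suc k \<le> (1 + x) * (1 + 2 * real k * x)"
    using Suc.IH[OF le] assms(1) by (simp add: mult_left_mono)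
  also have "\<dots> = 1 + 2 * real k * x + x + (2 * real k * x) * x" by (simp add: algebra_simps)
  also have "\<dots> \<le> 1 + 2 * real k * x + x + 1 * x"
    using mult_right_mono[OF le assms(1)] by simp
  finally show ?case by (simp add: algebra_simps)
qed simp

lemma precision_error:
  assumes "D ^ k * v \<le> (D + 1) ^ k * t" "D = precision m N" "k \<le> m" "m > 0" "N > 0"
  shows "real v \<le> (1 + 1 / real N) * real t"
proof -
  have D: "real D > 0" using assms(2,4,5) by (simp add: precision_def)
  have "2 * real k * (1 / real D) = real k / real m * (1 / real N)"
    using assms(2,4,5) by (simp add: precision_def field_simps)
  also have "\<dots> \<le> 1 * (1 / real N)" using assms(3,4) by (intro mult_right_mono) auto
  finally have k: "2 * real k * (1 / real D) \<le> 1 / real N" by simp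
  then have "2 * real k * (1 / real D) \<le> 1" using assms(5) by (smt (verit) divide_le_eq_1 of_nat_0_less_iff of_nat_1 of_nat_le_iff Suc_leI One_nat_def)
  then have "(1 + 1 / real D) ^ k \<le> 1 + 1 / real N"
    using power_one_plus_le[of "1 / real D" k] k by simp
  have "real (D ^ k * v) \<le> real ((D + 1) ^ k * t)" using assms(1) by (rule of_nat_mono)
  then have "real D ^ k * real v \<le> (real D + 1) ^ k * real t" by (simp add: add.commute)
  then have "real v \<le> ((real D + 1) / real D) ^ k * real t"
    using D by (simp add: power_divide field_simps)
  also have "(real D + 1) / real D = 1 + 1 / real D" using D by (simp add: field_simps)
  also have "(1 + 1 / real D) ^ k * real t \<le> (1 + 1 / real N) * real t"
    using \<open>(1 + 1 / real D) ^ k \<le> 1 + 1 / real N\<close> by (rule mult_right_mono) simp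
  finally show ?thesis .
qed

definition strategy_of :: "nat \<Rightarrow> nat set \<Rightarrow> nat \<Rightarrow> nat" where
  "strategy_of m S = (\<lambda>a\<in>{..<m}. if a \<in> S then 1 else 0)"

lemma bits_set_encode:
  assumes "finite S"
  shows "bits m (set_encode S) = map (strategy_of m S) [0..<m]"
proof -
  \<comment> \<open>generalized to the digits from position \<open>i\<close> on\<close>
  have gen: "bits n (w div 2 ^ i) = map (\<lambda>a. if a \<in> set_decode w then 1 else 0) [i..<i + n]" for n w i
  proof (induction n arbitrary: i)
    case (Suc n)
    have "w div 2 ^ i div 2 = w div 2 ^ Suc i" by (metis div_mult2_eq power_Suc2)
    moreover have "(w div 2 ^ i) mod 2 = (if i \<in> set_decode w then 1 else 0)"
      by (auto simp: set_decode_def odd_iff_mod_2_eq_one)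
    moreover have "[i..<i + Suc n] = i # [Suc i..<Suc i + n]" by (simp add: upt_conv_Cons)
    ultimately show ?case using Suc.IH[of "Suc i"] by simp
  qed simp
  have "bits m (set_encode S) = map (\<lambda>a. if a \<in> S then 1 else 0) [0..<m]"
    using gen[of m "set_encode S" 0] assms by simp
  then show ?thesis by (auto simp: strategy_of_def)
qed

lemma interdicted_arcs_strategy_of:
  assumes "arcs (graph I) = {..<m}" "S \<subseteq> {..<m}"
  shows "interdicted_arcs I (strategy_of m S) = S"
  using assms by (auto simp: interdicted_arcs_def strategy_of_def split: if_splits)

lemma strategies_unit_cost:
  assumes "arcs (graph I) = {..<m}" "\<forall>a\<in>arcs (graph I). icost I a = 1"
  shows "\<gamma> \<in> strategies I \<longleftrightarrow> \<gamma> \<in> {..<m} \<rightarrow>\<^sub>E {0, 1} \<and> card (interdicted_arcs I \<gamma>) \<le> budget I"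
proof -
  have "(\<Sum>a\<in>arcs (graph I). icost I a * \<gamma> a) = card (interdicted_arcs I \<gamma>)"
    if "\<gamma> \<in> {..<m} \<rightarrow>\<^sub>E {0, 1}"
  proof -
    have "(\<Sum>a\<in>arcs (graph I). icost I a * \<gamma> a) = (\<Sum>a<m. if \<gamma> a = 1 then 1 else 0)"
      using that assms by (intro sum.cong) (auto dest!: PiE_mem[of \<gamma>])
    also have "\<dots> = card (interdicted_arcs I \<gamma>)"
      by (simp add: interdicted_arcs_def assms(1) Int_def flip: sum.inter_filter)
    finally show ?thesis .
  qed
  then show ?thesis using assms by (auto simp: strategies_def)
qed

lemma val_eq_tval:
  fixes I :: bmfni
  assumes I: "bmfni_instance I" and m: "arcs (graph I) = {..<m}"
    and flow: "\<And>u S. flow_values (source I) (sink I) (capacities u S (image_mset (arc_edge I) (mset_set {..<m}))) =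
      {0..real (tval u T S)}"
  shows "val I \<gamma> = (real (tval (cap1 I) T (interdicted_arcs I \<gamma>)), real (tval (cap2 I) T (interdicted_arcs I \<gamma>)))"
proof -
  have "max_flow (interdicted_graph I \<gamma>) (source I) (sink I) (\<lambda>a. real (u a)) = real (tval u T (interdicted_arcs I \<gamma>))" for u
  proof -
    let ?S = "interdicted_arcs I \<gamma>"
    have caps: "image_mset (\<lambda>a. (tail (graph I) a, head (graph I) a, if a \<in> ?S then 0 else real (u a))) (mset_set {..<m})
        = capacities u ?S (image_mset (arc_edge I) (mset_set {..<m}))"
      unfolding capacities_def image_mset.compositionality by (intro image_mset_cong) (simp add: arc_edge_def)
    have "max_flow (interdicted_graph I \<gamma>) (source I) (sink I) (\<lambda>a. real (u a)) = Sup {0..real (tval u T ?S)}"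
      unfolding interdicted_graph_def
      using I max_flow_eq_Sup_flow_values[of "graph I" "source I" "\<lambda>a. real (u a)" ?S "sink I"]
      by (simp add: bmfni_instance_def m caps flow)
    then show ?thesis by simp
  qed
  then show ?thesis by (simp add: val_def)
qed

text \<open>The main function is evaluated with exact costs because its division reads \<open>p\<close> and \<open>q\<close>, which no
bound in terms of the instance and \<open>1 / \<epsilon>\<close> covers.\<close>

lemma eval_main:
  assumes "calls prog M f_driver [inst, Num (q div p + 1)] v n" "p > 0"
  shows "\<exists>k. runs prog (Node inst (Node (Num p) (Num q))) v k \<and>
    k \<le> 20 + 2 * data_size (Node (Num p) (Num q)) + n * (1 + 2 * bitlength M)"
proof -
  obtain k where k: "eval prog [inst, Num (q div p + 1)] (prog ! f_driver) v k" "k \<le> n * (1 + 2 * bitlength M)"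
    using eval_if_calls[OF assms(1)] by blast
  let ?E = "[Node inst (Node (Num p) (Num q))]"
  have var: "eval prog ?E (Var 0) (?E ! 0) 1" by (rule eval_Var) simp
  then have v0: "eval prog ?E (Var 0) (Node inst (Node (Num p) (Num q))) 1" by simp
  note r = eval_Right[OF v0]
  note arg = eval_Arith[where b = Add, OF eval_Arith[where b = Div, OF eval_Right[OF r] eval_Left[OF r]] eval_Lit[of _ _ 1]]
  note main = eval_Call[where f = f_driver, OF _ evals_Cons[OF eval_Left[OF v0] evals_Cons[OF arg evals_Nil]], unfolded arith_op.simps, OF _ k(1)]
  have "bitlength (q div p) \<le> bitlength q" by (intro bitlength_mono div_le_dividend)
  moreover have "bitlength 1 = 1" by (simp add: bitlength_def floorlog_def)
  ultimately show ?thesis using main k(2)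
    unfolding runs_def by (intro exI conjI) (auto simp: prog_def body_main_def numeral_eq_Suc)
qed


lemma pos_rat_reciprocal:
  assumes "\<epsilon> > 0"
  obtains p q where "enc_pos_rat \<epsilon> = Node (Num p) (Num q)" "p > 0"
    "real (q div p + 1) \<le> 1 / of_rat \<epsilon> + 1" "1 / real (q div p + 1) \<le> of_rat \<epsilon>"
proof -
  obtain a b where ab: "quotient_of \<epsilon> = (a, b)" by fastforce
  have b: "b > 0" using quotient_of_denom_pos[OF ab] .
  have \<epsilon>: "\<epsilon> = of_int a / of_int b" using quotient_of_div[OF ab] .
  then have a: "a > 0" using assms b by (simp add: zero_less_divide_iff)
  define p q where "p = nat a" and "q = nat b"
  have pq: "p > 0" "q > 0" using a b by (simp_all add: p_def q_def)
  have "(of_rat \<epsilon> :: real) = of_int a / of_int b" by (simp add: \<epsilon> of_rat_divide)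
  then have \<epsilon>': "of_rat \<epsilon> = real p / real q" using a b by (simp add: p_def q_def)
  have "real (q div p) * real p \<le> real q"
    by (metis div_times_less_eq_dividend of_nat_le_iff of_nat_mult)
  then have "real (q div p) \<le> real q / real p" using pq(1) by (simp add: field_simps)
  then have 1: "real (q div p + 1) \<le> 1 / of_rat \<epsilon> + 1" by (simp add: \<epsilon>')
  have "q = p * (q div p) + q mod p" by simp
  moreover have "q mod p < p" using pq(1) by simp
  ultimately have "q \<le> p * (q div p + 1)" by (simp only: distrib_left)
  then have "real q \<le> real p * real (q div p + 1)" by (metis of_nat_le_iff of_nat_mult)
  then have 2: "1 / real (q div p + 1) \<le> of_rat \<epsilon>"
    unfolding \<epsilon>' using pq by (simp add: field_simps)
  have "enc_pos_rat \<epsilon> = Node (Num p) (Num q)" by (simp add: enc_pos_rat_def ab p_def q_def)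
  from that[OF this pq(1) 1 2] show thesis .
qed

theorem corollary5:
  shows "\<exists>P. bmfni_fptas
    {I. bmfni_instance I \<and>
        two_terminal_sp (graph I) (source I) (sink I) \<and>
        (\<forall>a\<in>arcs (graph I). icost I a = 1)} P"
proof
  define cost where "cost X N =
    cost_driver X (list_bound X (2 * X) (precision X N)) * (2 * (precision X N + 2 * X + 4) + 1)" for X N
  have "poly_bounded cost" unfolding cost_def by (rule poly_bounded_cost)
  then obtain p where p: "\<And>x n y. 0 \<le> y \<Longrightarrow> real n \<le> y + 1 \<Longrightarrow> real (cost x n) \<le> poly2 p (real x) y"
    unfolding poly_bounded_def by blast
  show "bmfni_fptas {I. bmfni_instance I \<and> two_terminal_sp (graph I) (source I) (sink I) \<and>
      (\<forall>a\<in>arcs (graph I). icost I a = 1)} prog"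
    unfolding bmfni_fptas_def
    \<comment> \<open>the main function itself costs at most 20 and twice the length of the encoding of \<open>\<epsilon>\<close>\<close>
  proof (intro exI[of _ "p + [:[:20:]:]"] exI[of _ "2 :: real"] ballI allI impI)
    fix I :: bmfni and \<epsilon> :: rat
    assume "I \<in> {I. bmfni_instance I \<and> two_terminal_sp (graph I) (source I) (sink I) \<and>
      (\<forall>a\<in>arcs (graph I). icost I a = 1)}" and "\<epsilon> > 0"
    then have I: "bmfni_instance I" "two_terminal_sp (graph I) (source I) (sink I)"
      "\<forall>a\<in>arcs (graph I). icost I a = 1" by auto
    obtain a b where ab: "enc_pos_rat \<epsilon> = Node (Num a) (Num b)" "a > 0"
      "real (b div a + 1) \<le> 1 / of_rat \<epsilon> + 1" "1 / real (b div a + 1) \<le> of_rat \<epsilon>"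
      using pos_rat_reciprocal[OF \<open>\<epsilon> > 0\<close>] .
    define N where "N = b div a + 1"
    define m where "m = num_arcs I"
    define X where "X = data_size (enc_instance I)"
    define D where "D = precision m N"
    have "N > 0" by (simp add: N_def)
    have arcs: "arcs (graph I) = {..<m}" using I(1) by (simp add: bmfni_instance_def m_def)
    obtain T where T: "leaf_disjoint T" "leaves T = {..<m}" "D > 0"
      "set (cands (cap1 I) (cap2 I) D T) \<subseteq> cand_of (cap1 I) (cap2 I) T ` Pow {..<m}"
      "\<forall>u S. flow_values (source I) (sink I) (capacities u S (image_mset (arc_edge I) (mset_set {..<m}))) =
        {0..real (tval u T S)}"
      and calls: "calls prog (number_bound X D) f_driver [enc_instance I, Num (b div a + 1)]
        (enc_list (map (\<lambda>(c, v1, v2, w). enc_list (map Num (bits m w)))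
          (filter (\<lambda>(c, _). c \<le> budget I) (cands (cap1 I) (cap2 I) D T))))
        (cost_driver m (list_bound m (2 * X) D))"
      using calls_driver[OF I(1,2) \<open>N > 0\<close>] unfolding m_def X_def D_def N_def by blast
    define L where "L = filter (\<lambda>(c, _). c \<le> budget I) (cands (cap1 I) (cap2 I) D T)"
    define \<gamma>s where "\<gamma>s = map (\<lambda>(c, v1, v2, w). strategy_of m (set_decode w)) L"
    have L: "\<exists>S\<subseteq>{..<m}. x = cand_of (cap1 I) (cap2 I) T S \<and> card S \<le> budget I" if "x \<in> set L" for x
    proof -
      have "x \<in> cand_of (cap1 I) (cap2 I) T ` Pow {..<m}" and c: "case x of (c, _) \<Rightarrow> c \<le> budget I"
        using that subsetD[OF T(4), of x] by (simp_all add: L_def)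
      then obtain S where S: "S \<subseteq> {..<m}" "x = cand_of (cap1 I) (cap2 I) T S" by blast
      with c have "card S \<le> budget I" by (simp add: cand_of_def)
      with S show ?thesis by blast
    qed
    have fin: "finite S" if "S \<subseteq> {..<m}" for S using that finite_subset by blast
    have out: "map (\<lambda>(c, v1, v2, w). enc_list (map Num (bits m w))) L = map (enc_strategy I) \<gamma>s"
      unfolding \<gamma>s_def map_map
    proof (rule map_cong[OF refl])
      fix x assume "x \<in> set L"
      from L[OF this] obtain S where S: "S \<subseteq> {..<m}" "x = cand_of (cap1 I) (cap2 I) T S" by blast
      then show "(\<lambda>(c, v1, v2, w). enc_list (map Num (bits m w))) x =
          (enc_strategy I \<circ> (\<lambda>(c, v1, v2, w). strategy_of m (set_decode w))) x"
        using bits_set_encode[OF fin[OF S(1)], of m] fin[OF S(1)]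
        by (simp add: cand_of_def enc_strategy_def comp_def flip: m_def)
    qed
    have val: "val I \<gamma> = (real (tval (cap1 I) T (interdicted_arcs I \<gamma>)), real (tval (cap2 I) T (interdicted_arcs I \<gamma>)))" for \<gamma>
      by (rule val_eq_tval[OF I(1) arcs T(5)[rule_format]])
    have int: "interdicted_arcs I (strategy_of m S) = S" if "S \<subseteq> {..<m}" for S
      by (rule interdicted_arcs_strategy_of[OF arcs that])
    note strategies = strategies_unit_cost[OF arcs I(3)]
    have "eps_approximation I (of_rat \<epsilon>) (set \<gamma>s)"
      unfolding eps_approximation_def
    proof (intro conjI subsetI ballI)
      fix \<gamma> assume "\<gamma> \<in> set \<gamma>s"
      then obtain x where x: "x \<in> set L" "\<gamma> = (\<lambda>(c, v1, v2, w). strategy_of m (set_decode w)) x"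
        by (auto simp: \<gamma>s_def)
      from L[OF x(1)] obtain S where S: "S \<subseteq> {..<m}" "x = cand_of (cap1 I) (cap2 I) T S" "card S \<le> budget I" by blast
      have "\<gamma> = strategy_of m S" using x(2) S(2) fin[OF S(1)] by (simp add: cand_of_def)
      then show "\<gamma> \<in> strategies I"
        using S(3) int[OF S(1)] by (auto simp: strategies strategy_of_def)
    next
      fix \<gamma> assume \<gamma>: "\<gamma> \<in> strategies I"
      define S where "S = interdicted_arcs I \<gamma>"
      have S: "S \<subseteq> {..<m}" by (auto simp: S_def interdicted_arcs_def arcs)
      have card: "card S \<le> budget I" using \<gamma> by (simp add: strategies S_def)
      obtain x where x: "x \<in> set (cands (cap1 I) (cap2 I) D T)"
        "approx D (compositions T) x (cand_of (cap1 I) (cap2 I) T S)"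
        using cands_complete[OF T(1), of S] S T(2) by blast
      then obtain S' where S': "S' \<subseteq> {..<m}" "x = cand_of (cap1 I) (cap2 I) T S'" using T(4) by blast
      have ap: "card S' \<le> card S"
        "D ^ compositions T * tval (cap1 I) T S' \<le> (D + 1) ^ compositions T * tval (cap1 I) T S"
        "D ^ compositions T * tval (cap2 I) T S' \<le> (D + 1) ^ compositions T * tval (cap2 I) T S"
        using x(2) unfolding S'(2) by (simp_all add: cand_of_def)
      have m: "compositions T \<le> m" "m > 0" using card_leaves[OF T(1)] T(2) by auto
      have le: "real v \<le> (1 + of_rat \<epsilon>) * real t"
        if "D ^ compositions T * v \<le> (D + 1) ^ compositions T * t" for v t
      proof -
        have "real v \<le> (1 + 1 / real N) * real t"
          by (rule precision_error[OF that D_def m \<open>N > 0\<close>])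
        also have "\<dots> \<le> (1 + of_rat \<epsilon>) * real t"
          using ab(4) unfolding N_def by (intro mult_right_mono) auto
        finally show ?thesis .
      qed
      have "x \<in> set L" using x(1) S'(2) ap(1) card by (auto simp: L_def cand_of_def)
      moreover have "(\<lambda>(c, v1, v2, w). strategy_of m (set_decode w)) x = strategy_of m S'"
        using S'(2) fin[OF S'(1)] by (simp add: cand_of_def)
      ultimately have "strategy_of m S' \<in> set \<gamma>s" unfolding \<gamma>s_def by force
      moreover have "eps_approximates I (of_rat \<epsilon>) (strategy_of m S') \<gamma>"
        unfolding eps_approximates_def val int[OF S'(1)] fst_conv snd_conv S_def[symmetric]
        using le[OF ap(2)] le[OF ap(3)] by blast
      ultimately show "\<exists>\<alpha>\<in>set \<gamma>s. eps_approximates I (of_rat \<epsilon>) \<alpha> \<gamma>" by blast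
    qed
    moreover obtain k where k: "runs prog (Node (enc_instance I) (enc_pos_rat \<epsilon>)) (enc_list (map (enc_strategy I) \<gamma>s)) k"
      "k \<le> 20 + 2 * data_size (enc_pos_rat \<epsilon>) +
        cost_driver m (list_bound m (2 * X) D) * (1 + 2 * bitlength (number_bound X D))"
      using eval_main[OF calls ab(2), folded L_def] unfolding out ab(1) by blast
    have "real k \<le> poly2 (p + [:[:20:]:]) (real X) (1 / of_rat \<epsilon>) + 2 * real (data_size (enc_pos_rat \<epsilon>))"
    proof -
      have "cost_driver m (list_bound m (2 * X) D) * (1 + 2 * bitlength (number_bound X D))
          \<le> cost_driver m (list_bound m (2 * X) D) * (2 * (D + 2 * X + 4) + 1)"
        using bitlength_number_bound[of X D] by (intro mult_left_mono) auto
      also have "\<dots> \<le> cost X N"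
        unfolding cost_def D_def using instance_bounds(1)[of I] by (intro cost_mono) (simp add: m_def X_def)
      finally have "k \<le> 20 + 2 * data_size (enc_pos_rat \<epsilon>) + cost X N" using k(2) by linarith
      then have "real k \<le> 20 + 2 * real (data_size (enc_pos_rat \<epsilon>)) + real (cost X N)"
        by linarith
      moreover have "real (cost X N) \<le> poly2 p (real X) (1 / of_rat \<epsilon>)"
        using ab(3) \<open>\<epsilon> > 0\<close> by (intro p) (simp_all add: N_def)
      ultimately show ?thesis by (simp add: poly2_hom)
    qed
    ultimately show "\<exists>\<gamma>s k. runs prog (Node (enc_instance I) (enc_pos_rat \<epsilon>)) (enc_list (map (enc_strategy I) \<gamma>s)) k \<and>
        eps_approximation I (of_rat \<epsilon>) (set \<gamma>s) \<and>
        real k \<le> poly2 (p + [:[:20:]:]) (real (data_size (enc_instance I))) (1 / of_rat \<epsilon>)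
          + 2 * real (data_size (enc_pos_rat \<epsilon>))"
      using k(1) unfolding X_def by blast
  qed
qed

end
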